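(* For every triangle-free graph $G$, all $(\chi'(G)+1)$-edge-colourings of $G$ are Kempe-equivalent.
   Context: Graphs are finite and simple. A $k$-edge-colouring of $G$ is a proper edge-colouring with colours in $\{1,\ldots,k\}$, i.e. a map $E(G)\to\{1,\ldots,k\}$ giving distinct colours to any two distinct edges sharing an endpoint (not every colour has to be used). The chromatic index $\chi'(G)$ is the smallest integer $k$ such that $G$ admits a $k$-edge-colouring. Given a $k$-edge-colouring, a Kempe chain is a maximal connected bicoloured subgraph, i.e. a connected component of the subgraph formed by all edges coloured $c$ or $d$, for two distinct colours $c,d\in\{1,\ldots,k\}$; it may consist of a single edge (coloured $c$, when $d$ appears on no edge incident to it). A Kempe change consists in selecting a Kempe chain and swapping its two colours $c$ and $d$ on it. Two $k$-edge-colourings are Kempe-equivalent if one can be reached from the other through a finite (possibly empty) series of Kempe changes using colours from $\{1,\ldots,k\}$. *)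

theory Defs
  imports "HOL-Library.Ramsey" "HOL-Combinatorics.Transposition"
begin

text \<open>A graph is given by a vertex set and a set of two-element vertex sets.\<close>

definition finite_simple_graph :: "'a set \<Rightarrow> 'a set set \<Rightarrow> bool" where
  "finite_simple_graph V E \<longleftrightarrow> finite V \<and> E \<subseteq> [V]\<^bsup>2\<^esup>"

definition triangle_free :: "'a set set \<Rightarrow> bool" where
  "triangle_free E \<longleftrightarrow>
     \<not> (\<exists>x y z. x \<noteq> y \<and> y \<noteq> z \<and> x \<noteq> z \<and> {x, y} \<in> E \<and> {y, z} \<in> E \<and> {x, z} \<in> E)"

text \<open>
  Colourings are extensional functions (with value \<^const>\<open>undefined\<close> off \<open>E\<close>), so that
  equality of functions is equality of colourings.
\<close>

definition edge_colouring :: "'a set set \<Rightarrow> nat \<Rightarrow> ('a set \<Rightarrow> nat) \<Rightarrow> bool" where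
  "edge_colouring E k f \<longleftrightarrow>
     f \<in> E \<rightarrow>\<^sub>E {1..k} \<and>
     (\<forall>e\<in>E. \<forall>e'\<in>E. e \<noteq> e' \<and> e \<inter> e' \<noteq> {} \<longrightarrow> f e \<noteq> f e')"

definition chromatic_index :: "'a set set \<Rightarrow> nat" where
  "chromatic_index E = (LEAST k. \<exists>f. edge_colouring E k f)"

text \<open>
  Connectedness of the subgraph with edge set \<open>F\<close> and the endpoints of these edges as vertices.
\<close>

definition connected_edges :: "'a set set \<Rightarrow> bool" where
  "connected_edges F \<longleftrightarrow> (\<forall>u\<in>\<Union>F. \<forall>v\<in>\<Union>F. (\<lambda>x y. {x, y} \<in> F)\<^sup>*\<^sup>* u v)"

definition bicoloured_edges :: "'a set set \<Rightarrow> ('a set \<Rightarrow> nat) \<Rightarrow> nat \<Rightarrow> nat \<Rightarrow> 'a set set" where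
  "bicoloured_edges E f c d = {e \<in> E. f e = c \<or> f e = d}"

text \<open>
  The subgraph formed by the edges coloured \<open>c\<close> or \<open>d\<close> has no isolated vertices, so each of its
  connected components is determined by its edge set, which is nonempty.
\<close>

definition kempe_chain ::
    "'a set set \<Rightarrow> ('a set \<Rightarrow> nat) \<Rightarrow> nat \<Rightarrow> nat \<Rightarrow> 'a set set \<Rightarrow> bool" where
  "kempe_chain E f c d K \<longleftrightarrow>
     K \<noteq> {} \<and> K \<subseteq> bicoloured_edges E f c d \<and> connected_edges K \<and>
     (\<forall>K'. K \<subseteq> K' \<and> K' \<subseteq> bicoloured_edges E f c d \<and> connected_edges K' \<longrightarrow> K' = K)"

definition kempe_swap ::
    "nat \<Rightarrow> nat \<Rightarrow> 'a set set \<Rightarrow> ('a set \<Rightarrow> nat) \<Rightarrow> 'a set \<Rightarrow> nat" where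
  "kempe_swap c d K f = (\<lambda>e. if e \<in> K then transpose c d (f e) else f e)"

definition kempe_change ::
    "'a set set \<Rightarrow> nat \<Rightarrow> ('a set \<Rightarrow> nat) \<Rightarrow> ('a set \<Rightarrow> nat) \<Rightarrow> bool" where
  "kempe_change E k f g \<longleftrightarrow>
     (\<exists>c\<in>{1..k}. \<exists>d\<in>{1..k}. c \<noteq> d \<and> (\<exists>K. kempe_chain E f c d K \<and> g = kempe_swap c d K f))"

definition kempe_equivalent ::
    "'a set set \<Rightarrow> nat \<Rightarrow> ('a set \<Rightarrow> nat) \<Rightarrow> ('a set \<Rightarrow> nat) \<Rightarrow> bool" where
  "kempe_equivalent E k = (kempe_change E k)\<^sup>*\<^sup>*"

end

theory Submission
  imports Defs
begin

text \<open>
  Let \<open>d\<close> be the chromatic index. Fixing a \<open>d\<close>-edge-colouring, \<open>G\<close> embeds into a \<open>d\<close>-regular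
  triangle-free graph \<open>H\<close>: take a copy of \<open>G\<close> for every vertex of a \<open>d\<close>-cube and join the copies of
  \<open>x\<close> along the first \<open>d - deg x\<close> directions. Colourings with \<open>d\<close> or \<open>d + 1\<close> colours extend to \<open>H\<close>, and Kempe
  equivalence on \<open>H\<close> restricts to \<open>G\<close>.

  On a \<open>d\<close>-regular class-one graph let \<open>M\<close> be a colour class of a \<open>d\<close>-edge-colouring. Every
  \<open>(d + 1)\<close>-edge-colouring is equivalent to one in which colour \<open>d + 1\<close> has class exactly \<open>M\<close>, so
  that removing \<open>M\<close> reduces the claim to \<open>d - 1\<close>.

  To reach \<open>M\<close>, maximise the overlap of \<open>M\<close> with the class \<open>N\<close> of \<open>\<omega> = d + 1\<close>, then the size of \<open>N\<close>. In a
  \<open>d\<close>-regular graph every vertex misses exactly one colour; call it free if it misses \<open>\<omega>\<close>. If \<open>tu\<close> lies in \<open>M - N\<close>,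
  \<open>t\<close> is free and \<open>uv\<close> lies in \<open>N\<close>, then one would like to exchange \<open>uv\<close> for \<open>tu\<close>.
  When the free vertices are independent, Vizing fans at \<open>v\<close> and at the free vertex ending that fan achieve this.
  If there is no free vertex, a fan argument first removes from \<open>N\<close> the edge \<open>ty\<close> at \<open>t\<close>, after which only \<open>t\<close> and
  \<open>y\<close> are free; if the exchange were impossible, counting the fans at a suitable neighbour
  of \<open>v\<close> would show it adjacent to two free vertices, hence to both \<open>t\<close> and \<open>y\<close>, a triangle.
\<close>

section \<open>Kempe chains\<close>

text \<open>Because the missing colour \<open>mc\<close> is a function, a vertex missing
  \<open>c\<close> or \<open>d\<close> is an end of a \<open>c\<close>/\<open>d\<close> Kempe chain,
  and a chain has at most two ends; many contradictions exhibit a third. The other recurring device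
  is to prove each claim for a whole family of colourings with the same class of
  \<open>\<omega>\<close>: if a desired chain did not exist, a swap would produce another member of
  the family that violates a claim already proved. Swaps involving \<open>\<omega>\<close> leave the
  family, so they occur only where they give the exchange outright or are undone afterwards.
  Triangle-freeness is also used through its local form: adjacent vertices have no common neighbour,
  so fans at two adjacent vertices do not disturb each other. The degree can be lowered because
  \<open>M\<close> comes from a colouring with as few colours as the degree, so the graph without
  \<open>M\<close> is again regular and of class one, and \<open>M\<close> is a common target for
  both given colourings.\<close>

lemma functional_orbit_comparable:
  assumes det: "\<And>x y z. r x y \<Longrightarrow> r x z \<Longrightarrow> y = z"
    and "r\<^sup>*\<^sup>* s x" "r\<^sup>*\<^sup>* s y"
  shows "r\<^sup>*\<^sup>* x y \<or> r\<^sup>*\<^sup>* y x"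
  using assms(2)
proof (induction rule: rtranclp_induct)
  case base
  then show ?case using assms(3) by blast
next
  case (step x x')
  then show ?case
  proof (elim disjE)
    assume "r\<^sup>*\<^sup>* x y"
    then show ?case
    proof (cases rule: converse_rtranclpE)
      case base
      then show ?thesis using step.hyps by auto
    next
      case (step z)
      then show ?thesis using \<open>r x x'\<close> det by blast
    qed
  next
    assume "r\<^sup>*\<^sup>* y x"
    then show ?case using step.hyps(2) by (metis rtranclp.rtrancl_into_rtrancl)
  qed
qed

text \<open>The nonbacktracking walk that leaves \<open>v\<close> is deterministic and stops only at a vertex
  of degree one, so such a vertex is unique.\<close>

lemma at_most_two_ends:
  fixes R :: "'a \<Rightarrow> 'a \<Rightarrow> bool"
  assumes sym: "\<And>x y. R x y \<Longrightarrow> R y x"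
    and deg2: "\<And>x y1 y2 y3. R x y1 \<Longrightarrow> R x y2 \<Longrightarrow> R x y3 \<Longrightarrow> y1 = y2 \<or> y1 = y3 \<or> y2 = y3"
    and v: "\<And>y z. R v y \<Longrightarrow> R v z \<Longrightarrow> y = z"
    and x: "\<And>y z. R x y \<Longrightarrow> R x z \<Longrightarrow> y = z"
    and x': "\<And>y z. R x' y \<Longrightarrow> R x' z \<Longrightarrow> y = z"
    and "R\<^sup>*\<^sup>* v x" "R\<^sup>*\<^sup>* v x'" "x \<noteq> v" "x' \<noteq> v"
  shows "x = x'"
proof -
  \<comment> \<open>A state is a pair of consecutive vertices; remembering the previous one makes
    the nonbacktracking walk a function.\<close>
  define st where "st = (\<lambda>(a, b) (a', b'). a' = b \<and> R b b' \<and> R a b \<and> b' \<noteq> a)"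
  from \<open>R\<^sup>*\<^sup>* v x\<close> \<open>x \<noteq> v\<close> obtain p where p: "R v p"
    by (metis converse_rtranclpE)
  have det: "y = z" if h: "st s y" "st s z" for s y z
  proof -
    obtain a b where s: "s = (a, b)" by force
    obtain b' b'' where y: "y = (b, b')" and z: "z = (b, b'')"
      using h s unfolding st_def by (cases y; cases z) auto
    have "R b b'" "R b b''" "R b a" "b' \<noteq> a" "b'' \<noteq> a"
      using h s y z sym by (auto simp: st_def)
    then show ?thesis using deg2 y z by blast
  qed
  \<comment> \<open>The last conjunct supplies the earlier state arriving at \<open>fst q\<close>,
    to which a backtracking step of an arbitrary walk returns.\<close>
  have inv: "(fst q = v \<longrightarrow> snd q = p) \<and> R (fst q) (snd q)
      \<and> (fst q \<noteq> v \<longrightarrow> (\<exists>a. st\<^sup>*\<^sup>* (v, p) (a, fst q)))" if "st\<^sup>*\<^sup>* (v, p) q" for q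
    using that
  proof (induction rule: rtranclp_induct)
    case base
    then show ?case using p by auto
  next
    case (step y z)
    then show ?case using v p
      by (cases y; cases z) (auto simp: st_def intro: rtranclp.rtrancl_into_rtrancl)
  qed
  have reach: "y = v \<or> (\<exists>a. st\<^sup>*\<^sup>* (v, p) (a, y))" if "R\<^sup>*\<^sup>* v y" for y
    using that
  proof (induction rule: rtranclp_induct)
    case base
    then show ?case by simp
  next
    case (step y z)
    show ?case
    proof (cases "y = v")
      case True
      then have "z = p" using step.hyps v p by blast
      then show ?thesis by blast
    next
      case False
      then obtain a where a: "st\<^sup>*\<^sup>* (v, p) (a, y)" using step.IH by blast
      show ?thesis
      proof (cases "z = a")
        case True
        then show ?thesis using inv[OF a] by auto
      next
        case zne: False
        have "R a y" using inv[OF a] by simp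
        then have "st (a, y) (y, z)" using zne step.hyps by (auto simp: st_def)
        then show ?thesis using a by (meson rtranclp.rtrancl_into_rtrancl)
      qed
    qed
  qed
  obtain a where a: "st\<^sup>*\<^sup>* (v, p) (a, x)" using reach assms(6,8) by blast
  obtain a' where a': "st\<^sup>*\<^sup>* (v, p) (a', x')" using reach assms(7,9) by blast
  have end1: "\<not> st (a, x) q" for q
  proof
    assume "st (a, x) q"
    then obtain b where "R x b" "R x a" "b \<noteq> a" using sym by (cases q) (auto simp: st_def)
    then show False using x by blast
  qed
  have end2: "\<not> st (a', x') q" for q
  proof
    assume "st (a', x') q"
    then obtain b where "R x' b" "R x' a'" "b \<noteq> a'" using sym by (cases q) (auto simp: st_def)
    then show False using x' by blast
  qed
  have "st\<^sup>*\<^sup>* (a, x) (a', x') \<or> st\<^sup>*\<^sup>* (a', x') (a, x)"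
    using functional_orbit_comparable[of st, OF det a a'] .
  then show ?thesis
  proof
    assume "st\<^sup>*\<^sup>* (a, x) (a', x')"
    then show ?thesis
    proof (cases rule: converse_rtranclpE)
      case base
      then show ?thesis by simp
    next
      case (step q)
      then show ?thesis using end1 by simp
    qed
  next
    assume "st\<^sup>*\<^sup>* (a', x') (a, x)"
    then show ?thesis
    proof (cases rule: converse_rtranclpE)
      case base
      then show ?thesis by simp
    next
      case (step q)
      then show ?thesis using end2 by simp
    qed
  qed
qed

text \<open>A union of Kempe chains, possibly empty. Closure under touching edges is easier to
  verify for an explicit set than connectedness and maximality.\<close>

definition swap_closed :: "'a set set \<Rightarrow> ('a set \<Rightarrow> nat) \<Rightarrow> nat \<Rightarrow> nat \<Rightarrow> 'a set set \<Rightarrow> bool" where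
  "swap_closed E f c d K \<longleftrightarrow> K \<subseteq> bicoloured_edges E f c d \<and>
     (\<forall>e\<in>K. \<forall>e'\<in>bicoloured_edges E f c d. e \<inter> e' \<noteq> {} \<longrightarrow> e' \<in> K)"

lemma transpose_cd_iff: "transpose c d x = c \<or> transpose c d x = d \<longleftrightarrow> x = c \<or> x = d"
  by (auto simp: transpose_def)

lemma transpose_in: "c \<in> S \<Longrightarrow> d \<in> S \<Longrightarrow> x \<in> S \<Longrightarrow> transpose c d x \<in> S"
  by (auto simp: transpose_def)

lemma bicoloured_swap:
  assumes "K \<subseteq> bicoloured_edges E f c d"
  shows "bicoloured_edges E (kempe_swap c d K f) c d = bicoloured_edges E f c d"
  by (simp add: bicoloured_edges_def kempe_swap_def transpose_cd_iff)

lemma kempe_swap_involutory: "kempe_swap c d K (kempe_swap c d K f) = f"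
  by (rule ext) (simp add: kempe_swap_def)

lemma edge_colouring_range: "edge_colouring E k \<phi> \<Longrightarrow> e \<in> E \<Longrightarrow> \<phi> e \<in> {1..k}"
  unfolding edge_colouring_def by blast

lemma edge_colouring_undefined: "edge_colouring E k \<phi> \<Longrightarrow> e \<notin> E \<Longrightarrow> \<phi> e = undefined"
  unfolding edge_colouring_def by (blast dest: PiE_arb)

lemma edge_colouring_restrict:
  assumes \<phi>: "edge_colouring E k \<phi>" and F: "F \<subseteq> E" and k': "\<And>e. e \<in> F \<Longrightarrow> \<phi> e \<in> {1..k'}"
  shows "edge_colouring F k' (restrict \<phi> F)"
  unfolding edge_colouring_def
proof (intro conjI ballI impI)
  show "restrict \<phi> F \<in> F \<rightarrow>\<^sub>E {1..k'}" using k' by (rule restrict_PiE_iff[THEN iffD2, rule_format])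
  fix e e' assume e: "e \<in> F" "e' \<in> F" "e \<noteq> e' \<and> e \<inter> e' \<noteq> {}"
  have "\<forall>e\<in>E. \<forall>e'\<in>E. e \<noteq> e' \<and> e \<inter> e' \<noteq> {} \<longrightarrow> \<phi> e \<noteq> \<phi> e'"
    using \<phi> unfolding edge_colouring_def by (rule conjunct2)
  then have "\<phi> e \<noteq> \<phi> e'" using subsetD[OF F e(1)] subsetD[OF F e(2)] e(3) by simp
  then show "restrict \<phi> F e \<noteq> restrict \<phi> F e'" using e(1,2) by simp
qed

lemma edge_colouring_proper:
  assumes "edge_colouring E k \<phi>" "e \<in> E" "e' \<in> E" "x \<in> e" "x \<in> e'" "\<phi> e = \<phi> e'" shows "e = e'"
proof -
  have "\<forall>e\<in>E. \<forall>e'\<in>E. e \<noteq> e' \<and> e \<inter> e' \<noteq> {} \<longrightarrow> \<phi> e \<noteq> \<phi> e'"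
    using assms(1) unfolding edge_colouring_def by simp
  then have "e \<noteq> e' \<and> e \<inter> e' \<noteq> {} \<longrightarrow> \<phi> e \<noteq> \<phi> e'" using assms(2,3) by simp
  then show ?thesis using assms(4-6) by auto
qed

lemma inj_on_edges_at:
  assumes "edge_colouring E k \<phi>" shows "inj_on \<phi> {e \<in> E. x \<in> e}"
proof (rule inj_onI)
  fix e e' assume "e \<in> {e \<in> E. x \<in> e}" "e' \<in> {e \<in> E. x \<in> e}" "\<phi> e = \<phi> e'"
  then show "e = e'" using edge_colouring_proper[OF assms, of e e' x] by simp
qed

section \<open>Swapping unions of Kempe chains\<close>

locale simple_graph =
  fixes V :: "'a set" and E :: "'a set set"
  assumes graph: "finite_simple_graph V E"
begin

lemma finV: "finite V" using graph by (simp add: finite_simple_graph_def)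

lemma edgeD: "{x, y} \<in> E \<Longrightarrow> x \<in> V \<and> y \<in> V \<and> x \<noteq> y"
  using graph unfolding finite_simple_graph_def nsets_def
  by (auto simp: card_insert_if split: if_splits)

lemma edgeE: assumes "e \<in> E" obtains x y where "e = {x, y}" "x \<noteq> y" "x \<in> V" "y \<in> V"
proof -
  have "card e = 2" using assms graph unfolding finite_simple_graph_def nsets_def by auto
  then obtain x y where "e = {x, y}" "x \<noteq> y" by (auto simp: card_2_iff)
  then show ?thesis using that assms edgeD by blast
qed

lemma edge_at: assumes "e \<in> E" "x \<in> e" obtains y where "e = {x, y}" "x \<noteq> y" "y \<in> V"
  using assms edgeE[OF assms(1)] by (metis insertE insert_commute singletonD)

lemma finE: "finite E"
proof -
  have "E \<subseteq> Pow V" using graph unfolding finite_simple_graph_def nsets_def by auto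
  then show ?thesis using finV finite_subset by blast
qed

lemma kempe_change_sym:
  assumes "kempe_change E k f g" shows "kempe_change E k g f"
proof -
  obtain c d K where cd: "c\<in>{1..k}" "d\<in>{1..k}" "c \<noteq> d" and K: "kempe_chain E f c d K"
    and g: "g = kempe_swap c d K f" using assms unfolding kempe_change_def by blast
  have "bicoloured_edges E g c d = bicoloured_edges E f c d"
    using K g bicoloured_swap unfolding kempe_chain_def by metis
  then have "kempe_chain E g c d K" using K unfolding kempe_chain_def by simp
  moreover have "f = kempe_swap c d K g"
    unfolding g by (auto simp: kempe_swap_def)
  ultimately show ?thesis using cd unfolding kempe_change_def by blast
qed

lemma equiv_sym: "kempe_equivalent E k f g \<Longrightarrow> kempe_equivalent E k g f"
  unfolding kempe_equivalent_def
  by (rule sympD[OF symp_rtranclp]) (auto simp: symp_def kempe_change_sym)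

lemma equiv_refl [simp]: "kempe_equivalent E k f f"
  unfolding kempe_equivalent_def by simp

lemma equiv_trans: "kempe_equivalent E k f g \<Longrightarrow> kempe_equivalent E k g h \<Longrightarrow> kempe_equivalent E k f h"
  unfolding kempe_equivalent_def by simp

text \<open>A walk in the bicoloured subgraph that starts on \<open>e\<close> uses only edges of
  \<open>C\<close>, which gives connectedness; a connected superset is absorbed because its walks
  are walks in \<open>B\<close>.\<close>

lemma component_chain:
  assumes e: "e \<in> bicoloured_edges E f c d"
  defines "B \<equiv> bicoloured_edges E f c d"
  defines "C \<equiv> {e' \<in> B. \<exists>x\<in>e. \<exists>y\<in>e'. (\<lambda>x y. {x, y} \<in> B)\<^sup>*\<^sup>* x y}"
  shows "kempe_chain E f c d C" "e \<in> C"
proof -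
  let ?R = "\<lambda>x y. {x, y} \<in> B"
  have BE: "B \<subseteq> E" unfolding B_def bicoloured_edges_def by auto
  have eB: "e \<in> B" using e B_def by simp
  then obtain p q where pq: "e = {p, q}" using edgeE BE by (metis subsetD)
  have sym1: "symp (\<lambda>x y. {x, y} \<in> A)" for A :: "'a set set"
    by (simp add: symp_def insert_commute)
  have symR: "?R\<^sup>*\<^sup>* y x" if "?R\<^sup>*\<^sup>* x y" for x y
    using sympD[OF symp_rtranclp[OF sym1] that] .
  have edgeR: "?R\<^sup>*\<^sup>* x y" if h: "e' \<in> B" "x \<in> e'" "y \<in> e'" for e' x y
  proof -
    obtain a b where "e' = {a, b}" using h(1) edgeE BE by (metis subsetD)
    then have "x = y \<or> {x, y} = e'" using h(2,3) by auto
    then show ?thesis using h(1) by blast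
  qed
  show eC: "e \<in> C" unfolding C_def using eB pq by auto
  have reachC: "?R\<^sup>*\<^sup>* p y" if yC: "y \<in> \<Union>C" for y
  proof -
    obtain e' where e': "e' \<in> C" "y \<in> e'" using yC by blast
    then obtain x z where xz: "e' \<in> B" "x \<in> e" "z \<in> e'" "?R\<^sup>*\<^sup>* x z"
      unfolding C_def by blast
    have "?R\<^sup>*\<^sup>* p x" by (rule edgeR[OF eB]) (use pq xz in auto)
    moreover have "?R\<^sup>*\<^sup>* z y" by (rule edgeR[OF xz(1) xz(3) e'(2)])
    ultimately show ?thesis using xz(4) rtranclp_trans[of ?R] by blast
  qed
  have stay: "(\<lambda>x y. {x, y} \<in> C)\<^sup>*\<^sup>* p y" if "?R\<^sup>*\<^sup>* p y" for y
    using that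
  proof (induction rule: rtranclp_induct)
    case base
    show ?case by simp
  next
    case (step y z)
    then have "{y, z} \<in> C" unfolding C_def using pq by blast
    then show ?case using rtranclp.rtrancl_into_rtrancl[OF step.IH] by blast
  qed
  have symC: "(\<lambda>x y. {x, y} \<in> C)\<^sup>*\<^sup>* y x" if "(\<lambda>x y. {x, y} \<in> C)\<^sup>*\<^sup>* x y" for x y
    using sympD[OF symp_rtranclp[OF sym1] that] .
  have conn: "connected_edges C"
    unfolding connected_edges_def
  proof (intro ballI)
    fix x y assume "x \<in> \<Union>C" "y \<in> \<Union>C"
    then show "(\<lambda>x y. {x, y} \<in> C)\<^sup>*\<^sup>* x y"
      using rtranclp_trans[OF symC[OF stay[OF reachC]] stay[OF reachC]] by blast
  qed
  have maxC: "K' = C" if K': "C \<subseteq> K'" "K' \<subseteq> B" "connected_edges K'" for K'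
  proof
    show "K' \<subseteq> C"
    proof
      fix e' assume e': "e' \<in> K'"
      then obtain a b where ab: "e' = {a, b}" using edgeE BE K'(2) by (metis subsetD)
      have "p \<in> \<Union>K'" "a \<in> \<Union>K'" using e' ab eC K'(1) pq by blast+
      then have "(\<lambda>x y. {x, y} \<in> K')\<^sup>*\<^sup>* p a"
        using K'(3) unfolding connected_edges_def by blast
      then have "?R\<^sup>*\<^sup>* p a"
        by (rule rtranclp_mono[THEN predicate2D, rotated]) (use K'(2) in blast)
      then show "e' \<in> C" unfolding C_def using e' K'(2) ab pq by blast
    qed
  qed (use K' in simp)
  show "kempe_chain E f c d C"
    unfolding kempe_chain_def B_def[symmetric]
  proof (intro conjI allI impI)
    show "C \<noteq> {}" using eC by blast
    show "C \<subseteq> B" unfolding C_def by blast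
    show "connected_edges C" by (rule conn)
    show "K' = C" if "C \<subseteq> K' \<and> K' \<subseteq> B \<and> connected_edges K'" for K'
      using that maxC by blast
  qed
qed

text \<open>By maximality a Kempe chain equals the component of each of its edges, and that
  component contains every bicoloured edge touching it.\<close>

lemma kempe_chain_swap_closed:
  assumes K: "kempe_chain E f c d K"
  shows "swap_closed E f c d K"
  unfolding swap_closed_def
proof (intro conjI ballI impI)
  let ?B = "bicoloured_edges E f c d"
  show KB: "K \<subseteq> ?B" using K unfolding kempe_chain_def by blast
  fix e e' assume e: "e \<in> K" and e': "e' \<in> ?B" and meet: "e \<inter> e' \<noteq> {}"
  define C where "C = {e' \<in> ?B. \<exists>x\<in>e. \<exists>y\<in>e'. (\<lambda>x y. {x, y} \<in> ?B)\<^sup>*\<^sup>* x y}"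
  have eB: "e \<in> ?B" using e KB by blast
  have C: "kempe_chain E f c d C" using component_chain[OF eB] unfolding C_def by blast
  have nonempty: "\<exists>x. x \<in> e1" if "e1 \<in> K" for e1
  proof -
    have "e1 \<in> E" using that KB unfolding bicoloured_edges_def by blast
    then show ?thesis using edgeE by blast
  qed
  have "K \<subseteq> C"
  proof
    fix e1 assume e1: "e1 \<in> K"
    obtain x y where xy: "x \<in> e" "y \<in> e1" using nonempty e e1 by blast
    then have "(\<lambda>x y. {x, y} \<in> K)\<^sup>*\<^sup>* x y"
      using K e e1 unfolding kempe_chain_def connected_edges_def by blast
    then have "(\<lambda>x y. {x, y} \<in> ?B)\<^sup>*\<^sup>* x y" by (rule rtranclp_mono[THEN predicate2D, rotated]) (use KB in blast)
    then show "e1 \<in> C" unfolding C_def using xy e1 KB by blast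
  qed
  then have "C = K" using K C unfolding kempe_chain_def by blast
  moreover have "e' \<in> C" unfolding C_def using e' meet by blast
  ultimately show "e' \<in> K" by simp
qed

text \<open>Components are peeled off one at a time: swapping one leaves the set of
  \<open>c\<close>/\<open>d\<close>-edges unchanged, so the remainder is still closed.\<close>

lemma swap_closed_equiv:
  assumes "swap_closed E f c d K" "c \<in> {1..k}" "d \<in> {1..k}" "c \<noteq> d"
  shows "kempe_equivalent E k f (kempe_swap c d K f)"
  using assms(1)
proof (induction "card K" arbitrary: K f rule: less_induct)
  case less
  let ?B = "bicoloured_edges E f c d"
  show ?case
  proof (cases "K = {}")
    case True
    then show ?thesis by (simp add: kempe_swap_def)
  next
    case False
    then obtain e where e: "e \<in> K" by blast
    have KB: "K \<subseteq> ?B" and Kcl: "\<And>e e'. e \<in> K \<Longrightarrow> e' \<in> ?B \<Longrightarrow> e \<inter> e' \<noteq> {} \<Longrightarrow> e' \<in> K"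
      using less.prems unfolding swap_closed_def by blast+
    have BE: "?B \<subseteq> E" unfolding bicoloured_edges_def by blast
    have finK: "finite K" using finite_subset[OF order_trans[OF KB BE] finE] .
    define C where "C = {e' \<in> ?B. \<exists>x\<in>e. \<exists>y\<in>e'. (\<lambda>x y. {x, y} \<in> ?B)\<^sup>*\<^sup>* x y}"
    have eB: "e \<in> ?B" using e KB by blast
    have ch: "kempe_chain E f c d C" and eC: "e \<in> C"
      using component_chain[OF eB] C_def by simp_all
    have reach: "\<forall>e'\<in>?B. y \<in> e' \<longrightarrow> e' \<in> K" if "(\<lambda>x y. {x, y} \<in> ?B)\<^sup>*\<^sup>* x y" "x \<in> e" for x y
      using that
    proof (induction rule: rtranclp_induct)
      case base
      then show ?case using e Kcl by blast
    next
      case (step y z)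
      then have "{y, z} \<in> K" by blast
      then show ?case using Kcl by blast
    qed
    have CK: "C \<subseteq> K" unfolding C_def using reach by blast
    let ?g = "kempe_swap c d C f"
    have CB: "C \<subseteq> ?B" unfolding C_def by blast
    have Bg: "bicoloured_edges E ?g c d = ?B" using bicoloured_swap[OF CB] .
    have Cdisj: "e' \<in> C" if h: "e'' \<in> C" "e' \<in> ?B" "e'' \<inter> e' \<noteq> {}" for e' e''
    proof -
      obtain x y where xy: "x \<in> e" "y \<in> e''" "(\<lambda>x y. {x, y} \<in> ?B)\<^sup>*\<^sup>* x y" "e'' \<in> ?B"
        using h(1) unfolding C_def by auto
      obtain z where z: "z \<in> e''" "z \<in> e'" using h(3) by blast
      note x = xy z
      have "e'' \<in> E" using x BE by blast
      then obtain a b where "e'' = {a, b}" by (rule edgeE)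
      then have "y = z \<or> {y, z} = e''" using x by auto
      then have "(\<lambda>x y. {x, y} \<in> ?B)\<^sup>*\<^sup>* x z"
      proof
        assume "{y, z} = e''"
        then show ?thesis using rtranclp.rtrancl_into_rtrancl[OF x(3), of z] x(4) by blast
      qed (use x(3) in simp)
      then show ?thesis unfolding C_def using x h by blast
    qed
    have "swap_closed E ?g c d (K - C)"
      unfolding swap_closed_def Bg
    proof (intro conjI ballI impI)
      fix e1 e2 assume h: "e1 \<in> K - C" "e2 \<in> ?B" "e1 \<inter> e2 \<noteq> {}"
      have "e2 \<notin> C" using Cdisj[of e2 e1] h KB by blast
      then show "e2 \<in> K - C" using Kcl h by blast
    qed (use KB in blast)
    moreover have "card (K - C) < card K"
      by (rule psubset_card_mono[OF finK]) (use eC e in blast)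
    ultimately have "kempe_equivalent E k ?g (kempe_swap c d (K - C) ?g)"
      using less.hyps by blast
    moreover have "kempe_swap c d (K - C) ?g = kempe_swap c d K f"
    proof
      show "kempe_swap c d (K - C) ?g x = kempe_swap c d K f x" for x
        using CK by (cases "x \<in> C") (auto simp: kempe_swap_def)
    qed
    moreover have "kempe_equivalent E k f ?g"
      unfolding kempe_equivalent_def kempe_change_def
      by (rule r_into_rtranclp) (use ch assms(2-4) in blast)
    ultimately show ?thesis using equiv_trans[of k f ?g "kempe_swap c d K f"] by simp
  qed
qed

lemma swap_closed_colouring:
  assumes "edge_colouring E k f" "swap_closed E f c d K" "c \<in> {1..k}" "d \<in> {1..k}"
  shows "edge_colouring E k (kempe_swap c d K f)"
proof -
  let ?g = "kempe_swap c d K f"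
  have KB: "K \<subseteq> bicoloured_edges E f c d"
    and Kcl: "\<And>e e'. e \<in> K \<Longrightarrow> e' \<in> bicoloured_edges E f c d \<Longrightarrow> e \<inter> e' \<noteq> {} \<Longrightarrow> e' \<in> K"
    using assms(2) unfolding swap_closed_def by blast+
  have fE: "f \<in> E \<rightarrow>\<^sub>E {1..k}"
    and pr: "\<And>e e'. e \<in> E \<Longrightarrow> e' \<in> E \<Longrightarrow> e \<noteq> e' \<Longrightarrow> e \<inter> e' \<noteq> {} \<Longrightarrow> f e \<noteq> f e'"
    using assms(1) unfolding edge_colouring_def by blast+
  have "?g \<in> E \<rightarrow>\<^sub>E {1..k}"
  proof (rule PiE_I)
    fix e assume "e \<in> E"
    then have "f e \<in> {1..k}" using fE by blast
    then show "?g e \<in> {1..k}"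
      using transpose_in[OF assms(3,4)] unfolding kempe_swap_def by simp
  next
    fix e assume "e \<notin> E"
    then have "e \<notin> K" using KB unfolding bicoloured_edges_def by blast
    then show "?g e = undefined"
      using PiE_arb[OF fE \<open>e \<notin> E\<close>] unfolding kempe_swap_def by simp
  qed
  moreover have "?g e \<noteq> ?g e'" if e: "e \<in> E" "e' \<in> E" "e \<noteq> e'" "e \<inter> e' \<noteq> {}" for e e'
  proof (cases "(f e = c \<or> f e = d) \<and> (f e' = c \<or> f e' = d)")
    case True
    then have B: "e \<in> bicoloured_edges E f c d" "e' \<in> bicoloured_edges E f c d"
      using e unfolding bicoloured_edges_def by simp_all
    have "e \<in> K \<longleftrightarrow> e' \<in> K" using Kcl[of e e'] Kcl[of e' e] B e(4) by blast
    then show ?thesis using pr[OF e] injD[OF inj_transpose, of c d "f e" "f e'"]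
      unfolding kempe_swap_def by (cases "e \<in> K") auto
  next
    case False
    have in_cd: "?g x = c \<or> ?g x = d \<longleftrightarrow> f x = c \<or> f x = d" for x
      unfolding kempe_swap_def by (simp add: transpose_cd_iff)
    have out: "?g x = f x" if "f x \<noteq> c" "f x \<noteq> d" for x
      unfolding kempe_swap_def using that by simp
    show ?thesis
    proof
      assume eq: "?g e = ?g e'"
      then have "(f e = c \<or> f e = d) \<longleftrightarrow> (f e' = c \<or> f e' = d)"
        using in_cd[of e] in_cd[of e'] by simp
      then have "f e \<noteq> c" "f e \<noteq> d" "f e' \<noteq> c" "f e' \<noteq> d" using False by blast+
      then show False using eq pr[OF e] out by simp
    qed
  qed
  ultimately show ?thesis unfolding edge_colouring_def by simp
qed

end

section \<open>Regular triangle-free graphs\<close>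

locale regular_triangle_free = simple_graph +
  fixes D :: nat
  assumes reg: "\<And>x. x \<in> V \<Longrightarrow> card {e \<in> E. x \<in> e} = D"
    and tf: "triangle_free E"
begin

abbreviation "col \<equiv> edge_colouring E (Suc D)"
abbreviation "eqv \<equiv> kempe_equivalent E (Suc D)"

lemma no_triangle: "{x, y} \<in> E \<Longrightarrow> {y, z} \<in> E \<Longrightarrow> {x, z} \<in> E \<Longrightarrow> False"
  using tf edgeD unfolding triangle_free_def by blast

section \<open>The missing colour at a vertex\<close>

lemma nbr_unique:
  assumes "col \<phi>" "{x, y} \<in> E" "{x, z} \<in> E" "\<phi> {x, y} = \<phi> {x, z}" shows "y = z"
proof -
  have "{x, y} = {x, z}" using edge_colouring_proper[OF assms(1-3) _ _ assms(4), of x] by simp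
  then show ?thesis by (auto simp: doubleton_eq_iff)
qed

text \<open>Missing colour: \<open>D\<close> edges of distinct colours leave exactly one of
  \<open>Suc D\<close> colours at a vertex of \<open>V\<close>, so \<open>THE\<close> is meaningful
  there.\<close>

definition mc :: "('a set \<Rightarrow> nat) \<Rightarrow> 'a \<Rightarrow> nat" where
  "mc \<phi> x = (THE c. c \<in> {1..Suc D} \<and> (\<forall>y. {x, y} \<in> E \<longrightarrow> \<phi> {x, y} \<noteq> c))"

lemma mc_ex1:
  assumes c: "col \<phi>" and x: "x \<in> V"
  shows "\<exists>!c. c \<in> {1..Suc D} \<and> (\<forall>y. {x, y} \<in> E \<longrightarrow> \<phi> {x, y} \<noteq> c)"
proof -
  let ?S = "{e \<in> E. x \<in> e}"
  have inj: "inj_on \<phi> ?S" by (rule inj_on_edges_at[OF c])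
  have sub: "\<phi> ` ?S \<subseteq> {1..Suc D}" using edge_colouring_range[OF c] by blast
  have "card ({1..Suc D} - \<phi> ` ?S) = 1"
    using card_Diff_subset[OF finite_subset[OF sub] sub] card_image[OF inj] reg[OF x] by simp
  then obtain c0 where c0: "{1..Suc D} - \<phi> ` ?S = {c0}" by (auto simp: card_1_singleton_iff)
  have iff: "c \<notin> \<phi> ` ?S \<longleftrightarrow> (\<forall>y. {x, y} \<in> E \<longrightarrow> \<phi> {x, y} \<noteq> c)" for c
  proof
    assume "\<forall>y. {x, y} \<in> E \<longrightarrow> \<phi> {x, y} \<noteq> c"
    then show "c \<notin> \<phi> ` ?S" by (metis (no_types, lifting) edge_at image_iff mem_Collect_eq)
  qed auto
  show ?thesis
  proof (rule ex1I)
    show "c0 \<in> {1..Suc D} \<and> (\<forall>y. {x, y} \<in> E \<longrightarrow> \<phi> {x, y} \<noteq> c0)"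
      using c0 iff[of c0] by blast
    fix c assume "c \<in> {1..Suc D} \<and> (\<forall>y. {x, y} \<in> E \<longrightarrow> \<phi> {x, y} \<noteq> c)"
    then have "c \<in> {1..Suc D} - \<phi> ` ?S" using iff[of c] by blast
    then show "c = c0" unfolding c0 by blast
  qed
qed

lemma mc_props:
  assumes "col \<phi>" "x \<in> V"
  shows "mc \<phi> x \<in> {1..Suc D}" "{x, y} \<in> E \<Longrightarrow> \<phi> {x, y} \<noteq> mc \<phi> x"
  using theI'[OF mc_ex1[OF assms]] unfolding mc_def[symmetric] by blast+

lemma mc_edge: "col \<phi> \<Longrightarrow> {x, y} \<in> E \<Longrightarrow> \<phi> {x, y} \<noteq> mc \<phi> x"
  using mc_props(2) edgeD by blast

lemma mc_edge': "col \<phi> \<Longrightarrow> {x, y} \<in> E \<Longrightarrow> \<phi> {x, y} \<noteq> mc \<phi> y"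
  using mc_edge[of \<phi> y x] by (simp add: insert_commute)

lemma mcI:
  assumes "col \<phi>" "x \<in> V" "c \<in> {1..Suc D}" "\<And>y. {x, y} \<in> E \<Longrightarrow> \<phi> {x, y} \<noteq> c"
  shows "mc \<phi> x = c"
  using mc_ex1[OF assms(1,2)] mc_props[OF assms(1,2)] assms(3,4) by blast

lemma nbr_ex:
  assumes "col \<phi>" "x \<in> V" "c \<in> {1..Suc D}" "c \<noteq> mc \<phi> x"
  obtains y where "{x, y} \<in> E" "\<phi> {x, y} = c"
  using mcI[OF assms(1-3)] assms(4) by blast

lemma mc_cong:
  assumes "\<And>y. {x, y} \<in> E \<Longrightarrow> \<phi> {x, y} = \<psi> {x, y}"
  shows "mc \<phi> x = mc \<psi> x"
proof -
  have "(\<forall>y. {x, y} \<in> E \<longrightarrow> \<phi> {x, y} \<noteq> c) = (\<forall>y. {x, y} \<in> E \<longrightarrow> \<psi> {x, y} \<noteq> c)" for c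
    using assms by simp
  then show ?thesis unfolding mc_def by simp
qed

section \<open>Kempe chains through a given vertex\<close>

definition conn :: "('a set \<Rightarrow> nat) \<Rightarrow> nat \<Rightarrow> nat \<Rightarrow> 'a \<Rightarrow> 'a \<Rightarrow> bool" where
  "conn \<phi> c d = (\<lambda>x y. {x, y} \<in> bicoloured_edges E \<phi> c d)\<^sup>*\<^sup>*"

lemma conn_refl [simp]: "conn \<phi> c d x x"
  unfolding conn_def by simp

lemma conn_sym: "conn \<phi> c d x y \<Longrightarrow> conn \<phi> c d y x"
  unfolding conn_def
  by (rule sympD[OF symp_rtranclp]) (simp_all add: symp_def insert_commute)

lemma conn_trans: "conn \<phi> c d x y \<Longrightarrow> conn \<phi> c d y z \<Longrightarrow> conn \<phi> c d x z"
  unfolding conn_def by simp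

lemma conn_edge: "{x, y} \<in> E \<Longrightarrow> \<phi> {x, y} = c \<or> \<phi> {x, y} = d \<Longrightarrow> conn \<phi> c d x y"
  unfolding conn_def bicoloured_edges_def by auto

text \<open>Vertices missing \<open>c\<close> or \<open>d\<close> have degree at most one in the
  \<open>c\<close>/\<open>d\<close>-subgraph and all others at most two, so a component through an
  end \<open>v\<close> is a path with at most one other end.\<close>

lemma chain_ends:
  assumes \<phi>: "col \<phi>" and conn: "conn \<phi> c d v x" "conn \<phi> c d v x'"
    and V: "v \<in> V" "x \<in> V" "x' \<in> V"
    and mc: "mc \<phi> v = c \<or> mc \<phi> v = d" "mc \<phi> x = c \<or> mc \<phi> x = d" "mc \<phi> x' = c \<or> mc \<phi> x' = d"
    and ne: "x \<noteq> v" "x' \<noteq> v"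
  shows "x = x'"
proof -
  let ?R = "\<lambda>x y. {x, y} \<in> bicoloured_edges E \<phi> c d"
  have RE: "{x, y} \<in> E \<and> (\<phi> {x, y} = c \<or> \<phi> {x, y} = d)" if "?R x y" for x y
    using that unfolding bicoloured_edges_def by simp
  have deg2: "y1 = y2 \<or> y1 = y3 \<or> y2 = y3" if h: "?R w y1" "?R w y2" "?R w y3" for w y1 y2 y3
  proof -
    note r = RE[OF h(1)] RE[OF h(2)] RE[OF h(3)]
    have "\<phi> {w, y1} = \<phi> {w, y2} \<or> \<phi> {w, y1} = \<phi> {w, y3} \<or> \<phi> {w, y2} = \<phi> {w, y3}"
      using r by auto
    then show ?thesis using nbr_unique[OF \<phi>] r by blast
  qed
  have leaf: "y = z" if h: "mc \<phi> w = c \<or> mc \<phi> w = d" "?R w y" "?R w z" for w y z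
  proof -
    note r = RE[OF h(2)] RE[OF h(3)]
    have "\<phi> {w, y} \<noteq> mc \<phi> w" "\<phi> {w, z} \<noteq> mc \<phi> w" using r mc_edge[OF \<phi>] by blast+
    then have "\<phi> {w, y} = \<phi> {w, z}" using r h(1) by auto
    then show ?thesis using nbr_unique[OF \<phi>] r by blast
  qed
  have symR: "?R y x" if "?R x y" for x y using that by (simp add: insert_commute)
  show ?thesis
  proof (rule at_most_two_ends[of ?R v x x'])
    show "?R w y" if "?R y w" for y w by (rule symR[OF that])
    show "y1 = y2 \<or> y1 = y3 \<or> y2 = y3" if "?R w y1" "?R w y2" "?R w y3" for w y1 y2 y3
      by (rule deg2[OF that])
    show "y = z" if "?R v y" "?R v z" for y z by (rule leaf[OF mc(1) that])
    show "y = z" if "?R x y" "?R x z" for y z by (rule leaf[OF mc(2) that])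
    show "y = z" if "?R x' y" "?R x' z" for y z by (rule leaf[OF mc(3) that])
    show "?R\<^sup>*\<^sup>* v x" "?R\<^sup>*\<^sup>* v x'" using conn unfolding conn_def by blast+
  qed (rule ne)+
qed

text \<open>The Kempe chain is selected by a vertex \<open>q\<close>, so that the effect on edges
  and missing colour at \<open>z\<close> can be read off from \<open>conn \<phi> c d q z\<close>
  alone.\<close>

definition swp :: "('a set \<Rightarrow> nat) \<Rightarrow> nat \<Rightarrow> nat \<Rightarrow> 'a \<Rightarrow> 'a set \<Rightarrow> nat" where
  "swp \<phi> c d q = kempe_swap c d {e \<in> bicoloured_edges E \<phi> c d. \<exists>y\<in>e. conn \<phi> c d q y} \<phi>"

lemma conn_bicoloured:
  assumes "e \<in> bicoloured_edges E \<phi> c d" "x \<in> e" "y \<in> e" "conn \<phi> c d q x"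
  shows "conn \<phi> c d q y"
proof -
  have e: "e \<in> E" "\<phi> e = c \<or> \<phi> e = d" using assms(1) unfolding bicoloured_edges_def by simp_all
  obtain z where z: "e = {x, z}" using edge_at[OF e(1) assms(2)] by blast
  then have "conn \<phi> c d x z" using conn_edge e by simp
  then show ?thesis using assms(3,4) z conn_trans by blast
qed

lemma chain_closed: "swap_closed E \<phi> c d {e \<in> bicoloured_edges E \<phi> c d. \<exists>y\<in>e. conn \<phi> c d q y}"
  unfolding swap_closed_def using conn_bicoloured by blast

context
  fixes \<phi> c d
  assumes \<phi>: "col \<phi>" and cd: "c \<in> {1..Suc D}" "d \<in> {1..Suc D}" "c \<noteq> d"
begin

lemma swp_col: "col (swp \<phi> c d q)"
  unfolding swp_def by (rule swap_closed_colouring[OF \<phi> chain_closed cd(1,2)])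

lemma swp_eqv: "eqv \<phi> (swp \<phi> c d q)"
  unfolding swp_def by (rule swap_closed_equiv[OF chain_closed cd])

lemma swp_edge:
  assumes "{z, w} \<in> E"
  shows "swp \<phi> c d q {z, w} = (if conn \<phi> c d q z then transpose c d (\<phi> {z, w}) else \<phi> {z, w})"
proof (cases "{z, w} \<in> bicoloured_edges E \<phi> c d")
  case True
  then have "(\<exists>y\<in>{z, w}. conn \<phi> c d q y) \<longleftrightarrow> conn \<phi> c d q z"
    using conn_bicoloured[OF True, of w z q] by auto
  then show ?thesis using True unfolding swp_def kempe_swap_def by simp
next
  case False
  then have "\<phi> {z, w} \<noteq> c" "\<phi> {z, w} \<noteq> d" using assms unfolding bicoloured_edges_def by simp_all
  then show ?thesis using False unfolding swp_def kempe_swap_def by simp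
qed

lemma swp_other: "e \<in> E \<Longrightarrow> \<phi> e \<noteq> c \<Longrightarrow> \<phi> e \<noteq> d \<Longrightarrow> swp \<phi> c d q e = \<phi> e"
  unfolding swp_def kempe_swap_def by simp

lemma swp_iff: "e \<in> E \<Longrightarrow> b \<noteq> c \<Longrightarrow> b \<noteq> d \<Longrightarrow> swp \<phi> c d q e = b \<longleftrightarrow> \<phi> e = b"
  unfolding swp_def kempe_swap_def by (auto simp: transpose_def)

lemma swp_mc:
  assumes z: "z \<in> V"
  shows "mc (swp \<phi> c d q) z = (if conn \<phi> c d q z then transpose c d (mc \<phi> z) else mc \<phi> z)"
proof (rule mcI[OF swp_col z])
  show "(if conn \<phi> c d q z then transpose c d (mc \<phi> z) else mc \<phi> z) \<in> {1..Suc D}"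
    using mc_props(1)[OF \<phi> z] transpose_in[OF cd(1,2)] by simp
  fix y assume y: "{z, y} \<in> E"
  have "transpose c d (\<phi> {z, y}) \<noteq> transpose c d (mc \<phi> z)"
    using mc_edge[OF \<phi> y] injD[OF inj_transpose, of c d "\<phi> {z, y}" "mc \<phi> z"] by blast
  then show "swp \<phi> c d q {z, y} \<noteq> (if conn \<phi> c d q z then transpose c d (mc \<phi> z) else mc \<phi> z)"
    using swp_edge[OF y, of q] mc_edge[OF \<phi> y] by simp
qed

end

text \<open>Since both ends miss \<open>c\<close>, the edge by itself is a whole Kempe chain for its
  colour and \<open>c\<close>.\<close>

lemma recolour:
  assumes \<phi>: "col \<phi>" and e: "{x, y} \<in> E" and c: "mc \<phi> x = c" "mc \<phi> y = c"
  shows "col (\<phi>({x, y} := c))" "eqv \<phi> (\<phi>({x, y} := c))"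
    "mc (\<phi>({x, y} := c)) x = \<phi> {x, y}" "mc (\<phi>({x, y} := c)) y = \<phi> {x, y}"
    "z \<noteq> x \<Longrightarrow> z \<noteq> y \<Longrightarrow> mc (\<phi>({x, y} := c)) z = mc \<phi> z"
proof -
  let ?b = "\<phi> {x, y}" and ?\<psi> = "\<phi>({x, y} := c)"
  have V: "x \<in> V" "y \<in> V" using edgeD[OF e] by auto
  have cr: "c \<in> {1..Suc D}" using mc_props(1)[OF \<phi> V(1)] c by simp
  have br: "?b \<in> {1..Suc D}" using edge_colouring_range[OF \<phi> e] .
  have bc: "?b \<noteq> c" using mc_edge[OF \<phi> e] c by simp
  have e': "{y, x} \<in> E" and b': "\<phi> {y, x} = ?b" using e by (simp_all add: insert_commute)
  have only: "e1 = {x, y}" if h: "e1 \<in> bicoloured_edges E \<phi> ?b c" "{x, y} \<inter> e1 \<noteq> {}" for e1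
  proof -
    have E1: "e1 \<in> E" and be: "\<phi> e1 = ?b \<or> \<phi> e1 = c"
      using h(1) unfolding bicoloured_edges_def by simp_all
    from h(2) have "x \<in> e1 \<or> y \<in> e1" by blast
    then show ?thesis
    proof
      assume "x \<in> e1"
      then obtain z where z: "e1 = {x, z}" using edge_at[OF E1] by blast
      then have "\<phi> {x, z} = ?b" using be mc_edge[OF \<phi>, of x z] E1 c by simp
      then show ?thesis using nbr_unique[OF \<phi> e, of z] E1 z by simp
    next
      assume "y \<in> e1"
      then obtain z where z: "e1 = {y, z}" using edge_at[OF E1] by blast
      then have "\<phi> {y, z} = ?b" using be mc_edge[OF \<phi>, of y z] E1 c by simp
      then have "x = z" using nbr_unique[OF \<phi> e', of z] E1 z b' by simp
      then show ?thesis using z by auto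
    qed
  qed
  have cl: "swap_closed E \<phi> ?b c {{x, y}}"
    unfolding swap_closed_def
  proof (intro conjI ballI impI)
    show "{{x, y}} \<subseteq> bicoloured_edges E \<phi> ?b c" using e unfolding bicoloured_edges_def by simp
    fix e1 e2 assume "e1 \<in> {{x, y}}" "e2 \<in> bicoloured_edges E \<phi> ?b c" "e1 \<inter> e2 \<noteq> {}"
    then show "e2 \<in> {{x, y}}" using only by simp
  qed
  have eq: "kempe_swap ?b c {{x, y}} \<phi> = ?\<psi>"
    by (rule ext) (simp add: kempe_swap_def)
  show \<psi>: "col ?\<psi>" using swap_closed_colouring[OF \<phi> cl br cr] eq by simp
  show "eqv \<phi> ?\<psi>" using swap_closed_equiv[OF cl br cr bc] eq by simp
  show "mc ?\<psi> x = ?b"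
  proof (rule mcI[OF \<psi> V(1) br])
    fix z assume "{x, z} \<in> E"
    then show "?\<psi> {x, z} \<noteq> ?b"
      using bc nbr_unique[OF \<phi> e, of z] by (cases "{x, z} = {x, y}") auto
  qed
  show "mc ?\<psi> y = ?b"
  proof (rule mcI[OF \<psi> V(2) br])
    fix z assume z: "{y, z} \<in> E"
    show "?\<psi> {y, z} \<noteq> ?b"
      using bc nbr_unique[OF \<phi> e' z] b' by (cases "{y, z} = {x, y}") auto
  qed
  show "mc ?\<psi> z = mc \<phi> z" if "z \<noteq> x" "z \<noteq> y"
  proof (rule mc_cong)
    fix w
    have "{z, w} \<noteq> {x, y}" using that by blast
    then show "?\<psi> {z, w} = \<phi> {z, w}" by simp
  qed
qed

section \<open>Vizing fans and shifting along them\<close>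

definition fan :: "('a set \<Rightarrow> nat) \<Rightarrow> 'a \<Rightarrow> 'a list \<Rightarrow> bool" where
  "fan \<phi> r ws \<longleftrightarrow> (\<forall>w\<in>set ws. {r, w} \<in> E) \<and>
     (\<forall>i. Suc i < length ws \<longrightarrow> \<phi> {r, ws ! Suc i} = mc \<phi> (ws ! i))"

lemma fan_snoc:
  "fan \<phi> r (ws @ [w]) \<longleftrightarrow> fan \<phi> r ws \<and> {r, w} \<in> E \<and> (ws \<noteq> [] \<longrightarrow> \<phi> {r, w} = mc \<phi> (last ws))"
proof (cases "ws = []")
  case True
  then show ?thesis by (simp add: fan_def)
next
  case False
  have "(\<forall>i. Suc i < length (ws @ [w]) \<longrightarrow> \<phi> {r, (ws @ [w]) ! Suc i} = mc \<phi> ((ws @ [w]) ! i)) \<longleftrightarrow>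
    (\<forall>i. Suc i < length ws \<longrightarrow> \<phi> {r, ws ! Suc i} = mc \<phi> (ws ! i)) \<and> \<phi> {r, w} = mc \<phi> (last ws)"
    (is "?L \<longleftrightarrow> ?R")
  proof
    assume L: ?L
    have "\<phi> {r, ws ! Suc i} = mc \<phi> (ws ! i)" if "Suc i < length ws" for i
      using L[rule_format, of i] that by (simp add: nth_append)
    moreover have "\<phi> {r, w} = mc \<phi> (last ws)"
      using L[rule_format, of "length ws - 1"] False by (simp add: nth_append last_conv_nth)
    ultimately show ?R by blast
  next
    assume R: ?R
    show ?L
    proof (intro allI impI)
      fix i assume "Suc i < length (ws @ [w])"
      then show "\<phi> {r, (ws @ [w]) ! Suc i} = mc \<phi> ((ws @ [w]) ! i)"
      proof (cases "Suc i < length ws")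
        case True
        then show ?thesis using R by (simp add: nth_append)
      next
        case F: False
        then have "Suc i = length ws" using \<open>Suc i < length (ws @ [w])\<close> by simp
        then have "i = length ws - 1" "i < length ws" by simp_all
        then show ?thesis using R False \<open>Suc i = length ws\<close> by (simp add: nth_append last_conv_nth)
      qed
    qed
  qed
  then show ?thesis using False unfolding fan_def by auto
qed

lemma fan_take: "fan \<phi> r ws \<Longrightarrow> fan \<phi> r (take n ws)"
  unfolding fan_def by (auto dest: in_set_takeD)

lemma fan_cong:
  assumes "fan \<phi> r ws" "\<And>w. w \<in> set ws \<Longrightarrow> \<psi> {r, w} = \<phi> {r, w}"
    "\<And>i. Suc i < length ws \<Longrightarrow> mc \<psi> (ws ! i) = mc \<phi> (ws ! i)"
  shows "fan \<psi> r ws"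
  using assms unfolding fan_def by auto

text \<open>Since \<open>{r, w}\<close> determines \<open>w\<close>, the edge to \<open>w\<close> receives the colour missing at \<open>w\<close>.\<close>

definition shift :: "('a set \<Rightarrow> nat) \<Rightarrow> 'a \<Rightarrow> 'a list \<Rightarrow> 'a set \<Rightarrow> nat" where
  "shift \<phi> r ws e = (if \<exists>w\<in>set ws. e = {r, w} then mc \<phi> (SOME w. w \<in> set ws \<and> e = {r, w}) else \<phi> e)"

lemma shift_in: "w \<in> set ws \<Longrightarrow> shift \<phi> r ws {r, w} = mc \<phi> w"
proof -
  assume w: "w \<in> set ws"
  have "(SOME w'. w' \<in> set ws \<and> {r, w} = {r, w'}) = w"
    by (rule some_equality) (use w in \<open>auto simp: doubleton_eq_iff\<close>)
  then show ?thesis using w unfolding shift_def by auto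
qed

lemma shift_out: "(\<And>w. w \<in> set ws \<Longrightarrow> e \<noteq> {r, w}) \<Longrightarrow> shift \<phi> r ws e = \<phi> e"
  unfolding shift_def by auto

text \<open>Recolouring starts at the far end: the last edge takes the colour missing at both of its
  ends, after which \<open>r\<close> misses its old colour, which the preceding leaf misses too.
  Every step is a Kempe change on a single edge.\<close>

lemma fan_shift:
  assumes "col \<phi>" "fan \<phi> r ws" "distinct ws" "ws \<noteq> []" "mc \<phi> (last ws) = mc \<phi> r"
  shows "col (shift \<phi> r ws) \<and> eqv \<phi> (shift \<phi> r ws) \<and> mc (shift \<phi> r ws) r = \<phi> {r, hd ws}"
  using assms
proof (induction ws arbitrary: \<phi> rule: rev_induct)
  case (snoc w ws)
  have f: "fan \<phi> r ws" "{r, w} \<in> E" "ws \<noteq> [] \<Longrightarrow> \<phi> {r, w} = mc \<phi> (last ws)"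
    using snoc.prems(2) fan_snoc by auto
  let ?\<psi> = "\<phi>({r, w} := mc \<phi> r)"
  have \<psi>: "col ?\<psi>" "eqv \<phi> ?\<psi>" "mc ?\<psi> r = \<phi> {r, w}" "z \<noteq> r \<Longrightarrow> z \<noteq> w \<Longrightarrow> mc ?\<psi> z = mc \<phi> z" for z
    using recolour[OF snoc.prems(1) f(2) refl] snoc.prems(5) by auto
  have rw: "r \<notin> set ws" using f(1) edgeD unfolding fan_def by blast
  have mcs: "mc ?\<psi> z = mc \<phi> z" if "z \<in> set ws" for z
  proof -
    have "z \<noteq> r" "z \<noteq> w" using that rw snoc.prems(3) by auto
    then show ?thesis by (rule \<psi>(4))
  qed
  have sh: "shift \<phi> r (ws @ [w]) = shift ?\<psi> r ws"
  proof
    fix e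
    consider (1) z where "z \<in> set ws" "e = {r, z}" | (2) "e = {r, w}" | (3) "\<forall>z\<in>set (ws @ [w]). e \<noteq> {r, z}"
      by auto
    then show "shift \<phi> r (ws @ [w]) e = shift ?\<psi> r ws e"
    proof cases
      case 1
      then show ?thesis using shift_in[of z ws ?\<psi> r] shift_in[of z "ws @ [w]" \<phi> r] mcs by simp
    next
      case 2
      have "shift ?\<psi> r ws e = ?\<psi> e"
        by (rule shift_out) (use 2 snoc.prems(3) in \<open>auto simp: doubleton_eq_iff\<close>)
      then show ?thesis using 2 shift_in[of w "ws @ [w]" \<phi> r] snoc.prems(5) by simp
    next
      case 3
      have "shift ?\<psi> r ws e = ?\<psi> e" by (rule shift_out) (use 3 in simp)
      moreover have "shift \<phi> r (ws @ [w]) e = \<phi> e" by (rule shift_out) (use 3 in blast)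
      ultimately show ?thesis using 3 by simp
    qed
  qed
  show ?case
  proof (cases "ws = []")
    case True
    have "shift ?\<psi> r [] = ?\<psi>" by (rule ext) (simp add: shift_def)
    then have eq: "shift \<phi> r (ws @ [w]) = ?\<psi>" using sh True by simp
    have hd: "hd (ws @ [w]) = w" using True by simp
    show ?thesis unfolding eq hd using \<psi>(1-3) by blast
  next
    case False
    have fan': "fan ?\<psi> r ws"
      by (rule fan_cong[OF f(1)]) (use mcs snoc.prems(3) in \<open>auto simp: doubleton_eq_iff\<close>)
    have dist: "distinct ws" using snoc.prems(3) by simp
    have "mc ?\<psi> (last ws) = mc \<phi> (last ws)" using mcs[of "last ws"] False by simp
    then have "mc ?\<psi> (last ws) = mc ?\<psi> r" using f(3)[OF False] unfolding \<psi>(3) by simp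
    from snoc.IH[OF \<psi>(1) fan' dist False this]
    have IH: "col (shift ?\<psi> r ws)" "eqv ?\<psi> (shift ?\<psi> r ws)" "mc (shift ?\<psi> r ws) r = ?\<psi> {r, hd ws}"
      by blast+
    have "{r, hd ws} \<noteq> {r, w}"
      using False snoc.prems(3) hd_in_set[OF False] by (auto simp: doubleton_eq_iff)
    then have "?\<psi> {r, hd ws} = \<phi> {r, hd (ws @ [w])}" using False by simp
    then show ?thesis unfolding sh using IH equiv_trans[OF \<psi>(2) IH(2)] by metis
  qed
qed simp

text \<open>A longest fan of distinct leaves starting at \<open>w\<close> stops only if the last
  missing colour is also missing at \<open>r\<close> or already sits on a fan edge.\<close>

lemma fan_exists:
  assumes \<phi>: "col \<phi>" and e: "{r, w} \<in> E"
  obtains ws where "fan \<phi> r ws" "distinct ws" "ws \<noteq> []" "hd ws = w"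
    "mc \<phi> (last ws) = mc \<phi> r \<or> (\<exists>j < length ws. \<phi> {r, ws ! j} = mc \<phi> (last ws))"
proof -
  define P where "P ws \<longleftrightarrow> fan \<phi> r ws \<and> distinct ws \<and> ws \<noteq> [] \<and> hd ws = w" for ws
  have sub: "set ws \<subseteq> V" if "P ws" for ws using that edgeD unfolding P_def fan_def by blast
  have bound: "length ws \<le> card V" if "P ws" for ws
    using card_mono[OF finV sub[OF that]] distinct_card that unfolding P_def by metis
  have "P [w]" unfolding P_def fan_def using e by simp
  then obtain ws where ws: "P ws" and max: "\<And>ws'. P ws' \<Longrightarrow> length ws' \<le> length ws"
    using ex_has_greatest_nat[of P "[w]" length "Suc (card V)"] bound by (auto simp: less_Suc_eq_le)
  have ne: "ws \<noteq> []" using ws unfolding P_def by blast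
  have lV: "last ws \<in> V" using sub[OF ws] ne by auto
  have "mc \<phi> (last ws) = mc \<phi> r \<or> (\<exists>j < length ws. \<phi> {r, ws ! j} = mc \<phi> (last ws))"
  proof (rule ccontr)
    assume a: "\<not> ?thesis"
    obtain z where z: "{r, z} \<in> E" "\<phi> {r, z} = mc \<phi> (last ws)"
    proof (rule nbr_ex[OF \<phi> _ mc_props(1)[OF \<phi> lV]])
      show "r \<in> V" using edgeD[OF e] by blast
      show "mc \<phi> (last ws) \<noteq> mc \<phi> r" using a by blast
    qed
    have "z \<notin> set ws" using a z(2) by (metis in_set_conv_nth)
    then have "P (ws @ [z])" using ws z ne unfolding P_def fan_snoc by simp
    then show False using max by force
  qed
  then show ?thesis using that ws unfolding P_def by blast
qed

text \<open>A swap that gives some vertex of a fan the missing colour \<open>a\<close> may disturb the fan only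
  behind the first vertex that now misses \<open>a\<close>.\<close>

lemma fan_prefix:
  assumes len: "\<And>i. Suc i < length ws \<Longrightarrow> \<psi> {r, ws ! Suc i} = mc \<phi> (ws ! i)"
    and E: "\<And>w. w \<in> set ws \<Longrightarrow> {r, w} \<in> E"
    and mcs: "\<And>w. w \<in> set ws \<Longrightarrow> mc \<psi> w = mc \<phi> w \<or> mc \<psi> w = a"
    and ex: "z \<in> set ws" "mc \<psi> z = a"
  obtains n where "0 < n" "n \<le> length ws" "fan \<psi> r (take n ws)" "mc \<psi> (last (take n ws)) = a"
    "\<And>i. Suc i < n \<Longrightarrow> mc \<psi> (ws ! i) \<noteq> a"
proof -
  have "\<exists>i. i < length ws \<and> mc \<psi> (ws ! i) = a" using ex by (metis in_set_conv_nth)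
  then obtain i where i: "i < length ws" "mc \<psi> (ws ! i) = a"
    and least: "\<And>j. j < i \<Longrightarrow> \<not> (j < length ws \<and> mc \<psi> (ws ! j) = a)"
    using exists_least_iff[of "\<lambda>i. i < length ws \<and> mc \<psi> (ws ! i) = a"] by blast
  have lst: "last (take (Suc i) ws) = ws ! i" using i(1) by (simp add: take_Suc_conv_app_nth)
  have "fan \<psi> r (take (Suc i) ws)"
    unfolding fan_def
  proof (intro conjI ballI allI impI)
    show "{r, w} \<in> E" if "w \<in> set (take (Suc i) ws)" for w
      using E[OF in_set_takeD[OF that]] .
    fix j assume j: "Suc j < length (take (Suc i) ws)"
    then have "j < i" "j < length ws" "Suc j < length ws" by auto
    then have "mc \<psi> (ws ! j) = mc \<phi> (ws ! j)" using least mcs[of "ws ! j"] by auto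
    then show "\<psi> {r, take (Suc i) ws ! Suc j} = mc \<psi> (take (Suc i) ws ! j)"
      using len[of j] j by simp
  qed
  then show ?thesis using that[of "Suc i"] i lst least by auto
qed

lemma mc_eq_iff:
  assumes "col \<phi>" "x \<in> V" "c \<in> {1..Suc D}"
  shows "mc \<phi> x = c \<longleftrightarrow> (\<forall>y. {x, y} \<in> E \<longrightarrow> \<phi> {x, y} \<noteq> c)"
  using mcI[OF assms] mc_edge[OF assms(1)] by metis

lemma swap_closedI:
  assumes "K \<subseteq> bicoloured_edges E \<phi> c d"
    "\<And>e z w. e \<in> K \<Longrightarrow> z \<in> e \<Longrightarrow> {z, w} \<in> E \<Longrightarrow> \<phi> {z, w} = c \<or> \<phi> {z, w} = d \<Longrightarrow> {z, w} \<in> K"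
  shows "swap_closed E \<phi> c d K"
  unfolding swap_closed_def
proof (intro conjI ballI impI)
  show "K \<subseteq> bicoloured_edges E \<phi> c d" by fact
  fix e e' assume e: "e \<in> K" "e' \<in> bicoloured_edges E \<phi> c d" "e \<inter> e' \<noteq> {}"
  then obtain z where z: "z \<in> e" "z \<in> e'" by blast
  have e': "e' \<in> E" "\<phi> e' = c \<or> \<phi> e' = d" using e(2) unfolding bicoloured_edges_def by simp_all
  obtain w where "e' = {z, w}" using edge_at[OF e'(1) z(2)] by blast
  then show "e' \<in> K" using assms(2)[OF e(1) z(1)] e' by simp
qed

end

section \<open>Modifying one colour class\<close>

text \<open>The last assumption of this locale and that of the next one deny the desired modification of the
  class of \<open>\<omega>\<close>, so their final lemmas are contradictions.\<close>

locale irremovable = regular_triangle_free +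
  fixes \<phi>0 :: "'a set \<Rightarrow> nat" and \<omega> :: nat and u v :: 'a
  assumes col0: "col \<phi>0" and uv: "{u, v} \<in> E" and \<phi>0_uv: "\<phi>0 {u, v} = \<omega>"
    and no_removal: "\<And>\<psi>. col \<psi> \<Longrightarrow> eqv \<phi>0 \<psi> \<Longrightarrow>
      \<exists>e\<in>E. \<not> (\<psi> e = \<omega> \<longleftrightarrow> \<phi>0 e = \<omega> \<and> e \<noteq> {u, v})"
begin

text \<open>The family for which the following claims are proved. It is stable under swaps of two
  colours other than \<open>\<omega>\<close>, so a claim may be applied again after such a
  swap.\<close>

definition C :: "('a set \<Rightarrow> nat) \<Rightarrow> bool" where
  "C \<phi> \<longleftrightarrow> col \<phi> \<and> eqv \<phi>0 \<phi> \<and> (\<forall>e\<in>E. \<phi> e = \<omega> \<longleftrightarrow> \<phi>0 e = \<omega>)"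

lemma C0: "C \<phi>0"
  unfolding C_def using col0 by simp

lemma C_col: "C \<phi> \<Longrightarrow> col \<phi>"
  unfolding C_def by simp

lemma C_class: "C \<phi> \<Longrightarrow> e \<in> E \<Longrightarrow> \<phi> e = \<omega> \<longleftrightarrow> \<phi>0 e = \<omega>"
  unfolding C_def by simp

lemma vu: "{v, u} \<in> E" using uv by (simp add: insert_commute)

lemma uV: "u \<in> V" and vV: "v \<in> V" and u_ne_v: "u \<noteq> v"
  using edgeD[OF uv] by auto

lemma \<omega>_range: "\<omega> \<in> {1..Suc D}"
  using edge_colouring_range[OF col0 uv] \<phi>0_uv by simp

lemma C_free: "C \<phi> \<Longrightarrow> x \<in> V \<Longrightarrow> mc \<phi> x = \<omega> \<longleftrightarrow> mc \<phi>0 x = \<omega>"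
  using mc_eq_iff[OF C_col _ \<omega>_range, of \<phi> x] mc_eq_iff[OF col0 _ \<omega>_range, of x] C_class[of \<phi>] by simp

lemma C_uv: assumes "C \<phi>" shows "\<phi> {u, v} = \<omega>" "\<phi> {v, u} = \<omega>"
  using C_class[OF assms uv] \<phi>0_uv by (simp_all add: insert_commute)

lemma C_mc_uv: assumes "C \<phi>" shows "mc \<phi> u \<noteq> \<omega>" "mc \<phi> v \<noteq> \<omega>"
  using mc_edge[OF C_col[OF assms] uv] mc_edge'[OF C_col[OF assms] uv] C_uv[OF assms] by auto

lemma C_range: "C \<phi> \<Longrightarrow> x \<in> V \<Longrightarrow> mc \<phi> x \<in> {1..Suc D}"
  using mc_props(1)[OF C_col] by blast

lemma C_swp:
  assumes "C \<phi>" "c \<in> {1..Suc D}" "d \<in> {1..Suc D}" "c \<noteq> d" "c \<noteq> \<omega>" "d \<noteq> \<omega>"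
  shows "C (swp \<phi> c d q)"
proof -
  have "eqv \<phi>0 (swp \<phi> c d q)"
    using equiv_trans[OF _ swp_eqv[OF C_col[OF assms(1)] assms(2-4)]] assms(1) unfolding C_def by blast
  moreover have "swp \<phi> c d q e = \<omega> \<longleftrightarrow> \<phi>0 e = \<omega>" if "e \<in> E" for e
    using swp_iff[OF C_col[OF assms(1)] assms(2-4) that, of \<omega>] assms(5,6) C_class[OF assms(1) that] by metis
  ultimately show ?thesis
    unfolding C_def using swp_col[OF C_col[OF assms(1)] assms(2-4)] by blast
qed

lemma C_recolour:
  assumes "C \<phi>" "{x, y} \<in> E" "mc \<phi> x = c" "mc \<phi> y = c" "c \<noteq> \<omega>" "\<phi> {x, y} \<noteq> \<omega>"
  shows "C (\<phi>({x, y} := c))"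
proof -
  note r = recolour[OF C_col[OF assms(1)] assms(2-4)]
  have "eqv \<phi>0 (\<phi>({x, y} := c))" using equiv_trans[OF _ r(2)] assms(1) unfolding C_def by blast
  moreover have "(\<phi>({x, y} := c)) e = \<omega> \<longleftrightarrow> \<phi>0 e = \<omega>" if "e \<in> E" for e
    using C_class[OF assms(1) that] assms(5,6) by (cases "e = {x, y}") auto
  ultimately show ?thesis unfolding C_def using r(1) by blast
qed

text \<open>Shift from the far end: an edge other than \<open>vu\<close> is not coloured
  \<open>\<omega>\<close>, so recolouring it stays in \<open>C\<close> and shortens the fan. Once
  only \<open>u\<close> is left, recolouring \<open>uv\<close> deletes just this edge from the
  class, which \<open>no_removal\<close> forbids.\<close>

lemma fan_last_ne:
  assumes "C \<phi>" "fan \<phi> v xs" "distinct xs" "xs \<noteq> []" "hd xs = u"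
  shows "mc \<phi> (last xs) \<noteq> mc \<phi> v"
  using assms
proof (induction xs arbitrary: \<phi> rule: rev_induct)
  case (snoc x xs)
  show ?case
  proof
    assume "mc \<phi> (last (xs @ [x])) = mc \<phi> v"
    then have mx: "mc \<phi> x = mc \<phi> v" by simp
    have f: "fan \<phi> v xs" "{v, x} \<in> E" "xs \<noteq> [] \<Longrightarrow> \<phi> {v, x} = mc \<phi> (last xs)"
      using snoc.prems(2) fan_snoc by auto
    let ?a = "mc \<phi> v"
    let ?\<psi> = "\<phi>({v, x} := ?a)"
    note r = recolour[OF C_col[OF snoc.prems(1)] f(2) refl mx]
    have a\<omega>: "?a \<noteq> \<omega>" using C_mc_uv(2)[OF snoc.prems(1)] .
    show False
    proof (cases "xs = []")
      case True
      then have xu: "x = u" using snoc.prems(5) by simp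
      have "eqv \<phi>0 ?\<psi>" using equiv_trans[OF _ r(2)] snoc.prems(1) unfolding C_def by blast
      then obtain e where e: "e \<in> E" "\<not> (?\<psi> e = \<omega> \<longleftrightarrow> \<phi>0 e = \<omega> \<and> e \<noteq> {u, v})"
        using no_removal[OF r(1)] by blast
      show False
        using e C_class[OF snoc.prems(1) e(1)] a\<omega> xu
        by (cases "e = {u, v}") (auto simp: insert_commute)
    next
      case False
      have uxs: "u \<in> set xs" using snoc.prems(5) False by (metis hd_append2 hd_in_set)
      then have "x \<noteq> u" using snoc.prems(3) by auto
      then have "\<phi> {v, x} \<noteq> \<omega>"
        using nbr_unique[OF C_col[OF snoc.prems(1)] f(2) vu] C_uv(2)[OF snoc.prems(1)] by metis
      then have C': "C ?\<psi>" using C_recolour[OF snoc.prems(1) f(2) refl mx a\<omega>] by blast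
      have vxs: "v \<notin> set xs" using f(1) edgeD unfolding fan_def by blast
      have mcs: "mc ?\<psi> z = mc \<phi> z" if "z \<in> set xs" for z
      proof -
        have "z \<noteq> v" "z \<noteq> x" using that vxs snoc.prems(3) by auto
        then show ?thesis by (rule r(5))
      qed
      have fan': "fan ?\<psi> v xs"
        by (rule fan_cong[OF f(1)]) (use mcs snoc.prems(3) in \<open>auto simp: doubleton_eq_iff\<close>)
      have "mc ?\<psi> (last xs) = mc ?\<psi> v"
        using mcs[of "last xs"] False f(3) unfolding r(3) by simp
      moreover have "distinct xs" "hd xs = u" using snoc.prems(3,5) False by auto
      ultimately show False using snoc.IH[OF C' fan' _ False] by blast
    qed
  qed
qed simp

lemma fan_mc_ne:
  assumes "C \<phi>" "fan \<phi> v xs" "distinct xs" "hd xs = u" "w \<in> set xs"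
  shows "mc \<phi> w \<noteq> mc \<phi> v"
proof -
  obtain i where i: "i < length xs" "xs ! i = w" using assms(5) by (metis in_set_conv_nth)
  have ne: "take (Suc i) xs \<noteq> []" using i by auto
  have "hd (take (Suc i) xs) = u" using assms(4) by simp
  moreover have "last (take (Suc i) xs) = w" using i by (simp add: take_Suc_conv_app_nth)
  ultimately show ?thesis
    using fan_last_ne[OF assms(1) fan_take[OF assms(2)] distinct_take[OF assms(3)] ne] by simp
qed

text \<open>If the chain at \<open>z\<close> avoided \<open>v\<close>, swapping it would make
  \<open>z\<close> miss \<open>mc \<phi> v\<close> without affecting \<open>v\<close>; the fan up to
  its first leaf missing that colour would contradict \<open>fan_last_ne\<close>.\<close>

lemma fan_linked:
  assumes C: "C \<phi>" and fan: "fan \<phi> v xs" and dist: "distinct xs" and hd: "hd xs = u"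
    and z: "z \<in> set xs" "mc \<phi> z \<noteq> \<omega>"
  shows "conn \<phi> (mc \<phi> v) (mc \<phi> z) v z"
proof (rule ccontr)
  let ?a = "mc \<phi> v" and ?d = "mc \<phi> z"
  assume "\<not> ?thesis"
  then have nc: "\<not> conn \<phi> ?a ?d z v" using conn_sym by blast
  let ?\<psi> = "swp \<phi> ?a ?d z"
  have E: "{v, w} \<in> E" if "w \<in> set xs" for w using fan that unfolding fan_def by blast
  have xV: "w \<in> V" if "w \<in> set xs" for w using E[OF that] edgeD by blast
  have ad: "?a \<noteq> ?d" using fan_mc_ne[OF C fan dist hd z(1)] by simp
  note cd = C_range[OF C vV] C_range[OF C xV[OF z(1)]] ad
  note cc = C_col[OF C]
  have C': "C ?\<psi>" using C_swp[OF C cd C_mc_uv(2)[OF C] z(2)] .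
  have edges: "?\<psi> {v, w} = \<phi> {v, w}" if "{v, w} \<in> E" for w
    using swp_edge[OF cc cd that] nc by simp
  have mv: "mc ?\<psi> v = ?a" using swp_mc[OF cc cd vV] nc by simp
  have mcs: "mc ?\<psi> w = mc \<phi> w \<or> mc ?\<psi> w = ?a" if "w \<in> set xs" for w
    using swp_mc[OF cc cd xV[OF that], of z] fan_mc_ne[OF C fan dist hd that]
    by (cases "mc \<phi> w = ?d") auto
  have mz: "mc ?\<psi> z = ?a" using swp_mc[OF cc cd xV[OF z(1)], of z] by simp
  obtain n where n: "0 < n" "n \<le> length xs" "fan ?\<psi> v (take n xs)" "mc ?\<psi> (last (take n xs)) = ?a"
  proof (rule fan_prefix[of xs ?\<psi> v \<phi> ?a z])
    show "?\<psi> {v, xs ! Suc i} = mc \<phi> (xs ! i)" if "Suc i < length xs" for i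
      using edges[OF E[OF nth_mem[OF that]]] fan that unfolding fan_def by simp
  qed (use E mcs z(1) mz in blast)+
  have "hd (take n xs) = u" "take n xs \<noteq> []" using hd n(1,2) by auto
  then show False using fan_last_ne[OF C' n(3) distinct_take[OF dist]] n(4) mv by simp
qed

lemma mc_uv_ne: "C \<phi> \<Longrightarrow> mc \<phi> u \<noteq> mc \<phi> v"
  using fan_last_ne[of \<phi> "[u]"] vu by (simp add: fan_def)

lemma uv_linked: "C \<phi> \<Longrightarrow> conn \<phi> (mc \<phi> v) (mc \<phi> u) v u"
  using fan_linked[of \<phi> "[u]" u] vu C_mc_uv by (simp add: fan_def)

lemma fan_to_free:
  assumes C: "C \<phi>"
  obtains xs where "fan \<phi> v xs" "distinct xs" "xs \<noteq> []" "hd xs = u" "mc \<phi> (last xs) = \<omega>"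
proof -
  note cc = C_col[OF C]
  obtain xs where xs: "fan \<phi> v xs" "distinct xs" "xs \<noteq> []" "hd xs = u"
    and end_xs: "mc \<phi> (last xs) = mc \<phi> v \<or> (\<exists>j < length xs. \<phi> {v, xs ! j} = mc \<phi> (last xs))"
    using fan_exists[OF cc vu] by blast
  then obtain j where j: "j < length xs" "\<phi> {v, xs ! j} = mc \<phi> (last xs)"
    using fan_last_ne[OF C xs] by blast
  \<comment> \<open>The last missing colour recurs on the edge to \<open>xs ! j\<close>. For
    \<open>j = 0\<close> it is the colour of \<open>vu\<close>. For \<open>j > 0\<close> the leaf
    before \<open>xs ! j\<close> misses it too, and by \<open>fan_linked\<close> one chain would
    have three ends unless the colour is \<open>\<omega>\<close>.\<close>
  have "mc \<phi> (last xs) = \<omega>"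
  proof (cases j)
    case 0
    then show ?thesis using j xs(3,4) C_uv(2)[OF C] by (simp add: hd_conv_nth)
  next
    case (Suc i)
    let ?z = "last xs" and ?y = "xs ! i"
    have E: "{v, w} \<in> E" if "w \<in> set xs" for w using xs(1) that unfolding fan_def by blast
    have xV: "w \<in> V" if "w \<in> set xs" for w using E[OF that] edgeD by blast
    have zy: "mc \<phi> ?z = mc \<phi> ?y" using xs(1) j Suc unfolding fan_def by simp
    have ne: "?z \<noteq> ?y" using xs(2,3) j(1) Suc by (simp add: last_conv_nth nth_eq_iff_index_eq)
    have set: "?z \<in> set xs" "?y \<in> set xs" using xs(3) j(1) Suc by auto
    show ?thesis
    proof (rule ccontr)
      assume z\<omega>: "\<not> ?thesis"
      then have y\<omega>: "mc \<phi> ?y \<noteq> \<omega>" using zy by simp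
      have l: "conn \<phi> (mc \<phi> v) (mc \<phi> ?z) v ?z" "conn \<phi> (mc \<phi> v) (mc \<phi> ?z) v ?y"
        using fan_linked[OF C xs(1,2,4) set(1) z\<omega>] fan_linked[OF C xs(1,2,4) set(2) y\<omega>] zy by simp_all
      have "?z \<noteq> v" "?y \<noteq> v" using E[OF set(1)] E[OF set(2)] edgeD by blast+
      then have "?z = ?y"
        using chain_ends[OF cc l vV xV[OF set(1)] xV[OF set(2)]] zy by simp
      then show False using ne by simp
    qed
  qed
  then show ?thesis using that xs by blast
qed

end

locale unexchangeable = irremovable +
  fixes t :: 'a
  assumes tu: "{t, u} \<in> E" and t_ne_v: "t \<noteq> v" and t_free0: "mc \<phi>0 t = \<omega>"
    and no_win: "\<And>\<psi>. col \<psi> \<Longrightarrow> eqv \<phi>0 \<psi> \<Longrightarrow>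
      (\<And>e. e \<in> E \<Longrightarrow> \<phi>0 e = \<omega> \<Longrightarrow> e \<noteq> {u, v} \<Longrightarrow> \<psi> e = \<omega>) \<Longrightarrow> \<psi> {t, u} \<noteq> \<omega>"
begin

section \<open>Colours excluded by the impossible exchange\<close>

lemma ut: "{u, t} \<in> E" using tu by (simp add: insert_commute)

lemma tV: "t \<in> V" and t_ne_u: "t \<noteq> u" using edgeD[OF tu] by auto

lemma t_free: "C \<phi> \<Longrightarrow> mc \<phi> t = \<omega>"
  using C_free[OF _ tV] t_free0 by blast

text \<open>It suffices to free \<open>u\<close> and keep \<open>t\<close> free, as
  \<open>tu\<close> can then take \<open>\<omega>\<close>. Further edges may join the class; only
  edges other than \<open>uv\<close> must not leave it.\<close>

lemma no_win_free:
  assumes "col \<psi>" "eqv \<phi>0 \<psi>" "\<And>e. e \<in> E \<Longrightarrow> \<phi>0 e = \<omega> \<Longrightarrow> e \<noteq> {u, v} \<Longrightarrow> \<psi> e = \<omega>"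
    "mc \<psi> t = \<omega>" "mc \<psi> u = \<omega>"
  shows False
proof -
  note r = recolour[OF assms(1) tu assms(4,5)]
  have "eqv \<phi>0 (\<psi>({t, u} := \<omega>))" using equiv_trans[OF assms(2) r(2)] .
  moreover have "(\<psi>({t, u} := \<omega>)) e = \<omega>" if "e \<in> E" "\<phi>0 e = \<omega>" "e \<noteq> {u, v}" for e
    using assms(3)[OF that] by simp
  ultimately show False using no_win[OF r(1)] by fastforce
qed

lemma free_not_adj_tv: "{v, t} \<notin> E"
  using no_triangle[OF vu ut] by blast

text \<open>The path \<open>v\<close>, \<open>u\<close>, \<open>t\<close> would be a complete Kempe
  chain, as \<open>v\<close> misses the colour of \<open>ut\<close> and \<open>t\<close> misses
  \<open>\<omega>\<close>. Swapping it is the exchange.\<close>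

lemma ut_ne_v: assumes C: "C \<phi>" shows "\<phi> {u, t} \<noteq> mc \<phi> v"
proof
  let ?a = "mc \<phi> v"
  assume eq: "\<phi> {u, t} = ?a"
  note cc = C_col[OF C]
  let ?K = "{{u, v}, {u, t}}"
  have cl: "swap_closed E \<phi> \<omega> ?a ?K"
  proof (rule swap_closedI)
    show "?K \<subseteq> bicoloured_edges E \<phi> \<omega> ?a"
      unfolding bicoloured_edges_def using uv ut C_uv[OF C] eq by simp
    fix e z w assume h: "e \<in> ?K" "z \<in> e" "{z, w} \<in> E" "\<phi> {z, w} = \<omega> \<or> \<phi> {z, w} = ?a"
    consider "z = u" | "z = v" | "z = t" using h(1,2) by blast
    then show "{z, w} \<in> ?K"
    proof cases
      case 1
      then have "w = v \<or> w = t"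
        using h(3,4) nbr_unique[OF cc _ uv] nbr_unique[OF cc _ ut] C_uv(1)[OF C] eq by metis
      then show ?thesis using 1 by blast
    next
      case 2
      then have "\<phi> {v, w} = \<omega>" using h(3,4) mc_edge[OF cc, of v w] by blast
      then have "w = u" using nbr_unique[OF cc _ vu] h(3) 2 C_uv(2)[OF C] by metis
      then show ?thesis using 2 by (simp add: insert_commute)
    next
      case 3
      then have "\<phi> {t, w} = ?a" using h(3,4) mc_edge[OF cc, of t w] t_free[OF C] by metis
      moreover have "\<phi> {t, u} = ?a" using eq by (simp add: insert_commute)
      ultimately have "w = u" using nbr_unique[OF cc _ tu] h(3) 3 by metis
      then show ?thesis using 3 by (simp add: insert_commute)
    qed
  qed
  let ?\<psi> = "kempe_swap \<omega> ?a ?K \<phi>"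
  have a\<omega>: "\<omega> \<noteq> ?a" using C_mc_uv(2)[OF C] by simp
  have "eqv \<phi> ?\<psi>" by (rule swap_closed_equiv[OF cl \<omega>_range C_range[OF C vV] a\<omega>])
  then have "eqv \<phi>0 ?\<psi>" using equiv_trans C unfolding C_def by blast
  moreover have "col ?\<psi>" by (rule swap_closed_colouring[OF cc cl \<omega>_range C_range[OF C vV]])
  moreover have "?\<psi> e = \<omega>" if "e \<in> E" "\<phi>0 e = \<omega>" "e \<noteq> {u, v}" for e
  proof -
    have "\<phi> e = \<omega>" using that C_class[OF C] by blast
    moreover have "e \<noteq> {u, t}" using \<open>\<phi> e = \<omega>\<close> eq a\<omega> by metis
    ultimately show ?thesis using that(3) unfolding kempe_swap_def by simp
  qed
  moreover have "?\<psi> {t, u} = \<omega>" using eq unfolding kempe_swap_def by (simp add: insert_commute)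
  ultimately show False using no_win by blast
qed

text \<open>The path \<open>u\<close>, \<open>v\<close>, \<open>f\<close> would be a complete Kempe
  chain. Its swap moves \<open>\<omega>\<close> from \<open>uv\<close> to \<open>vf\<close>, which
  frees \<open>u\<close>; \<open>t\<close> stays free because it is not adjacent to
  \<open>v\<close>.\<close>

lemma vf_ne_u:
  assumes C: "C \<phi>" and f: "mc \<phi> f = \<omega>" "{v, f} \<in> E" shows "\<phi> {v, f} \<noteq> mc \<phi> u"
proof
  let ?c = "mc \<phi> u"
  assume eq: "\<phi> {v, f} = ?c"
  note cc = C_col[OF C]
  let ?K = "{{v, u}, {v, f}}"
  have fv: "{f, v} \<in> E" "\<phi> {f, v} = ?c" using f eq by (simp_all add: insert_commute)
  have cl: "swap_closed E \<phi> \<omega> ?c ?K"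
  proof (rule swap_closedI)
    show "?K \<subseteq> bicoloured_edges E \<phi> \<omega> ?c"
      unfolding bicoloured_edges_def using vu f C_uv[OF C] eq by simp
    fix e z w assume h: "e \<in> ?K" "z \<in> e" "{z, w} \<in> E" "\<phi> {z, w} = \<omega> \<or> \<phi> {z, w} = ?c"
    consider "z = v" | "z = u" | "z = f" using h(1,2) by blast
    then show "{z, w} \<in> ?K"
    proof cases
      case 1
      then have "w = u \<or> w = f"
        using h(3,4) nbr_unique[OF cc _ vu] nbr_unique[OF cc _ f(2)] C_uv(2)[OF C] eq by metis
      then show ?thesis using 1 by blast
    next
      case 2
      then have "\<phi> {u, w} = \<omega>" using h(3,4) mc_edge[OF cc, of u w] by blast
      then have "w = v" using nbr_unique[OF cc _ uv] h(3) 2 C_uv(1)[OF C] by metis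
      then show ?thesis using 2 by (simp add: insert_commute)
    next
      case 3
      then have "\<phi> {f, w} = ?c" using h(3,4) mc_edge[OF cc, of f w] f(1) by metis
      then have "w = v" using nbr_unique[OF cc _ fv(1)] h(3) 3 fv(2) by metis
      then show ?thesis using 3 by (simp add: insert_commute)
    qed
  qed
  let ?\<psi> = "kempe_swap \<omega> ?c ?K \<phi>"
  have c\<omega>: "\<omega> \<noteq> ?c" using C_mc_uv(1)[OF C] by simp
  have "eqv \<phi> ?\<psi>" by (rule swap_closed_equiv[OF cl \<omega>_range C_range[OF C uV] c\<omega>])
  then have e\<psi>: "eqv \<phi>0 ?\<psi>" using equiv_trans C unfolding C_def by blast
  have c\<psi>: "col ?\<psi>" by (rule swap_closed_colouring[OF cc cl \<omega>_range C_range[OF C uV]])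
  have "?\<psi> e = \<omega>" if "e \<in> E" "\<phi>0 e = \<omega>" "e \<noteq> {u, v}" for e
  proof -
    have "\<phi> e = \<omega>" using that C_class[OF C] by blast
    moreover have "e \<noteq> {v, f}" using \<open>\<phi> e = \<omega>\<close> eq c\<omega> by metis
    ultimately show ?thesis using that(3) unfolding kempe_swap_def by (simp add: insert_commute)
  qed
  moreover have "mc ?\<psi> t = \<omega>"
  proof -
    have tf: "t \<noteq> f" using free_not_adj_tv f(2) by blast
    have "mc ?\<psi> t = mc \<phi> t"
    proof (rule mc_cong)
      fix y
      have "{t, y} \<notin> ?K" using t_ne_u t_ne_v tf by (auto simp: doubleton_eq_iff)
      then show "?\<psi> {t, y} = \<phi> {t, y}" unfolding kempe_swap_def by simp
    qed
    then show ?thesis using t_free[OF C] by simp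
  qed
  moreover have "mc ?\<psi> u = \<omega>"
  proof (rule mcI[OF c\<psi> uV \<omega>_range])
    fix y assume y: "{u, y} \<in> E"
    show "?\<psi> {u, y} \<noteq> \<omega>"
    proof (cases "y = v")
      case True
      then show ?thesis using C_uv(1)[OF C] c\<omega> unfolding kempe_swap_def by (simp add: insert_commute)
    next
      case False
      then have "\<phi> {u, y} \<noteq> \<omega>" using nbr_unique[OF cc y uv] C_uv(1)[OF C] by metis
      moreover have "u \<noteq> f" using f(1) C_mc_uv(1)[OF C] by metis
      then have "{u, y} \<notin> ?K" using False u_ne_v by (auto simp: doubleton_eq_iff)
      ultimately show ?thesis unfolding kempe_swap_def by simp
    qed
  qed
  ultimately show False using no_win_free[OF c\<psi> e\<psi>] by blast
qed

text \<open>The path \<open>t\<close>, \<open>u\<close>, \<open>v\<close>, \<open>f\<close> would be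
  a complete Kempe chain with both ends missing \<open>\<omega>\<close>; swapping it trades
  \<open>uv\<close> for \<open>tu\<close> and \<open>vf\<close>.\<close>

lemma vf_ne_ut:
  assumes C: "C \<phi>" and f: "mc \<phi> f = \<omega>" "{v, f} \<in> E" shows "\<phi> {v, f} \<noteq> \<phi> {u, t}"
proof
  let ?b = "\<phi> {u, t}"
  assume eq: "\<phi> {v, f} = ?b"
  note cc = C_col[OF C]
  let ?K = "{{u, v}, {u, t}, {v, f}}"
  have tub: "\<phi> {t, u} = ?b" by (simp add: insert_commute)
  have fv: "{f, v} \<in> E" "\<phi> {f, v} = ?b" using f eq by (simp_all add: insert_commute)
  have b\<omega>: "\<omega> \<noteq> ?b" using mc_edge[OF cc tu] t_free[OF C] tub by simp
  have cl: "swap_closed E \<phi> \<omega> ?b ?K"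
  proof (rule swap_closedI)
    show "?K \<subseteq> bicoloured_edges E \<phi> \<omega> ?b"
      unfolding bicoloured_edges_def using uv ut f C_uv[OF C] eq by simp
    fix e z w assume h: "e \<in> ?K" "z \<in> e" "{z, w} \<in> E" "\<phi> {z, w} = \<omega> \<or> \<phi> {z, w} = ?b"
    consider "z = v" | "z = u" | "z = f" | "z = t" using h(1,2) by blast
    then show "{z, w} \<in> ?K"
    proof cases
      case 1
      then have "w = u \<or> w = f"
        using h(3,4) nbr_unique[OF cc _ vu] nbr_unique[OF cc _ f(2)] C_uv(2)[OF C] eq by metis
      then show ?thesis using 1 by (auto simp: insert_commute)
    next
      case 2
      then have "w = v \<or> w = t"
        using h(3,4) nbr_unique[OF cc _ uv] nbr_unique[OF cc _ ut] C_uv(1)[OF C] by metis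
      then show ?thesis using 2 by blast
    next
      case 3
      then have "\<phi> {f, w} = ?b" using h(3,4) mc_edge[OF cc, of f w] f(1) by metis
      then have "w = v" using nbr_unique[OF cc _ fv(1)] h(3) 3 fv(2) by metis
      then show ?thesis using 3 by (simp add: insert_commute)
    next
      case 4
      then have "\<phi> {t, w} = ?b" using h(3,4) mc_edge[OF cc, of t w] t_free[OF C] by metis
      then have "w = u" using nbr_unique[OF cc _ tu] h(3) 4 tub by metis
      then show ?thesis using 4 by (simp add: insert_commute)
    qed
  qed
  let ?\<psi> = "kempe_swap \<omega> ?b ?K \<phi>"
  have br: "?b \<in> {1..Suc D}" using edge_colouring_range[OF cc ut] .
  have "eqv \<phi> ?\<psi>" by (rule swap_closed_equiv[OF cl \<omega>_range br b\<omega>])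
  then have "eqv \<phi>0 ?\<psi>" using equiv_trans C unfolding C_def by blast
  moreover have "col ?\<psi>" by (rule swap_closed_colouring[OF cc cl \<omega>_range br])
  moreover have "?\<psi> e = \<omega>" if "e \<in> E" "\<phi>0 e = \<omega>" "e \<noteq> {u, v}" for e
  proof -
    have "\<phi> e = \<omega>" using that C_class[OF C] by blast
    moreover have "e \<noteq> {v, f}" "e \<noteq> {u, t}" using \<open>\<phi> e = \<omega>\<close> eq b\<omega> by metis+
    ultimately show ?thesis using that(3) unfolding kempe_swap_def by simp
  qed
  moreover have "?\<psi> {t, u} = \<omega>" using tub unfolding kempe_swap_def by (simp add: insert_commute)
  ultimately show False using no_win by blast
qed

lemma ut_colour:
  assumes C: "C \<phi>"
  shows "\<phi> {u, t} \<in> {1..Suc D}" "\<phi> {u, t} \<noteq> \<omega>" "\<phi> {u, t} \<noteq> mc \<phi> u"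
  using edge_colouring_range[OF C_col[OF C] ut] mc_edge'[OF C_col[OF C] ut] mc_edge[OF C_col[OF C] ut] t_free[OF C]
  by auto

text \<open>Otherwise swapping the chain at \<open>v\<close> makes \<open>v\<close> miss the colour
  of \<open>ut\<close> and leaves that edge alone, against \<open>ut_ne_v\<close>.\<close>

lemma ut_linked:
  assumes C: "C \<phi>" shows "conn \<phi> (mc \<phi> v) (\<phi> {u, t}) v u"
proof (rule ccontr)
  let ?a = "mc \<phi> v" and ?b = "\<phi> {u, t}"
  assume nc: "\<not> ?thesis"
  note cc = C_col[OF C]
  note cd = C_range[OF C vV] ut_colour(1)[OF C] ut_ne_v[OF C, symmetric]
  let ?\<psi> = "swp \<phi> ?a ?b v"
  have C': "C ?\<psi>" using C_swp[OF C cd C_mc_uv(2)[OF C] ut_colour(2)[OF C]] .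
  have "?\<psi> {u, t} = ?b" using swp_edge[OF cc cd ut] nc by simp
  moreover have "mc ?\<psi> v = ?b" using swp_mc[OF cc cd vV, of v] by simp
  ultimately show False using ut_ne_v[OF C'] by simp
qed

end

section \<open>Counting fans at a neighbour of \<open>v\<close>\<close>

locale fan_centre = unexchangeable +
  fixes x s :: 'a
  assumes vx: "{v, x} \<in> E" and vs: "{v, s} \<in> E"
begin

text \<open>From \<open>v\<close>, the colour missing at \<open>u\<close> leads to \<open>x\<close>,
  so \<open>u\<close>, \<open>x\<close> begin a fan; the colour of \<open>ut\<close> leads to
  \<open>s\<close>, the neighbour where fans are counted. Both vertices are fixed, and
  \<open>Q\<close> says that a modified colouring still leads to them.\<close>

definition Q :: "('a set \<Rightarrow> nat) \<Rightarrow> bool" where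
  "Q \<phi> \<longleftrightarrow> C \<phi> \<and> \<phi> {v, x} = mc \<phi> u \<and> \<phi> {v, s} = \<phi> {u, t}"

lemma xV: "x \<in> V" and sV: "s \<in> V" using edgeD[OF vx] edgeD[OF vs] by auto

lemma sv: "{s, v} \<in> E" using vs by (simp add: insert_commute)

lemma s_ne_v: "s \<noteq> v" and x_ne_v: "x \<noteq> v" using edgeD[OF vx] edgeD[OF vs] by auto

lemma nbr_of_s: "{s, w} \<in> E \<Longrightarrow> w \<in> V \<and> w \<noteq> s \<and> w \<noteq> u \<and> w \<noteq> x"
  using edgeD[of s w] no_triangle[of s v u] no_triangle[of s v x] sv vu vx by auto

context
  fixes \<phi>
  assumes Q: "Q \<phi>"
begin

lemma QC: "C \<phi>" using Q unfolding Q_def by simp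

lemma Qc: "col \<phi>" using C_col[OF QC] .

lemma Qx: "\<phi> {v, x} = mc \<phi> u" and Qs: "\<phi> {v, s} = \<phi> {u, t}" using Q unfolding Q_def by simp_all

lemma Qs': "\<phi> {s, v} = \<phi> {u, t}" using Qs by (simp add: insert_commute)

lemma x_nonfree: "mc \<phi> x \<noteq> \<omega>" using vf_ne_u[OF QC _ vx] Qx by blast

lemma s_nonfree: "mc \<phi> s \<noteq> \<omega>" using vf_ne_ut[OF QC _ vs] Qs by blast

lemma u_ne_x: "u \<noteq> x" using Qx C_uv(2)[OF QC] C_mc_uv(1)[OF QC] by auto

lemma s_ne_u: "s \<noteq> u" using Qs C_uv(2)[OF QC] ut_colour(2)[OF QC] by auto

lemma s_ne_x: "s \<noteq> x" using Qx Qs ut_colour(3)[OF QC] by auto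

lemma fan_ux: "fan \<phi> v [u, x]" using vu vx Qx by (simp add: fan_def)

lemma linked_x: "conn \<phi> (mc \<phi> v) (mc \<phi> x) v x"
  using fan_linked[OF QC fan_ux] u_ne_x x_nonfree by simp

lemma mc_x: "mc \<phi> x \<noteq> mc \<phi> u" "mc \<phi> x \<noteq> mc \<phi> v"
  using mc_edge'[OF Qc vx] Qx fan_mc_ne[OF QC fan_ux] u_ne_x by auto

lemma mc_s_ut: "mc \<phi> s \<noteq> \<phi> {u, t}" using mc_edge'[OF Qc vs] Qs by simp

end

text \<open>Recolouring \<open>vs\<close> with the common missing colour would make \<open>v\<close>
  miss the colour of \<open>ut\<close>, against \<open>ut_ne_v\<close>.\<close>

lemma mc_s_ne_v:
  assumes C: "C \<phi>" and eq: "\<phi> {v, s} = \<phi> {u, t}" shows "mc \<phi> s \<noteq> mc \<phi> v"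
proof
  let ?\<psi> = "\<phi>({v, s} := mc \<phi> v)"
  assume a: "mc \<phi> s = mc \<phi> v"
  have C': "C ?\<psi>"
    using C_recolour[OF C vs refl a C_mc_uv(2)[OF C]] eq ut_colour(2)[OF C] by simp
  have "mc ?\<psi> v = \<phi> {u, t}" using recolour(3)[OF C_col[OF C] vs refl a] eq by simp
  moreover have "{u, t} \<noteq> {v, s}" using u_ne_v t_ne_v by (auto simp: doubleton_eq_iff)
  ultimately show False using ut_ne_v[OF C'] by simp
qed

text \<open>A chain at \<open>s\<close> avoiding \<open>v\<close> could be swapped to make
  \<open>s\<close> miss the same colour as \<open>v\<close>, with \<open>vs\<close> and
  \<open>ut\<close> unchanged, against \<open>mc_s_ne_v\<close>.\<close>

lemma linked_s:
  assumes Q: "Q \<phi>" shows "conn \<phi> (mc \<phi> v) (mc \<phi> s) v s"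
proof (rule ccontr)
  let ?a = "mc \<phi> v" and ?d = "mc \<phi> s"
  assume "\<not> ?thesis"
  then have nc: "\<not> conn \<phi> ?a ?d s v" using conn_sym by blast
  note C = QC[OF Q] and cc = Qc[OF Q]
  note cd = C_range[OF C vV] C_range[OF C sV] mc_s_ne_v[OF C Qs[OF Q], symmetric]
  let ?\<psi> = "swp \<phi> ?a ?d s"
  have C': "C ?\<psi>" using C_swp[OF C cd C_mc_uv(2)[OF C] s_nonfree[OF Q]] .
  have "?\<psi> {v, s} = \<phi> {v, s}" using swp_edge[OF cc cd vs] nc by simp
  moreover have "?\<psi> {u, t} = \<phi> {u, t}"
    using swp_other[OF cc cd ut] ut_ne_v[OF C] mc_s_ut[OF Q] by simp
  moreover have "mc ?\<psi> s = ?a" "mc ?\<psi> v = ?a" using swp_mc[OF cc cd] sV vV nc by simp_all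
  ultimately show False using mc_s_ne_v[OF C'] Qs[OF Q] by simp
qed

text \<open>Each of \<open>u\<close>, \<open>x\<close>, \<open>s\<close> is the far end of a chain
  from \<open>v\<close> in \<open>mc \<phi> v\<close> and its own missing colour; equal missing
  colours would give one chain two far ends.\<close>

lemma mc_s:
  assumes Q: "Q \<phi>" shows "mc \<phi> s \<noteq> mc \<phi> v" "mc \<phi> s \<noteq> mc \<phi> u" "mc \<phi> s \<noteq> mc \<phi> x"
proof -
  note C = QC[OF Q] and cc = Qc[OF Q]
  show "mc \<phi> s \<noteq> mc \<phi> v" using mc_s_ne_v[OF C Qs[OF Q]] .
  show "mc \<phi> s \<noteq> mc \<phi> u"
  proof
    assume eq: "mc \<phi> s = mc \<phi> u"
    have "s = u"
      using chain_ends[OF cc linked_s[OF Q], of u] uv_linked[OF C] eq vV sV uV s_ne_v u_ne_v by simp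
    then show False using s_ne_u[OF Q] by simp
  qed
  show "mc \<phi> s \<noteq> mc \<phi> x"
  proof
    assume eq: "mc \<phi> s = mc \<phi> x"
    have "s = x"
      using chain_ends[OF cc linked_s[OF Q], of x] linked_x[OF Q] eq vV sV xV s_ne_v x_ne_v by simp
    then show False using s_ne_x[OF Q] by simp
  qed
qed

text \<open>The chain joining \<open>v\<close> and \<open>y\<close> has both its ends, so a further
  vertex missing one of its colours lies on another chain, which can be swapped without affecting
  \<open>v\<close> and \<open>y\<close>.\<close>

lemma unlinked:
  assumes Q: "Q \<phi>" and y: "y \<in> {u, x, s}" and w: "w \<in> V" "w \<noteq> y" "w \<noteq> v"
    and mw: "mc \<phi> w = mc \<phi> y \<or> mc \<phi> w = mc \<phi> v"
  shows "\<not> conn \<phi> (mc \<phi> v) (mc \<phi> y) w v" "\<not> conn \<phi> (mc \<phi> v) (mc \<phi> y) w y"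
proof -
  have yv: "conn \<phi> (mc \<phi> v) (mc \<phi> y) v y" and yV: "y \<in> V" "y \<noteq> v"
    using y uv_linked[OF QC[OF Q]] linked_x[OF Q] linked_s[OF Q] uV xV sV u_ne_v x_ne_v s_ne_v by auto
  show 1: "\<not> conn \<phi> (mc \<phi> v) (mc \<phi> y) w v"
  proof
    assume "conn \<phi> (mc \<phi> v) (mc \<phi> y) w v"
    then show False
      using chain_ends[OF Qc[OF Q] yv conn_sym vV yV(1) w(1)] mw yV(2) w(2,3) by auto
  qed
  then show "\<not> conn \<phi> (mc \<phi> v) (mc \<phi> y) w y"
    using conn_trans conn_sym[OF yv] by blast
qed

lemma Q_swp:
  assumes Q: "Q \<phi>" and cd: "c \<in> {1..Suc D}" "d \<in> {1..Suc D}" "c \<noteq> d" "c \<noteq> \<omega>" "d \<noteq> \<omega>"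
    and v: "\<not> conn \<phi> c d q v \<or> mc \<phi> u \<noteq> c \<and> mc \<phi> u \<noteq> d \<and> \<phi> {u, t} \<noteq> c \<and> \<phi> {u, t} \<noteq> d"
    and u: "\<not> conn \<phi> c d q u \<or> mc \<phi> u \<noteq> c \<and> mc \<phi> u \<noteq> d \<and> \<phi> {u, t} \<noteq> c \<and> \<phi> {u, t} \<noteq> d"
  shows "Q (swp \<phi> c d q)" "mc (swp \<phi> c d q) u = mc \<phi> u"
proof -
  note cc = Qc[OF Q]
  have C': "C (swp \<phi> c d q)" using C_swp[OF QC[OF Q] cd] .
  have e: "swp \<phi> c d q {v, x} = \<phi> {v, x}" "swp \<phi> c d q {v, s} = \<phi> {v, s}"
    using swp_edge[OF cc cd(1-3) vx] swp_edge[OF cc cd(1-3) vs] v Qx[OF Q] Qs[OF Q] by auto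
  have ut': "swp \<phi> c d q {u, t} = \<phi> {u, t}"
    using swp_edge[OF cc cd(1-3) ut] u by auto
  show mu: "mc (swp \<phi> c d q) u = mc \<phi> u" using swp_mc[OF cc cd(1-3) uV] u by auto
  show "Q (swp \<phi> c d q)" unfolding Q_def using C' e ut' mu Qx[OF Q] Qs[OF Q] by simp
qed

text \<open>A fan at \<open>s\<close>, not a Kempe chain. Repeated leaves are allowed. Excluding
  \<open>v\<close> and the free vertices makes them the only exits, which is what the later counting
  relies on.\<close>

definition chain :: "('a set \<Rightarrow> nat) \<Rightarrow> 'a list \<Rightarrow> bool" where
  "chain \<phi> ws \<longleftrightarrow> fan \<phi> s ws \<and> ws \<noteq> [] \<and> \<phi> {s, hd ws} \<in> {mc \<phi> v, mc \<phi> u, mc \<phi> x}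
     \<and> (\<forall>w\<in>set ws. mc \<phi> w \<noteq> \<omega> \<and> w \<noteq> v)"

lemma chain_take: "chain \<phi> ws \<Longrightarrow> 0 < n \<Longrightarrow> chain \<phi> (take n ws)"
  unfolding chain_def using fan_take[of \<phi> s ws n] by (auto dest: in_set_takeD)

lemma chain_edge: "chain \<phi> ws \<Longrightarrow> w \<in> set ws \<Longrightarrow> {s, w} \<in> E"
  unfolding chain_def fan_def by blast

lemma chain_colour:
  assumes Q: "Q \<phi>" and ch: "chain \<phi> ws" and w: "w \<in> set ws"
  shows "\<phi> {s, w} \<noteq> \<omega>"
proof -
  obtain i where i: "i < length ws" "ws ! i = w" using w by (metis in_set_conv_nth)
  show ?thesis
  proof (cases i)
    case 0
    then have "hd ws = w" using i by (cases ws) auto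
    then show ?thesis using ch C_mc_uv[OF QC[OF Q]] x_nonfree[OF Q] unfolding chain_def by auto
  next
    case (Suc j)
    then have "\<phi> {s, w} = mc \<phi> (ws ! j)" using ch i unfolding chain_def fan_def by blast
    moreover have "ws ! j \<in> set ws" using i Suc by simp
    ultimately show ?thesis using ch unfolding chain_def by simp
  qed
qed

text \<open>The missing colour at the last leaf is left open: no later edge depends on it, and being
  free depends only on the class of \<open>\<omega>\<close>. So a swap may change that
  colour.\<close>

lemma chain_cong:
  assumes ch: "chain \<phi> ws" and Q: "Q \<phi>" "Q \<psi>"
    and st: "\<psi> {s, hd ws} \<in> {mc \<psi> v, mc \<psi> u, mc \<psi> x}"
    and len: "\<And>i. Suc i < length ws \<Longrightarrow> \<psi> {s, ws ! Suc i} = mc \<phi> (ws ! i)"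
    and mcs: "\<And>i. Suc i < length ws \<Longrightarrow> mc \<psi> (ws ! i) = mc \<phi> (ws ! i)"
  shows "chain \<psi> ws"
proof -
  have "mc \<psi> w \<noteq> \<omega>" if "w \<in> set ws" for w
  proof -
    have "w \<in> V" using chain_edge[OF ch that] edgeD by blast
    then have "mc \<phi> w = \<omega> \<longleftrightarrow> mc \<psi> w = \<omega>"
      using C_free[OF QC[OF Q(1)], of w] C_free[OF QC[OF Q(2)], of w] by simp
    then show ?thesis using ch that unfolding chain_def by simp
  qed
  then show ?thesis using ch st len mcs unfolding chain_def fan_def by simp
qed

text \<open>Induction on the length for all colourings in \<open>Q\<close> at once. Swaps at the
  last leaf turn a colour missing at \<open>u\<close> or \<open>x\<close> into the one missing at
  \<open>v\<close>, and that into the one missing at \<open>s\<close>; then the last edge can be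
  recoloured and dropped.\<close>

lemma chain_end:
  assumes "Q \<phi>" "chain \<phi> ws"
  shows "mc \<phi> (last ws) \<notin> {mc \<phi> v, mc \<phi> u, mc \<phi> x, mc \<phi> s}"
  using assms
proof (induction ws arbitrary: \<phi> rule: measure_induct_rule[of length])
  case (less ws)
  let ?w = "last ws"
  have inner: "mc \<psi> (ws ! i) \<notin> {mc \<psi> v, mc \<psi> u, mc \<psi> x, mc \<psi> s}"
    if "Q \<psi>" "chain \<psi> ws" "Suc i < length ws" for \<psi> i
  proof -
    have "last (take (Suc i) ws) = ws ! i" using that(3) by (simp add: take_Suc_conv_app_nth)
    then show ?thesis
      using less.IH[OF _ that(1) chain_take[OF that(2), of "Suc i"]] that(3) by simp
  qed
  have wE: "{s, ?w} \<in> E" and wne: "?w \<noteq> v" "mc \<psi> ?w \<noteq> \<omega>" if "chain \<psi> ws" for \<psi>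
    using that last_in_set[of ws] unfolding chain_def fan_def by auto
  have succ: "\<psi> {s, ws ! Suc i} = mc \<psi> (ws ! i)" if "chain \<psi> ws" "Suc i < length ws" for \<psi> i
    using that unfolding chain_def fan_def by blast
  have nthE: "{s, ws ! i} \<in> E" "ws ! i \<in> V" if "chain \<psi> ws" "i < length ws" for \<psi> i
    using chain_edge[OF that(1) nth_mem[OF that(2)]] edgeD by blast+
  \<comment> \<open>After recolouring the last edge, \<open>s\<close> misses its old colour, which
    the leaf before misses as well, against the induction hypothesis; a chain of length one
    contradicts \<open>mc_s\<close> instead.\<close>
  have H1: False if Q: "Q \<psi>" and ch: "chain \<psi> ws" and eq: "mc \<psi> ?w = mc \<psi> s" for \<psi>
  proof -
    let ?\<xi> = "\<psi>({s, ?w} := mc \<psi> s)"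
    note wE1 = wE[OF ch] and w = nbr_of_s[OF wE[OF ch]]
    have ne: "ws \<noteq> []" using ch unfolding chain_def by simp
    note r = recolour[OF Qc[OF Q] wE1 refl eq]
    have C': "C ?\<xi>"
      using C_recolour[OF QC[OF Q] wE1 refl eq s_nonfree[OF Q]] chain_colour[OF Q ch last_in_set[OF ne]] by blast
    have mcs: "mc ?\<xi> u = mc \<psi> u" "mc ?\<xi> x = mc \<psi> x" "mc ?\<xi> v = mc \<psi> v"
      using r(5) w s_ne_u[OF Q] s_ne_x[OF Q] s_ne_v wne(1)[OF ch] by metis+
    have "{v, x} \<noteq> {s, ?w}" "{v, s} \<noteq> {s, ?w}" "{u, t} \<noteq> {s, ?w}"
      using w s_ne_v s_ne_u[OF Q] wne(1)[OF ch] by (auto simp: doubleton_eq_iff)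
    then have Q': "Q ?\<xi>" unfolding Q_def using C' mcs Qx[OF Q] Qs[OF Q] by simp
    show False
    proof (cases "length ws = 1")
      case True
      then have "hd ws = ?w" by (cases ws) auto
      then have "mc ?\<xi> s \<in> {mc ?\<xi> v, mc ?\<xi> u, mc ?\<xi> x}"
        using ch r(3) mcs unfolding chain_def by simp
      then show False using mc_s[OF Q'] by blast
    next
      case False
      define n where "n = length ws - 1"
      have n: "0 < n" "n < length ws" "Suc (n - 1) = n" using False ne unfolding n_def by (cases ws; auto)+
      have wn: "?w = ws ! n" using ne unfolding n_def by (simp add: last_conv_nth)
      have in_ne: "ws ! i \<noteq> ?w" if "i < n" for i
        using inner[OF Q ch, of i] that n eq by auto
      have mcn: "mc ?\<xi> (ws ! i) = mc \<psi> (ws ! i)" if "i < n" for i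
        using r(5)[of "ws ! i"] in_ne[OF that] nthE(1)[OF ch, of i] that n edgeD by fastforce
      have en: "?\<xi> {s, ws ! i} = \<psi> {s, ws ! i}" if "i < n" for i
        using in_ne[OF that] by (auto simp: doubleton_eq_iff)
      have short: "length (take n ws) < length ws" using n by simp
      have ch': "chain ?\<xi> (take n ws)"
      proof (rule chain_cong[OF chain_take[OF ch n(1)] Q Q'])
        show "?\<xi> {s, hd (take n ws)} \<in> {mc ?\<xi> v, mc ?\<xi> u, mc ?\<xi> x}"
          using ch en[OF n(1)] n ne mcs unfolding chain_def by (simp add: hd_conv_nth)
        show "?\<xi> {s, take n ws ! Suc i} = mc \<psi> (take n ws ! i)" if "Suc i < length (take n ws)" for i
          using that en[of "Suc i"] succ[OF ch, of i] by simp
        show "mc ?\<xi> (take n ws ! i) = mc \<psi> (take n ws ! i)" if "Suc i < length (take n ws)" for i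
          using that mcn[of i] by simp
      qed
      have "mc ?\<xi> (last (take n ws)) \<noteq> mc ?\<xi> s"
        using less.IH[OF short Q' ch'] by blast
      moreover have "last (take n ws) = ws ! (n - 1)" using n ne by (simp add: last_conv_nth)
      moreover have "mc ?\<xi> s = mc \<psi> (ws ! (n - 1))" using r(3) succ[OF ch, of "n - 1"] n wn by simp
      ultimately show False using mcn[of "n - 1"] n by simp
    qed
  qed
  have H2: False if Q: "Q \<psi>" and ch: "chain \<psi> ws" and eq: "mc \<psi> ?w = mc \<psi> v" for \<psi>
  proof -
    let ?\<xi> = "swp \<psi> (mc \<psi> v) (mc \<psi> s) ?w"
    note cc = Qc[OF Q] and w = nbr_of_s[OF wE[OF ch]]
    note cd = C_range[OF QC[OF Q] vV] C_range[OF QC[OF Q] sV] mc_s(1)[OF Q, symmetric]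
    have nc: "\<not> conn \<psi> (mc \<psi> v) (mc \<psi> s) ?w v" "\<not> conn \<psi> (mc \<psi> v) (mc \<psi> s) ?w s"
      using unlinked[OF Q, of s ?w] w wne(1)[OF ch] eq by auto
    have Q': "Q ?\<xi>" and mu: "mc ?\<xi> u = mc \<psi> u"
      using Q_swp[OF Q cd C_mc_uv(2)[OF QC[OF Q]] s_nonfree[OF Q], of ?w] nc
        mc_uv_ne[OF QC[OF Q]] mc_s(2)[OF Q] ut_ne_v[OF QC[OF Q]] mc_s_ut[OF Q] by auto
    have m: "mc ?\<xi> v = mc \<psi> v" "mc ?\<xi> s = mc \<psi> s" "mc ?\<xi> x = mc \<psi> x" "mc ?\<xi> ?w = mc \<psi> s"
      using swp_mc[OF cc cd] vV sV xV w nc mc_x(2)[OF Q] mc_s(3)[OF Q] eq by auto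
    have e: "?\<xi> {s, z} = \<psi> {s, z}" if "{s, z} \<in> E" for z using swp_edge[OF cc cd that] nc by simp
    have "chain ?\<xi> ws"
    proof (rule chain_cong[OF ch Q Q'])
      show "?\<xi> {s, hd ws} \<in> {mc ?\<xi> v, mc ?\<xi> u, mc ?\<xi> x}"
        using ch e[OF chain_edge[OF ch hd_in_set]] m mu unfolding chain_def by auto
      show "?\<xi> {s, ws ! Suc i} = mc \<psi> (ws ! i)" if "Suc i < length ws" for i
        using e[OF nthE(1)[OF ch that]] succ[OF ch that] by simp
      show "mc ?\<xi> (ws ! i) = mc \<psi> (ws ! i)" if "Suc i < length ws" for i
        using swp_mc[OF cc cd nthE(2)[OF ch, of i], of ?w] inner[OF Q ch that] that by auto
    qed
    then show False using H1[OF Q'] m by simp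
  qed
  have H3: False if Q: "Q \<psi>" and ch: "chain \<psi> ws" and y: "y \<in> {u, x}" and eq: "mc \<psi> ?w = mc \<psi> y" for \<psi> y
  proof -
    let ?d = "mc \<psi> y"
    let ?\<xi> = "swp \<psi> (mc \<psi> v) ?d ?w"
    note C = QC[OF Q] and cc = Qc[OF Q] and w = nbr_of_s[OF wE[OF ch]]
    have yV: "y \<in> V" "?w \<noteq> y" "?d \<noteq> mc \<psi> v" "?d \<noteq> \<omega>" "?d \<noteq> mc \<psi> s"
      using y uV xV w mc_uv_ne[OF C] mc_x(2)[OF Q] C_mc_uv(1)[OF C] x_nonfree[OF Q] mc_s(2,3)[OF Q] by auto
    note cd = C_range[OF C vV] C_range[OF C yV(1)] yV(3)[symmetric]
    have nc: "\<not> conn \<psi> (mc \<psi> v) ?d ?w v" "\<not> conn \<psi> (mc \<psi> v) ?d ?w y"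
      using unlinked[OF Q, of y ?w] y w yV(2) wne(1)[OF ch] eq by auto
    \<comment> \<open>For \<open>y = x\<close> the chain of the last leaf may pass through
      \<open>u\<close>. It could recolour \<open>ut\<close> only if \<open>ut\<close> had the colour
      missing at \<open>x\<close>, but then \<open>ut_linked\<close> puts \<open>u\<close> on the
      chain of \<open>v\<close>.\<close>
    have ncu: "\<not> conn \<psi> (mc \<psi> v) ?d ?w u \<or> mc \<psi> u \<noteq> mc \<psi> v \<and> mc \<psi> u \<noteq> ?d \<and> \<phi>' {u, t} \<noteq> mc \<psi> v \<and> \<psi> {u, t} \<noteq> ?d"
      if "\<phi>' {u, t} \<noteq> mc \<psi> v" for \<phi>'
    proof (cases "y = u")
      case True
      then show ?thesis using nc by simp
    next
      case False
      then have yx: "y = x" using y by simp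
      show ?thesis
      proof (cases "\<psi> {u, t} = ?d")
        case True
        then have "conn \<psi> (mc \<psi> v) ?d v u" using ut_linked[OF C] by simp
        then show ?thesis using nc(1) conn_trans conn_sym by blast
      next
        case False
        then show ?thesis using mc_uv_ne[OF C] mc_x(1)[OF Q] yx that by auto
      qed
    qed
    have Q': "Q ?\<xi>" and mu: "mc ?\<xi> u = mc \<psi> u"
      using Q_swp[OF Q cd C_mc_uv(2)[OF C] yV(4), of ?w] nc ncu[of \<psi>] ut_ne_v[OF C] by auto
    have mx: "mc ?\<xi> x = mc \<psi> x"
      using swp_mc[OF cc cd xV, of ?w] y nc mc_x[OF Q] by (cases "y = x") auto
    have m: "mc ?\<xi> v = mc \<psi> v" "mc ?\<xi> s = mc \<psi> s" "mc ?\<xi> ?w = mc \<psi> v"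
      using swp_mc[OF cc cd] vV sV w nc mc_s(1)[OF Q] yV(5) eq by auto
    have "chain ?\<xi> ws"
    proof (rule chain_cong[OF ch Q Q'])
      have h: "{s, hd ws} \<in> E" "\<psi> {s, hd ws} \<in> {mc \<psi> v, mc \<psi> u, mc \<psi> x}"
        using chain_edge[OF ch hd_in_set] ch unfolding chain_def by auto
      \<comment> \<open>This swap may recolour edges at \<open>s\<close>, but the first edge only
        moves between two colours that both may start a chain, and later edges carry neither of
        them.\<close>
      show "?\<xi> {s, hd ws} \<in> {mc ?\<xi> v, mc ?\<xi> u, mc ?\<xi> x}"
      proof (cases "\<psi> {s, hd ws} = mc \<psi> v \<or> \<psi> {s, hd ws} = ?d")
        case True
        then have "?\<xi> {s, hd ws} \<in> {mc \<psi> v, ?d}" using swp_edge[OF cc cd h(1), of ?w] by auto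
        then show ?thesis using y m mu mx by auto
      next
        case False
        then show ?thesis using swp_other[OF cc cd h(1)] h(2) m mu mx by auto
      qed
      fix i assume i: "Suc i < length ws"
      have io: "mc \<psi> (ws ! i) \<noteq> mc \<psi> v" "mc \<psi> (ws ! i) \<noteq> ?d" using inner[OF Q ch i] y by auto
      show "?\<xi> {s, ws ! Suc i} = mc \<psi> (ws ! i)"
        using swp_other[OF cc cd nthE(1)[OF ch i]] succ[OF ch i] io by simp
      show "mc ?\<xi> (ws ! i) = mc \<psi> (ws ! i)"
        using swp_mc[OF cc cd nthE(2)[OF ch, of i], of ?w] i io by simp
    qed
    then show False using H2[OF Q'] m by simp
  qed
  show ?case
    using H1[OF less.prems] H2[OF less.prems] H3[OF less.prems, of u] H3[OF less.prems, of x] by blast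
qed

lemma chain_inner:
  assumes "Q \<phi>" "chain \<phi> ws" "i < length ws"
  shows "mc \<phi> (ws ! i) \<notin> {mc \<phi> v, mc \<phi> u, mc \<phi> x, mc \<phi> s}"
  using chain_end[OF assms(1) chain_take[OF assms(2), of "Suc i"]] assms(3)
  by (simp add: take_Suc_conv_app_nth)

definition reached :: "('a set \<Rightarrow> nat) \<Rightarrow> 'a set" where
  "reached \<phi> = {last ws | ws. chain \<phi> ws}"

lemma reached_adj:
  assumes "w \<in> reached \<phi>" shows "{s, w} \<in> E" "w \<noteq> v" "mc \<phi> w \<noteq> \<omega>"
proof -
  obtain ws where "chain \<phi> ws" "w = last ws" using assms unfolding reached_def by blast
  then show "{s, w} \<in> E" "w \<noteq> v" "mc \<phi> w \<noteq> \<omega>"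
    using last_in_set[of ws] unfolding chain_def fan_def by auto
qed

lemma reached_mc:
  assumes "Q \<phi>" "w \<in> reached \<phi>" shows "mc \<phi> w \<notin> {mc \<phi> v, mc \<phi> u, mc \<phi> x, mc \<phi> s}"
  using chain_end[OF assms(1)] assms(2) unfolding reached_def by blast

text \<open>The chain from \<open>v\<close> contains \<open>u\<close> by \<open>ut_linked\<close>
  and \<open>s\<close> through the edge \<open>vs\<close>. If \<open>w\<close> were off it, a swap
  at \<open>w\<close> would keep the fan at \<open>s\<close> and make \<open>w\<close> miss the same
  colour as \<open>v\<close>, against \<open>chain_end\<close>.\<close>

lemma reached_ut_linked:
  assumes Q: "Q \<phi>" and w: "w \<in> reached \<phi>" and eq: "mc \<phi> w = \<phi> {u, t}"
  shows "conn \<phi> (mc \<phi> v) (\<phi> {u, t}) v w"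
proof (rule ccontr)
  let ?a = "mc \<phi> v" and ?b = "\<phi> {u, t}"
  let ?\<psi> = "swp \<phi> ?a ?b w"
  note C = QC[OF Q] and cc = Qc[OF Q]
  assume "\<not> ?thesis"
  then have nv: "\<not> conn \<phi> ?a ?b w v" using conn_sym by blast
  have nu: "\<not> conn \<phi> ?a ?b w u" using nv ut_linked[OF C] conn_trans conn_sym by blast
  have ns: "\<not> conn \<phi> ?a ?b w s" using nv conn_edge[OF sv, of \<phi>] Qs'[OF Q] conn_trans by blast
  note cd = C_range[OF C vV] ut_colour(1)[OF C] ut_ne_v[OF C, symmetric]
  obtain ws where ws: "chain \<phi> ws" "w = last ws" using w unfolding reached_def by blast
  have wsE: "{s, ws ! i} \<in> E" "ws ! i \<in> V" if "i < length ws" for i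
    using chain_edge[OF ws(1) nth_mem[OF that]] edgeD by blast+
  have ne: "ws \<noteq> []" using ws(1) unfolding chain_def by blast
  have Q': "Q ?\<psi>" and mu: "mc ?\<psi> u = mc \<phi> u"
    using Q_swp[OF Q cd C_mc_uv(2)[OF C] ut_colour(2)[OF C], of w] nu nv by simp_all
  have mv: "mc ?\<psi> v = ?a" using swp_mc[OF cc cd vV] nv by simp
  have mx: "mc ?\<psi> x = mc \<phi> x"
  proof (cases "mc \<phi> x = ?b")
    case True
    then have "conn \<phi> ?a ?b v x" using linked_x[OF Q] by simp
    then have "\<not> conn \<phi> ?a ?b w x" using nv conn_trans conn_sym by blast
    then show ?thesis using swp_mc[OF cc cd xV] by simp
  next
    case False
    then show ?thesis using swp_mc[OF cc cd xV] mc_x(2)[OF Q] by simp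
  qed
  have e: "?\<psi> {s, z} = \<phi> {s, z}" if "{s, z} \<in> E" for z using swp_edge[OF cc cd that] ns by simp
  have "chain ?\<psi> ws"
  proof (rule chain_cong[OF ws(1) Q Q'])
    show "?\<psi> {s, hd ws} \<in> {mc ?\<psi> v, mc ?\<psi> u, mc ?\<psi> x}"
      using ws(1) e[OF chain_edge[OF ws(1) hd_in_set[OF ne]]] mv mu mx unfolding chain_def by simp
    fix i assume i: "Suc i < length ws"
    have su: "\<phi> {s, ws ! Suc i} = mc \<phi> (ws ! i)" using ws(1) i unfolding chain_def fan_def by blast
    then show "?\<psi> {s, ws ! Suc i} = mc \<phi> (ws ! i)" using e[OF wsE(1)[OF i]] by simp
    \<comment> \<open>At \<open>s\<close> the colour of \<open>ut\<close> leads to \<open>v\<close>,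
      which is never a leaf; so no leaf before the last misses this colour.\<close>
    have "ws ! Suc i \<noteq> v" using ws(1) nth_mem[OF i] unfolding chain_def by blast
    then have "mc \<phi> (ws ! i) \<noteq> ?b" using su nbr_unique[OF cc wsE(1)[OF i] sv] Qs'[OF Q] by auto
    then show "mc ?\<psi> (ws ! i) = mc \<phi> (ws ! i)"
      using swp_mc[OF cc cd wsE(2)[of i]] chain_inner[OF Q ws(1), of i] i by simp
  qed
  then have "mc ?\<psi> w \<noteq> mc ?\<psi> v" using chain_end[OF Q'] ws(2) by blast
  moreover have "mc ?\<psi> w = ?a"
    using swp_mc[OF cc cd, of w w] reached_adj(1)[OF w] edgeD eq by auto
  ultimately show False using mv by simp
qed

text \<open>Otherwise swap at the end of a shortest offending fan: by minimality, earlier leaves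
  missing the same colour are linked to \<open>s\<close> and stay as they are, while the end now
  misses \<open>mc \<phi> s\<close>, against \<open>chain_end\<close>. For the colour of
  \<open>ut\<close> the swap could destroy \<open>Q\<close>.\<close>

lemma chain_linked:
  assumes Q: "Q \<phi>" and ch: "chain \<phi> ws" and ne: "mc \<phi> (last ws) \<noteq> \<phi> {u, t}"
  shows "conn \<phi> (mc \<phi> (last ws)) (mc \<phi> s) s (last ws)"
proof (rule ccontr)
  assume neg: "\<not> ?thesis"
  let ?d = "mc \<phi> (last ws)" and ?h = "mc \<phi> s"
  note C = QC[OF Q] and cc = Qc[OF Q]
  define P where "P ys \<longleftrightarrow> chain \<phi> ys \<and> mc \<phi> (last ys) = ?d \<and> \<not> conn \<phi> ?d ?h s (last ys)" for ys
  have "P ws" unfolding P_def using ch neg by blast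
  then obtain ys where ys: "P ys" and least: "\<And>zs. P zs \<Longrightarrow> length ys \<le> length zs"
    using ex_has_least_nat[of P ws length] by blast
  let ?z = "last ys"
  let ?\<psi> = "swp \<phi> ?d ?h ?z"
  have chy: "chain \<phi> ys" and mz: "mc \<phi> ?z = ?d" and ns: "\<not> conn \<phi> ?d ?h ?z s"
    using ys conn_sym unfolding P_def by blast+
  have ysE: "{s, ys ! i} \<in> E" "ys ! i \<in> V" if "i < length ys" for i
    using chain_edge[OF chy nth_mem[OF that]] edgeD by blast+
  have yne: "ys \<noteq> []" using chy unfolding chain_def by blast
  have zV: "?z \<in> V" using chain_edge[OF chy last_in_set[OF yne]] edgeD by blast
  have out: "?d \<notin> {mc \<phi> v, mc \<phi> u, mc \<phi> x, ?h}" using chain_end[OF Q chy] mz by simp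
  have d\<omega>: "?d \<noteq> \<omega>" using chy mz last_in_set[OF yne] unfolding chain_def by auto
  have dr: "?d \<in> {1..Suc D}" using C_range[OF C zV] mz by simp
  have dh: "?d \<noteq> ?h" using out by simp
  note cd = dr C_range[OF C sV] dh
  have Q': "Q ?\<psi>" and mu: "mc ?\<psi> u = mc \<phi> u"
    using Q_swp[OF Q cd d\<omega> s_nonfree[OF Q], of ?z] out mc_s(2)[OF Q] ne mc_s_ut[OF Q] by auto
  have mv: "mc ?\<psi> v = mc \<phi> v" and mx: "mc ?\<psi> x = mc \<phi> x" and ms: "mc ?\<psi> s = ?h"
    using swp_mc[OF cc cd] vV xV sV out ns mc_s[OF Q] by auto
  have e: "?\<psi> {s, w} = \<phi> {s, w}" if "{s, w} \<in> E" for w using swp_edge[OF cc cd that] ns by simp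
  have "chain ?\<psi> ys"
  proof (rule chain_cong[OF chy Q Q'])
    show "?\<psi> {s, hd ys} \<in> {mc ?\<psi> v, mc ?\<psi> u, mc ?\<psi> x}"
      using chy e[OF chain_edge[OF chy hd_in_set[OF yne]]] mv mu mx unfolding chain_def by simp
    fix i assume i: "Suc i < length ys"
    have su: "\<phi> {s, ys ! Suc i} = mc \<phi> (ys ! i)" using chy i unfolding chain_def fan_def by blast
    then show "?\<psi> {s, ys ! Suc i} = mc \<phi> (ys ! i)" using e[OF ysE(1)[OF i]] by simp
    have "\<not> conn \<phi> ?d ?h ?z (ys ! i)" if eq: "mc \<phi> (ys ! i) = ?d"
    proof
      assume "conn \<phi> ?d ?h ?z (ys ! i)"
      then have "\<not> conn \<phi> ?d ?h s (ys ! i)" using ns conn_trans conn_sym by blast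
      moreover have "last (take (Suc i) ys) = ys ! i" using i by (simp add: take_Suc_conv_app_nth)
      ultimately have "P (take (Suc i) ys)" unfolding P_def using chain_take[OF chy, of "Suc i"] eq by simp
      then show False using least[of "take (Suc i) ys"] i by simp
    qed
    then show "mc ?\<psi> (ys ! i) = mc \<phi> (ys ! i)"
      using swp_mc[OF cc cd ysE(2)[of i], of ?z] chain_inner[OF Q chy, of i] i
      by (cases "mc \<phi> (ys ! i) = ?d") auto
  qed
  then have "mc ?\<psi> ?z \<noteq> mc ?\<psi> s" using chain_end[OF Q'] by blast
  moreover have "mc ?\<psi> ?z = ?h" using swp_mc[OF cc cd zV, of ?z] mz by simp
  ultimately show False using ms by simp
qed

text \<open>Two reached vertices missing the same colour would be far ends of one Kempe chain, from
  \<open>v\<close> if the colour is that of \<open>ut\<close> and from \<open>s\<close>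
  otherwise.\<close>

lemma reached_inj:
  assumes Q: "Q \<phi>" and w: "w \<in> reached \<phi>" "w' \<in> reached \<phi>" and eq: "mc \<phi> w = mc \<phi> w'"
  shows "w = w'"
proof -
  note cc = Qc[OF Q]
  have V: "w \<in> V" "w' \<in> V" "w \<noteq> s" "w' \<noteq> s" "w \<noteq> v" "w' \<noteq> v"
    using reached_adj[OF w(1)] reached_adj[OF w(2)] edgeD by blast+
  show ?thesis
  proof (cases "mc \<phi> w = \<phi> {u, t}")
    case True
    then show ?thesis
      using chain_ends[OF cc reached_ut_linked[OF Q w(1)] reached_ut_linked[OF Q w(2)] vV V(1,2)] V(5,6) eq
      by simp
  next
    case False
    obtain ws ws' where "chain \<phi> ws" "w = last ws" "chain \<phi> ws'" "w' = last ws'"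
      using w unfolding reached_def by blast
    then have "conn \<phi> (mc \<phi> w) (mc \<phi> s) s w" "conn \<phi> (mc \<phi> w') (mc \<phi> s) s w'"
      using chain_linked[OF Q, of ws] chain_linked[OF Q, of ws'] False eq by simp_all
    then show ?thesis using chain_ends[OF cc _ _ sV V(1,2)] V(3,4) eq by simp
  qed
qed


text \<open>The colours that start or continue a chain at \<open>s\<close> are pairwise distinct, and each
  leads to a reached vertex, to \<open>v\<close>, or to a vertex missing \<open>\<omega>\<close>.\<close>

lemma two_free:
  assumes Q: "Q \<phi>"
  shows "2 \<le> card {f. {s, f} \<in> E \<and> mc \<phi> f = \<omega>}"
proof -
  note C = QC[OF Q] and cc = Qc[OF Q]
  define S where "S = {mc \<phi> v, mc \<phi> u, mc \<phi> x}"
  define R where "R = reached \<phi>"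
  define F where "F = {f. {s, f} \<in> E \<and> mc \<phi> f = \<omega>}"
  define P where "P = S \<union> mc \<phi> ` R"
  have R_adj: "{s, w} \<in> E" "mc \<phi> w \<notin> S" "mc \<phi> w \<noteq> mc \<phi> s" "w \<in> V" if "w \<in> R" for w
    using that reached_adj(1)[of w \<phi>] reached_mc[OF Q, of w] edgeD[of s w] unfolding R_def S_def by simp_all
  have RV: "R \<subseteq> V" using R_adj(4) by blast
  have FV: "F \<subseteq> V" unfolding F_def using edgeD[of s] by auto
  have finR: "finite R" and finF: "finite F"
    using finite_subset[OF RV finV] finite_subset[OF FV finV] .
  have cS: "card S = 3" and finS: "finite S"
    unfolding S_def using mc_uv_ne[OF C, symmetric] mc_x[OF Q, symmetric] by simp_all
  have inj: "inj_on (mc \<phi>) R"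
    by (rule inj_onI) (use reached_inj[OF Q] R_def in simp)
  have disj: "S \<inter> mc \<phi> ` R = {}" using R_adj(2) by blast
  have cP: "card P = 3 + card R"
    unfolding P_def using card_Un_disjoint[OF finS finite_imageI[OF finR] disj] card_image[OF inj] cS by simp
  have P_cases: "p \<in> S \<or> (\<exists>w\<in>R. p = mc \<phi> w)" if "p \<in> P" for p
    using that unfolding P_def by blast
  have S_mc: "\<exists>z\<in>V. p = mc \<phi> z" and S_s: "p \<noteq> mc \<phi> s" if "p \<in> S" for p
    using that vV uV xV mc_s[OF Q] unfolding S_def by auto
  have "\<exists>y. {s, y} \<in> E \<and> \<phi> {s, y} = p" if "p \<in> P" for p
  proof -
    have "\<exists>z\<in>V. p = mc \<phi> z" using P_cases[OF that] S_mc[of p] R_adj(4) by auto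
    then have pr: "p \<in> {1..Suc D}" using C_range[OF C] by auto
    have "p \<noteq> mc \<phi> s"
      using P_cases[OF that]
    proof
      assume "\<exists>w\<in>R. p = mc \<phi> w"
      then obtain w where "w \<in> R" "p = mc \<phi> w" by blast
      then show ?thesis using R_adj(3)[of w] by simp
    qed (rule S_s)
    then show ?thesis by (rule nbr_ex[OF cc sV pr]) blast
  qed
  then have nb_ex: "\<exists>y. {s, y} \<in> E \<and> \<phi> {s, y} = p" if "p \<in> P" for p using that .
  define nb where "nb p = (SOME y. {s, y} \<in> E \<and> \<phi> {s, y} = p)" for p
  have nb: "{s, nb p} \<in> E \<and> \<phi> {s, nb p} = p" if "p \<in> P" for p
    unfolding nb_def by (rule someI_ex[OF nb_ex[OF that]])
  have inj_nb: "inj_on nb P"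
  proof (rule inj_onI)
    fix p q assume p: "p \<in> P" and q: "q \<in> P" and eq: "nb p = nb q"
    have "p = \<phi> {s, nb p}" using conjunct2[OF nb[OF p], symmetric] .
    also have "\<dots> = \<phi> {s, nb q}" unfolding eq ..
    also have "\<dots> = q" using conjunct2[OF nb[OF q]] .
    finally show "p = q" .
  qed
  have sub: "nb p \<in> insert v (R \<union> F)" if pP: "p \<in> P" for p
  proof (cases "nb p = v \<or> mc \<phi> (nb p) = \<omega>")
    case True
    then show ?thesis using nb[OF pP] unfolding F_def by auto
  next
    case False
    note y = nb[OF pP]
    have "\<exists>ws. chain \<phi> ws \<and> last ws = nb p"
    proof (cases "p \<in> S")
      case True
      then have "chain \<phi> [nb p]" using y False unfolding chain_def fan_def S_def by simp
      then show ?thesis by (intro exI[of _ "[nb p]"]) simp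
    next
      case nS: False
      then obtain w where "w \<in> R" "p = mc \<phi> w" using P_cases[OF pP] by blast
      then obtain ws where ws: "chain \<phi> ws" "p = mc \<phi> (last ws)"
        unfolding R_def reached_def by blast
      then have "chain \<phi> (ws @ [nb p])"
        using y False unfolding chain_def by (simp add: fan_snoc)
      then show ?thesis by (intro exI[of _ "ws @ [nb p]"]) simp
    qed
    then obtain ws where ws: "chain \<phi> ws" "last ws = nb p" by blast
    have "last ws \<in> R" unfolding R_def reached_def using ws(1) by blast
    then show ?thesis unfolding ws(2) by simp
  qed
  \<comment> \<open>The \<open>3 + card R\<close> colours lead injectively into \<open>R\<close>,
    \<open>F\<close> and the single vertex \<open>v\<close>, which leaves at least two for
    \<open>F\<close>.\<close>
  have "card P = card (nb ` P)" using card_image[OF inj_nb] by simp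
  also have "\<dots> \<le> card (insert v (R \<union> F))"
    by (rule card_mono) (use finR finF sub in auto)
  also have "\<dots> \<le> card R + card F + 1"
    using card_Un_le[of R F] card_insert_le_m1[of "card R + card F + 1" "R \<union> F" v] by simp
  finally show ?thesis using cP unfolding F_def by simp
qed

end

section \<open>Contradictions from the impossible exchange\<close>

context unexchangeable
begin

lemma two_free_contradiction:
  assumes ty: "{t, y} \<in> E" and only: "\<And>z. z \<in> V \<Longrightarrow> mc \<phi>0 z = \<omega> \<Longrightarrow> z = t \<or> z = y"
  shows False
proof -
  \<comment> \<open>\<open>x\<close> and \<open>s\<close> exist because \<open>v\<close> misses
    neither the colour missing at \<open>u\<close> nor the colour of \<open>ut\<close>.\<close>
  obtain x where x: "{v, x} \<in> E" "\<phi>0 {v, x} = mc \<phi>0 u"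
    using nbr_ex[OF col0 vV C_range[OF C0 uV] mc_uv_ne[OF C0]] by blast
  obtain s where s: "{v, s} \<in> E" "\<phi>0 {v, s} = \<phi>0 {u, t}"
    using nbr_ex[OF col0 vV ut_colour(1)[OF C0] ut_ne_v[OF C0]] by blast
  interpret fan_centre V E D \<phi>0 \<omega> u v t x s by unfold_locales (use x s in blast)+
  let ?F = "{f. {s, f} \<in> E \<and> mc \<phi>0 f = \<omega>}"
  have "Q \<phi>0" unfolding Q_def using C0 x s by blast
  then have "2 \<le> card ?F" by (rule two_free)
  moreover have "?F \<subseteq> {t, y}" using only edgeD by blast
  moreover have "t \<notin> ?F \<or> y \<notin> ?F" using no_triangle[of s t y] ty by blast
  ultimately have "2 \<le> card ?F" "?F \<subseteq> {t} \<or> ?F \<subseteq> {y}" by blast+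
  then show False using card_mono[of "{t}" ?F] card_mono[of "{y}" ?F] by auto
qed

text \<open>\<open>\<psi>\<close> arises from a colouring with the class of \<open>\<phi>0\<close> by swapping \<open>K\<close> (up to edges not
  coloured \<open>\<omega>\<close>) so that \<open>y\<close> and \<open>v\<close> missing the same colour \<open>a\<close>. Shifting the fan at \<open>v\<close> that ends at
  \<open>y\<close> and swapping back \<open>K\<close> together with \<open>vy\<close> replaces \<open>uv\<close> by \<open>vy\<close> in the class.\<close>

lemma swap_back:
  assumes col: "col \<psi>" and eqv: "eqv \<phi>0 \<psi>" and a: "a = mc \<psi> v" "a \<noteq> \<omega>"
    and fan: "fan \<psi> v xs" "distinct xs" "xs \<noteq> []" "hd xs = u" "last xs = y"
    and y: "mc \<psi> y = a" "y \<noteq> u"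
    and xs: "\<And>x. x \<in> set xs \<Longrightarrow> x \<noteq> y \<Longrightarrow> mc \<psi> x \<noteq> \<omega> \<and> mc \<psi> x \<noteq> a"
    and uv\<psi>: "\<psi> {v, u} = \<omega>"
    and K: "swap_closed E \<psi> \<omega> a K" "\<And>e. e \<in> K \<Longrightarrow> v \<notin> e"
    and yK: "\<And>w. {y, w} \<in> E \<Longrightarrow> \<psi> {y, w} = \<omega> \<or> \<psi> {y, w} = a \<Longrightarrow> {y, w} \<in> K"
    and cls: "\<And>e. e \<in> E \<Longrightarrow> kempe_swap \<omega> a K \<psi> e = \<omega> \<longleftrightarrow> \<phi>0 e = \<omega>"
  shows False
proof -
  let ?\<chi> = "shift \<psi> v xs" and ?K = "insert {v, y} K"
  let ?\<xi> = "kempe_swap \<omega> a ?K ?\<chi>"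
  have yxs: "y \<in> set xs" and uxs: "u \<in> set xs" using fan by auto
  have xsE: "{v, x} \<in> E" if "x \<in> set xs" for x using fan(1) that unfolding fan_def by blast
  note vy = xsE[OF yxs]
  have sh: "col ?\<chi>" "eqv \<psi> ?\<chi>"
    using fan_shift[OF col fan(1-3)] fan(5) y(1) a(1) by simp_all
  have in_xs: "?\<chi> {v, x} = mc \<psi> x" if "x \<in> set xs" for x using shift_in[OF that] .
  have out_xs: "?\<chi> e = \<psi> e" if "\<And>x. x \<in> set xs \<Longrightarrow> e \<noteq> {v, x}" for e using shift_out[OF that] .
  have KB: "K \<subseteq> bicoloured_edges E \<psi> \<omega> a"
    and Kcl: "\<And>e e'. e \<in> K \<Longrightarrow> e' \<in> bicoloured_edges E \<psi> \<omega> a \<Longrightarrow> e \<inter> e' \<noteq> {} \<Longrightarrow> e' \<in> K"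
    using K(1) unfolding swap_closed_def by blast+
  have K_out: "?\<chi> e = \<psi> e" if "e \<in> K" for e
    by (rule out_xs) (use K(2)[OF that] in auto)
  have KE: "e \<in> E" if "e \<in> K" for e using KB that unfolding bicoloured_edges_def by blast
  \<comment> \<open>After the shift \<open>vy\<close> is the only edge at \<open>v\<close> coloured
    \<open>\<omega>\<close> or \<open>a\<close>: \<open>vu\<close> has lost \<open>\<omega>\<close>,
    the other fan edges carry neither colour, and \<open>a\<close> was missing at
    \<open>v\<close>.\<close>
  have cl: "swap_closed E ?\<chi> \<omega> a ?K"
  proof (rule swap_closedI)
    have "e \<in> bicoloured_edges E ?\<chi> \<omega> a" if "e \<in> K" for e
      using KB that K_out[OF that] unfolding bicoloured_edges_def by auto
    moreover have "{v, y} \<in> bicoloured_edges E ?\<chi> \<omega> a"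
      using vy in_xs[OF yxs] y(1) unfolding bicoloured_edges_def by simp
    ultimately show "?K \<subseteq> bicoloured_edges E ?\<chi> \<omega> a" by blast
    fix e z w assume h: "e \<in> ?K" "z \<in> e" "{z, w} \<in> E" "?\<chi> {z, w} = \<omega> \<or> ?\<chi> {z, w} = a"
    show "{z, w} \<in> ?K"
    proof (cases "\<exists>x\<in>set xs. {z, w} = {v, x}")
      case True
      then obtain x where x: "x \<in> set xs" "{z, w} = {v, x}" by blast
      then have "mc \<psi> x = \<omega> \<or> mc \<psi> x = a" using h(4) in_xs by simp
      then have "x = y" using xs x(1) by blast
      then show ?thesis using x(2) by simp
    next
      case False
      then have eq: "?\<chi> {z, w} = \<psi> {z, w}" by (intro out_xs) blast
      then have B: "{z, w} \<in> bicoloured_edges E \<psi> \<omega> a"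
        using h(3,4) unfolding bicoloured_edges_def by simp
      show ?thesis
      proof (cases "e \<in> K")
        case True
        then show ?thesis using Kcl[OF True B] h(2) by blast
      next
        case False': False
        then have "z = v \<or> z = y" using h(1,2) by blast
        then show ?thesis
        proof
          assume zv: "z = v"
          then have "\<psi> {v, w} = \<omega>" using h(3,4) eq mc_edge[OF col, of v w] a(1) by auto
          then have "w = u" using nbr_unique[OF col _ vu] h(3) zv uv\<psi> by simp
          then show ?thesis using False zv uxs by blast
        next
          assume "z = y"
          then show ?thesis using yK[of w] h(3,4) eq by simp
        qed
      qed
    qed
  qed
  have ar: "a \<in> {1..Suc D}" using mc_props(1)[OF col vV] a(1) by simp
  have e\<xi>: "eqv \<phi>0 ?\<xi>"
    using equiv_trans[OF equiv_trans[OF eqv sh(2)] swap_closed_equiv[OF cl \<omega>_range ar]] a(2) by simp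
  have c\<xi>: "col ?\<xi>" by (rule swap_closed_colouring[OF sh(1) cl \<omega>_range ar])
  have \<xi>_K: "?\<xi> e = \<omega> \<longleftrightarrow> \<phi>0 e = \<omega>" if "e \<in> K" for e
    using cls[OF KE[OF that]] that K_out[OF that] unfolding kempe_swap_def by simp
  have \<xi>_x: "?\<xi> {v, x} \<noteq> \<omega>" if "x \<in> set xs" "x \<noteq> y" for x
  proof -
    have "{v, x} \<notin> ?K" using K(2) that(2) by (auto simp: doubleton_eq_iff)
    then show ?thesis using xs[OF that] in_xs[OF that(1)] unfolding kempe_swap_def by simp
  qed
  have \<xi>_o: "?\<xi> e = \<omega> \<longleftrightarrow> \<phi>0 e = \<omega>"
    if "e \<in> E" "e \<notin> K" "\<And>x. x \<in> set xs \<Longrightarrow> e \<noteq> {v, x}" for e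
  proof -
    have "e \<notin> ?K" using that(2) that(3)[OF yxs] by blast
    then have "?\<xi> e = \<psi> e" using out_xs[OF that(3)] unfolding kempe_swap_def by simp
    then show ?thesis using cls[OF that(1)] that(2) unfolding kempe_swap_def by simp
  qed
  \<comment> \<open>Away from \<open>v\<close>, swapping back restores the class; at
    \<open>v\<close> the edge \<open>vu\<close> has left it, so both \<open>t\<close> and
    \<open>u\<close> end up free.\<close>
  have old: "?\<xi> e = \<omega> \<longleftrightarrow> \<phi>0 e = \<omega>" if e: "e \<in> E" "v \<notin> e" for e
  proof (cases "e \<in> K")
    case False
    have "e \<noteq> {v, x}" for x using e(2) by blast
    then show ?thesis using \<xi>_o[OF e(1) False] by simp
  qed (rule \<xi>_K)
  have "?\<xi> e = \<omega>" if e: "e \<in> E" "\<phi>0 e = \<omega>" "e \<noteq> {u, v}" for e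
  proof -
    have "v \<notin> e"
    proof
      assume "v \<in> e"
      then obtain w where w: "e = {v, w}" using edge_at[OF e(1)] by blast
      have "\<phi>0 {v, u} = \<omega>" using \<phi>0_uv by (simp add: insert_commute)
      then have "w = u" using nbr_unique[OF col0 _ vu] e w by simp
      then show False using e(3) w by (simp add: insert_commute)
    qed
    then show ?thesis using old e by blast
  qed
  moreover have tv: "t \<noteq> v" "t \<noteq> y" using t_ne_v free_not_adj_tv vy by blast+
  moreover have "mc ?\<xi> t = \<omega>"
  proof (rule mcI[OF c\<xi> tV \<omega>_range])
    fix w assume w: "{t, w} \<in> E"
    then have "w \<noteq> v" using free_not_adj_tv by (auto simp: insert_commute)
    then show "?\<xi> {t, w} \<noteq> \<omega>" using old[OF w] tv mc_edge[OF col0 w] t_free0 by simp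
  qed
  moreover have "mc ?\<xi> u = \<omega>"
  proof (rule mcI[OF c\<xi> uV \<omega>_range])
    fix w assume w: "{u, w} \<in> E"
    show "?\<xi> {u, w} \<noteq> \<omega>"
    proof (cases "w = v")
      case True
      then show ?thesis using \<xi>_x[OF uxs] y(2) by (simp add: insert_commute)
    next
      case False
      then have "\<phi>0 {u, w} \<noteq> \<omega>" using nbr_unique[OF col0 w uv] \<phi>0_uv by auto
      then show ?thesis using old[OF w] False u_ne_v by simp
    qed
  qed
  ultimately show False using no_win_free[OF c\<xi> e\<xi>] by blast
qed

text \<open>After a free leaf the next fan edge would be coloured \<open>\<omega>\<close>, but at
  \<open>v\<close> this colour leads to the first leaf \<open>u\<close>.\<close>

lemma fan_free_last:
  assumes C: "C \<phi>" and fan: "fan \<phi> v xs" "distinct xs" "hd xs = u" and x: "x \<in> set xs" "x \<noteq> last xs"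
  shows "mc \<phi> x \<noteq> \<omega>"
proof
  assume \<omega>: "mc \<phi> x = \<omega>"
  obtain i where i: "i < length xs" "xs ! i = x" using x(1) by (metis in_set_conv_nth)
  have ne: "xs \<noteq> []" using x(1) by auto
  have si: "Suc i < length xs"
  proof (rule ccontr)
    assume "\<not> ?thesis"
    then have "i = length xs - 1" using i(1) by simp
    then show False using x(2) i(2) ne by (simp add: last_conv_nth)
  qed
  have "\<phi> {v, xs ! Suc i} = \<phi> {v, u}"
    using fan(1) si i(2) \<omega> C_uv(2)[OF C] unfolding fan_def by simp
  moreover have "{v, xs ! Suc i} \<in> E" using fan(1) si unfolding fan_def by simp
  ultimately have "xs ! Suc i = u" using nbr_unique[OF C_col[OF C] _ vu] by blast
  moreover have "u = xs ! 0" using fan(3) ne by (simp add: hd_conv_nth)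
  moreover have "0 < length xs" using ne by simp
  ultimately show False using nth_eq_iff_index_eq[OF fan(2) si, of 0] by simp
qed

text \<open>Otherwise the chain at \<open>y\<close> can be swapped without touching
  \<open>v\<close>, so that \<open>y\<close> misses the same colour as \<open>v\<close>. Such a swap
  changes the class of \<open>\<omega>\<close>, which \<open>swap_back\<close> repairs while
  performing the exchange.\<close>

lemma free_fan_linked:
  assumes C: "C \<phi>" and fan: "fan \<phi> v xs" "distinct xs" "xs \<noteq> []" "hd xs = u" and y: "y = last xs" "mc \<phi> y = \<omega>"
  shows "conn \<phi> \<omega> (mc \<phi> v) v y"
proof (rule ccontr)
  let ?a = "mc \<phi> v"
  assume "\<not> ?thesis"
  then have nc: "\<not> conn \<phi> \<omega> ?a y v" using conn_sym by blast
  let ?\<psi> = "swp \<phi> \<omega> ?a y" and ?K = "{e \<in> bicoloured_edges E \<phi> \<omega> ?a. \<exists>z\<in>e. conn \<phi> \<omega> ?a y z}"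
  note cc = C_col[OF C]
  have a\<omega>: "?a \<noteq> \<omega>" using C_mc_uv(2)[OF C] .
  note cd = \<omega>_range C_range[OF C vV] a\<omega>[symmetric]
  have yxs: "y \<in> set xs" using fan(3) y(1) by simp
  have xsE: "{v, x} \<in> E" "x \<in> V" if "x \<in> set xs" for x
  proof -
    show "{v, x} \<in> E" using fan(1) that unfolding fan_def by blast
    then show "x \<in> V" using edgeD by blast
  qed
  have in_mc: "mc \<phi> x \<noteq> \<omega> \<and> mc \<phi> x \<noteq> ?a" if "x \<in> set xs" "x \<noteq> y" for x
    using fan_free_last[OF C fan(1,2,4) that(1)] fan_mc_ne[OF C fan(1,2,4) that(1)] that(2) y(1) by simp
  have same: "mc ?\<psi> x = mc \<phi> x" if "x \<in> set xs" "x \<noteq> y" for x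
    using swp_mc[OF cc cd xsE(2)[OF that(1)]] in_mc[OF that] by simp
  have mv: "mc ?\<psi> v = ?a" using swp_mc[OF cc cd vV] nc by simp
  have my: "mc ?\<psi> y = ?a" using swp_mc[OF cc cd xsE(2)[OF yxs], of y] y(2) by simp
  have e: "?\<psi> {v, x} = \<phi> {v, x}" if "{v, x} \<in> E" for x using swp_edge[OF cc cd that] nc by simp
  have bic: "bicoloured_edges E ?\<psi> \<omega> ?a = bicoloured_edges E \<phi> \<omega> ?a"
    unfolding swp_def by (rule bicoloured_swap) blast
  have swap: "kempe_swap \<omega> ?a ?K ?\<psi> = \<phi>"
    unfolding swp_def by (rule kempe_swap_involutory)
  show False
  proof (rule swap_back[where \<psi> = ?\<psi> and K = ?K and xs = xs and a = ?a and y = y])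
    show "col ?\<psi>" by (rule swp_col[OF cc cd])
    show "eqv \<phi>0 ?\<psi>" using equiv_trans[OF _ swp_eqv[OF cc cd]] C unfolding C_def by blast
    show "?a = mc ?\<psi> v" using mv by simp
    show "fan ?\<psi> v xs"
    proof (rule fan_cong[OF fan(1)])
      show "?\<psi> {v, w} = \<phi> {v, w}" if "w \<in> set xs" for w using e xsE(1)[OF that] by simp
      fix i assume i: "Suc i < length xs"
      then have "xs ! i \<noteq> y" using fan(2,3) y(1) by (simp add: last_conv_nth nth_eq_iff_index_eq)
      then show "mc ?\<psi> (xs ! i) = mc \<phi> (xs ! i)" using same i by simp
    qed
    show "y \<noteq> u" using y(2) C_mc_uv(1)[OF C] by auto
    show "mc ?\<psi> x \<noteq> \<omega> \<and> mc ?\<psi> x \<noteq> ?a" if "x \<in> set xs" "x \<noteq> y" for x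
      using same[OF that] in_mc[OF that] by simp
    show "?\<psi> {v, u} = \<omega>" using e[OF vu] C_uv(2)[OF C] by simp
    show "swap_closed E ?\<psi> \<omega> ?a ?K" using chain_closed[of \<phi> \<omega> ?a y] bic unfolding swap_closed_def by simp
    show "v \<notin> e" if "e \<in> ?K" for e using that conn_bicoloured nc by blast
    show "{y, w} \<in> ?K" if "{y, w} \<in> E" "?\<psi> {y, w} = \<omega> \<or> ?\<psi> {y, w} = ?a" for w
    proof -
      have "{y, w} \<in> bicoloured_edges E ?\<psi> \<omega> ?a" using that unfolding bicoloured_edges_def by simp
      then have "{y, w} \<in> bicoloured_edges E \<phi> \<omega> ?a" using bic by simp
      then show ?thesis by (simp add: exI[of _ y])
    qed
    show "kempe_swap \<omega> ?a ?K ?\<psi> e = \<omega> \<longleftrightarrow> \<phi>0 e = \<omega>" if "e \<in> E" for e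
      unfolding swap using C_class[OF C that] .
  qed (use fan my y a\<omega> in auto)
qed

text \<open>Leaves missing \<open>d\<close> are linked to \<open>v\<close> by
  \<open>fan_linked\<close> and so lie off the swapped chain, and no leaf misses
  \<open>mc \<phi> v\<close>.\<close>

lemma swp_keeps_fan:
  assumes C: "C \<phi>" and fan: "fan \<phi> v xs" "distinct xs" "hd xs = u"
    and d: "d \<in> {1..Suc D}" "d \<noteq> mc \<phi> v" "d \<noteq> \<omega>" and q: "\<not> conn \<phi> (mc \<phi> v) d q v"
  shows "C (swp \<phi> (mc \<phi> v) d q)" "fan (swp \<phi> (mc \<phi> v) d q) v xs" "mc (swp \<phi> (mc \<phi> v) d q) v = mc \<phi> v"
proof -
  note cc = C_col[OF C] and cd = C_range[OF C vV] d(1) d(2)[symmetric]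
  let ?\<psi> = "swp \<phi> (mc \<phi> v) d q"
  show "C ?\<psi>" by (rule C_swp[OF C cd C_mc_uv(2)[OF C] d(3)])
  show "mc ?\<psi> v = mc \<phi> v" using swp_mc[OF cc cd vV] q by simp
  have xsE: "{v, x} \<in> E" "x \<in> V" if "x \<in> set xs" for x
  proof -
    show "{v, x} \<in> E" using fan(1) that unfolding fan_def by blast
    then show "x \<in> V" using edgeD by blast
  qed
  have same: "mc ?\<psi> x = mc \<phi> x" if x: "x \<in> set xs" for x
  proof (cases "mc \<phi> x = d")
    case True
    then have "conn \<phi> (mc \<phi> v) d v x" using fan_linked[OF C fan x] d(3) by simp
    then have "\<not> conn \<phi> (mc \<phi> v) d q x" using q conn_trans conn_sym by blast
    then show ?thesis using swp_mc[OF cc cd xsE(2)[OF x]] by simp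
  next
    case False
    then show ?thesis using swp_mc[OF cc cd xsE(2)[OF x]] fan_mc_ne[OF C fan x] by simp
  qed
  show "fan ?\<psi> v xs"
    by (rule fan_cong[OF fan(1)]) (use swp_edge[OF cc cd xsE(1)] q same in auto)
qed

section \<open>Independent free vertices: a second fan at the free end of the first\<close>

context
  assumes indep: "\<And>x y. {x, y} \<in> E \<Longrightarrow> mc \<phi>0 x = \<omega> \<Longrightarrow> mc \<phi>0 y \<noteq> \<omega>"
begin

text \<open>By independence no neighbour of \<open>y\<close> is free, so a maximal fan at
  \<open>y\<close> cannot stop with a leaf missing \<open>\<omega>\<close> and must close up. Unless
  it ends suitably by itself, a swap avoiding \<open>v\<close> makes some leaf other than
  \<open>v\<close> miss the colour missing at \<open>v\<close>.\<close>

lemma second_fan: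
  assumes fan: "fan \<phi>0 v xs" "distinct xs" "xs \<noteq> []" "hd xs = u" and y: "y = last xs" "mc \<phi>0 y = \<omega>"
  obtains \<phi> ws where "C \<phi>" "fan \<phi> v xs" "fan \<phi> y ws" "distinct ws" "ws \<noteq> []" "v \<notin> set ws"
    "\<phi> {y, hd ws} = mc \<phi> v" "mc \<phi> (last ws) = mc \<phi> v"
    "\<And>i. Suc i < length ws \<Longrightarrow> mc \<phi> (ws ! i) \<noteq> mc \<phi> v"
proof -
  let ?a = "mc \<phi>0 v"
  note cc = col0
  have a\<omega>: "?a \<noteq> \<omega>" using C_mc_uv(2)[OF C0] .
  have ar: "?a \<in> {1..Suc D}" using C_range[OF C0 vV] .
  have yxs: "y \<in> set xs" using fan(3) y(1) by simp
  have vy: "{v, y} \<in> E" using fan(1) yxs unfolding fan_def by blast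
  have yv: "{y, v} \<in> E" "\<phi>0 {y, v} = \<phi>0 {v, y}" using vy by (simp_all add: insert_commute)
  have yV: "y \<in> V" "y \<noteq> v" using edgeD[OF vy] by auto
  have y_ne_u: "y \<noteq> u" using y(2) C_mc_uv(1)[OF C0] by auto
  have "?a \<noteq> mc \<phi>0 y" using a\<omega> y(2) by simp
  then obtain w1 where w1: "{y, w1} \<in> E" "\<phi>0 {y, w1} = ?a"
    by (rule nbr_ex[OF cc yV(1) ar])
  obtain ws where ws: "fan \<phi>0 y ws" "distinct ws" "ws \<noteq> []" "hd ws = w1"
    and end_ws: "mc \<phi>0 (last ws) = mc \<phi>0 y \<or> (\<exists>j < length ws. \<phi>0 {y, ws ! j} = mc \<phi>0 (last ws))"
    using fan_exists[OF cc w1(1)] by blast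
  let ?n = "length ws" and ?z = "last ws"
  have wsE: "{y, w} \<in> E" "w \<in> V" "mc \<phi>0 w \<noteq> \<omega>" "w \<noteq> y" if "w \<in> set ws" for w
  proof -
    show E: "{y, w} \<in> E" using ws(1) that unfolding fan_def by blast
    show "w \<in> V" "w \<noteq> y" using edgeD[OF E] by auto
    show "mc \<phi>0 w \<noteq> \<omega>" using indep[OF E y(2)] .
  qed
  have pos: "0 < ?n" using ws(3) by simp
  have w0: "ws ! 0 = w1" using ws(3,4) by (simp add: hd_conv_nth)
  have succ: "\<phi>0 {y, ws ! Suc i} = mc \<phi>0 (ws ! i)" if "Suc i < ?n" for i
    using ws(1) that unfolding fan_def by blast
  have idx: "i = j" if "i < ?n" "j < ?n" "\<phi>0 {y, ws ! i} = \<phi>0 {y, ws ! j}" for i j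
    using nbr_unique[OF cc wsE(1) wsE(1) that(3)] that(1,2) nth_eq_iff_index_eq[OF ws(2) that(1,2)] by simp
  have not_a: "mc \<phi>0 (ws ! i) \<noteq> ?a" if "Suc i < ?n" for i
    using idx[OF that pos] succ[OF that] w0 w1(2) by auto
  \<comment> \<open>A leaf before the last cannot miss \<open>?a\<close>, as that colour is on the
    first edge; so \<open>v\<close> can only come last.\<close>
  have v_last: "v = ?z" if "v \<in> set ws"
  proof -
    obtain i where i: "i < ?n" "ws ! i = v" using \<open>v \<in> set ws\<close> by (metis in_set_conv_nth)
    then have "\<not> Suc i < ?n" using not_a by auto
    then have "i = ?n - 1" using i(1) by simp
    then show ?thesis using i(2) ws(3) by (simp add: last_conv_nth)
  qed
  have zws: "?z \<in> set ws" using ws(3) by simp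
  have "mc \<phi>0 ?z \<noteq> mc \<phi>0 y" using wsE(3)[OF zws] y(2) by simp
  then obtain j where j: "j < ?n" "\<phi>0 {y, ws ! j} = mc \<phi>0 ?z" using end_ws by blast
  show ?thesis
  proof (cases "?z = v")
    case True
    define zs where "zs = butlast ws"
    let ?e = "\<phi>0 {y, v}"
    have ws_eq: "ws = zs @ [v]" unfolding zs_def using append_butlast_last_id[OF ws(3)] True by simp
    have e_a: "?e \<noteq> ?a" using mc_edge'[OF cc yv(1)] .
    have e_o: "?e \<noteq> \<omega>" using mc_edge[OF cc yv(1)] y(2) by simp
    have er: "?e \<in> {1..Suc D}" using edge_colouring_range[OF cc yv(1)] .
    have ne: "zs \<noteq> []"
    proof
      assume "zs = []"
      then have "w1 = v" using ws_eq ws(4) by simp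
      then show False using w1(2) e_a by simp
    qed
    let ?w = "last zs"
    have fan': "fan \<phi>0 y zs" and mw: "mc \<phi>0 ?w = ?e"
      using ws(1) ne unfolding ws_eq fan_snoc by simp_all
    have wsub: "set zs \<subseteq> set ws" "v \<notin> set zs" "distinct zs" using ws(2) unfolding ws_eq by auto
    have wws: "?w \<in> set zs" using ne by simp
    have wE: "{y, w} \<in> E" "w \<in> V" if "w \<in> set zs" for w using wsE(1,2)[of w] that wsub(1) by blast+
    have not_a': "mc \<phi>0 w \<noteq> ?a" if w: "w \<in> set zs" for w
    proof -
      obtain i where i: "i < length zs" "zs ! i = w" using w by (metis in_set_conv_nth)
      then have "Suc i < ?n" "ws ! i = w" unfolding ws_eq by (simp_all add: nth_append)
      then show ?thesis using not_a[of i] by simp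
    qed
    let ?\<xi> = "last (butlast xs)"
    have xs_eq: "xs = butlast xs @ [y]" using fan(3) y(1) by simp
    have xne: "butlast xs \<noteq> []"
    proof
      assume "butlast xs = []"
      then have "xs = [y]" using xs_eq by simp
      then show False using fan(4) y_ne_u by simp
    qed
    have m\<xi>: "mc \<phi>0 ?\<xi> = ?e"
    proof -
      have "fan \<phi>0 v (butlast xs @ [y])" using fan(1) xs_eq by simp
      then show ?thesis using xne yv(2) unfolding fan_snoc by simp
    qed
    have \<xi>xs: "?\<xi> \<in> set xs" using xne by (meson in_set_butlastD last_in_set)
    have \<xi>E: "{v, ?\<xi>} \<in> E" using fan(1) \<xi>xs unfolding fan_def by blast
    have \<xi>V: "?\<xi> \<in> V" "?\<xi> \<noteq> v" using edgeD[OF \<xi>E] by auto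
    have l\<xi>: "conn \<phi>0 ?a ?e v ?\<xi>"
      using fan_linked[OF C0 fan(1,2,4) \<xi>xs] m\<xi> e_o by simp
    \<comment> \<open>Both vertices miss the colour of \<open>yv\<close>. One is adjacent to
      \<open>y\<close>, the other to \<open>v\<close>, so they differ by triangle-freeness, and
      \<open>?\<xi>\<close> is already the far end of the chain of \<open>v\<close>.\<close>
    have w\<xi>: "?w \<noteq> ?\<xi>"
    proof
      assume "?w = ?\<xi>"
      then show False using no_triangle[OF vy wE(1)[OF wws]] \<xi>E by simp
    qed
    have wv: "?w \<noteq> v" using wws wsub(2) by auto
    have nc: "\<not> conn \<phi>0 ?a ?e ?w v"
    proof
      assume "conn \<phi>0 ?a ?e ?w v"
      then show False
        using chain_ends[OF cc l\<xi> conn_sym vV \<xi>V(1) wE(2)[OF wws]] mw m\<xi> w\<xi> wv \<xi>V(2) by simp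
    qed
    have ncy: "\<not> conn \<phi>0 ?a ?e ?w y"
      using nc conn_edge[OF yv(1), of \<phi>0 ?a ?e] conn_trans by blast
    let ?\<psi> = "swp \<phi>0 ?a ?e ?w"
    note cd = ar er e_a[symmetric]
    note kept = swp_keeps_fan[OF C0 fan(1,2,4) er e_a e_o nc]
    have ed: "?\<psi> {y, w} = \<phi>0 {y, w}" if "{y, w} \<in> E" for w using swp_edge[OF cc cd that] ncy by simp
    obtain n where n: "0 < n" "n \<le> length zs" "fan ?\<psi> y (take n zs)"
      "mc ?\<psi> (last (take n zs)) = ?a" "\<And>i. Suc i < n \<Longrightarrow> mc ?\<psi> (zs ! i) \<noteq> ?a"
    proof (rule fan_prefix[of zs ?\<psi> y \<phi>0 ?a ?w])
      show "?\<psi> {y, zs ! Suc i} = mc \<phi>0 (zs ! i)" if "Suc i < length zs" for i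
        using ed[OF wE(1)[OF nth_mem[OF that]]] fan' that unfolding fan_def by simp
      show "{y, w} \<in> E" if "w \<in> set zs" for w using wE(1)[OF that] .
      show "mc ?\<psi> w = mc \<phi>0 w \<or> mc ?\<psi> w = ?a" if "w \<in> set zs" for w
        using swp_mc[OF cc cd wE(2)[OF that], of ?w] not_a'[OF that] by (cases "mc \<phi>0 w = ?e") auto
      show "?w \<in> set zs" by (rule wws)
      show "mc ?\<psi> ?w = ?a" using swp_mc[OF cc cd wE(2)[OF wws], of ?w] mw by simp
    qed blast
    have hd_eq: "hd (take n zs) = w1" using n(1) ne ws(4) unfolding ws_eq by simp
    show ?thesis
    proof (rule that[of ?\<psi> "take n zs"])
      show "distinct (take n zs)" using wsub(3) by simp
      show "take n zs \<noteq> []" using n(1) ne by simp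
      show "v \<notin> set (take n zs)" using wsub(2) by (meson in_set_takeD)
      show "?\<psi> {y, hd (take n zs)} = mc ?\<psi> v" using hd_eq ed[OF w1(1)] w1(2) kept(3) by simp
      show "mc ?\<psi> (last (take n zs)) = mc ?\<psi> v" using n(4) kept(3) by simp
      show "mc ?\<psi> (take n zs ! i) \<noteq> mc ?\<psi> v" if "Suc i < length (take n zs)" for i
        using n(5)[of i] that kept(3) by simp
    qed (rule kept n)+
  next
    case zv: False
    have vws: "v \<notin> set ws" using v_last zv by auto
    show ?thesis
    proof (cases "mc \<phi>0 ?z = ?a")
      case True
      have hd_ws: "\<phi>0 {y, hd ws} = ?a" using ws(4) w1(2) by simp
      show ?thesis
        by (rule that[OF C0 fan(1) ws(1-3) vws hd_ws True not_a])
    next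
      case z_a: False
      let ?d = "mc \<phi>0 ?z"
      have j0: "0 < j" using j z_a w0 w1(2) by (cases j) auto
      let ?p = "ws ! (j - 1)"
      have pws: "?p \<in> set ws" using j(1) by simp
      have mp: "mc \<phi>0 ?p = ?d" using succ[of "j - 1"] j j0 by simp
      have zp: "?z \<noteq> ?p"
      proof
        assume "?z = ?p"
        then have "ws ! (?n - 1) = ws ! (j - 1)" using ws(3) by (simp add: last_conv_nth)
        moreover have "?n - 1 < ?n" "j - 1 < ?n" "?n - 1 \<noteq> j - 1" using j j0 by linarith+
        ultimately show False using nth_eq_iff_index_eq[OF ws(2), of "?n - 1" "j - 1"] by blast
      qed
      have pv: "?p \<noteq> v" using pws vws by auto
      have d_o: "?d \<noteq> \<omega>" using wsE(3)[OF zws] .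
      have dr: "?d \<in> {1..Suc D}" using C_range[OF C0 wsE(2)[OF zws]] .
      \<comment> \<open>Both vertices miss \<open>?d\<close>, so at most one of them ends the chain
        of \<open>v\<close>; the swap is made at the other.\<close>
      have "\<not> (conn \<phi>0 ?a ?d v ?z \<and> conn \<phi>0 ?a ?d v ?p)"
      proof
        assume "conn \<phi>0 ?a ?d v ?z \<and> conn \<phi>0 ?a ?d v ?p"
        then show False
          using chain_ends[OF cc, of ?a ?d v ?z ?p] vV wsE(2)[OF zws] wsE(2)[OF pws] mp zp zv pv by simp
      qed
      then obtain q where q: "q = ?z \<or> q = ?p" "\<not> conn \<phi>0 ?a ?d q v" using conn_sym by blast
      have qws: "q \<in> set ws" and mq: "mc \<phi>0 q = ?d" using q(1) zws pws mp by auto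
      let ?\<psi> = "swp \<phi>0 ?a ?d q"
      note cd = ar dr z_a[symmetric]
      note kept = swp_keeps_fan[OF C0 fan(1,2,4) dr z_a d_o q(2)]
      have not_a': "mc \<phi>0 w \<noteq> ?a" if w: "w \<in> set ws" for w
      proof -
        obtain i where i: "i < ?n" "ws ! i = w" using w by (metis in_set_conv_nth)
        show ?thesis
        proof (cases "Suc i < ?n")
          case True
          then show ?thesis using not_a i(2) by blast
        next
          case False
          then have "i = ?n - 1" using i(1) by simp
          then have "w = ?z" using i(2) ws(3) by (simp add: last_conv_nth)
          then show ?thesis using z_a by simp
        qed
      qed
      \<comment> \<open>If \<open>y\<close> lies on the swapped chain, \<open>?a\<close> and
        \<open>?d\<close> trade places at \<open>y\<close>: the edge to \<open>ws ! j\<close> now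
        comes first and the edge to \<open>w1\<close> follows \<open>?z\<close>, so the fan is
        rotated.\<close>
      define ws' where "ws' = (if conn \<phi>0 ?a ?d q y then drop j ws @ take j ws else ws)"
      have set': "set ws' = set ws"
      proof -
        have "set (take j ws) \<union> set (drop j ws) = set ws" by (metis append_take_drop_id set_append)
        then show ?thesis unfolding ws'_def by auto
      qed
      have dist': "distinct ws'"
      proof -
        have "distinct (take j ws @ drop j ws)" using ws(2) by simp
        then show ?thesis unfolding ws'_def distinct_append using ws(2) by (auto simp: Int_commute)
      qed
      have len': "?\<psi> {y, ws' ! Suc i} = mc \<phi>0 (ws' ! i)" if i: "Suc i < length ws'" for i
      proof (cases "conn \<phi>0 ?a ?d q y")
        case False
        then have i': "Suc i < ?n" and eq: "ws' = ws" using i unfolding ws'_def by simp_all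
        show ?thesis
          using swp_edge[OF cc cd wsE(1)[OF nth_mem[OF i']], of q] succ[OF i'] False unfolding eq by simp
      next
        case True
        let ?P = "\<lambda>x w. ?\<psi> {y, w} = mc \<phi>0 x"
        have other: "?\<psi> {y, ws ! m} = \<phi>0 {y, ws ! m}" if m: "m < ?n" "m \<noteq> 0" "m \<noteq> j" for m
        proof (rule swp_other[OF cc cd wsE(1)[OF nth_mem[OF m(1)]]])
          show "\<phi>0 {y, ws ! m} \<noteq> ?a" using idx[OF m(1) pos] m(2) w0 w1(2) by auto
          show "\<phi>0 {y, ws ! m} \<noteq> ?d" using idx[OF m(1) j(1)] m(3) j(2) by auto
        qed
        have "successively ?P (drop j ws)"
          unfolding successively_conv_nth
        proof (intro allI impI)
          fix m assume "Suc m < length (drop j ws)"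
          then show "?P (drop j ws ! m) (drop j ws ! Suc m)"
            using other[of "Suc (j + m)"] succ[of "j + m"] by simp
        qed
        moreover have "successively ?P (take j ws)"
          unfolding successively_conv_nth
        proof (intro allI impI)
          fix m assume "Suc m < length (take j ws)"
          then show "?P (take j ws ! m) (take j ws ! Suc m)"
            using other[of "Suc m"] succ[of m] by simp
        qed
        moreover have "?P (last (drop j ws)) (hd (take j ws))"
        proof -
          have "hd (take j ws) = w1" using j0 ws(4) by simp
          moreover have "last (drop j ws) = ?z" using j(1) by simp
          moreover have "?\<psi> {y, w1} = ?d" using swp_edge[OF cc cd w1(1), of q] True w1(2) by simp
          ultimately show ?thesis by simp
        qed
        ultimately have "successively ?P (drop j ws @ take j ws)" unfolding successively_append_iff by blast
        then show ?thesis using i True unfolding successively_conv_nth ws'_def by simp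
      qed
      have hd': "?\<psi> {y, hd ws'} = ?a"
      proof (cases "conn \<phi>0 ?a ?d q y")
        case True
        then have "hd ws' = ws ! j" using j(1) unfolding ws'_def by (simp add: hd_drop_conv_nth)
        then show ?thesis using swp_edge[OF cc cd wsE(1)[OF nth_mem[OF j(1)]], of q] True j(2) by simp
      next
        case False
        then show ?thesis using swp_edge[OF cc cd w1(1), of q] ws(4) w1(2) unfolding ws'_def by simp
      qed
      obtain n where n: "0 < n" "n \<le> length ws'" "fan ?\<psi> y (take n ws')"
        "mc ?\<psi> (last (take n ws')) = ?a" "\<And>i. Suc i < n \<Longrightarrow> mc ?\<psi> (ws' ! i) \<noteq> ?a"
      proof (rule fan_prefix[of ws' ?\<psi> y \<phi>0 ?a q])
        show "?\<psi> {y, ws' ! Suc i} = mc \<phi>0 (ws' ! i)" if "Suc i < length ws'" for i using len'[OF that] .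
        show "{y, w} \<in> E" if "w \<in> set ws'" for w using wsE(1) that set' by simp
        show "mc ?\<psi> w = mc \<phi>0 w \<or> mc ?\<psi> w = ?a" if w: "w \<in> set ws'" for w
        proof -
          have w': "w \<in> set ws" using w set' by simp
          show ?thesis
            using swp_mc[OF cc cd wsE(2)[OF w'], of q] not_a'[OF w'] by (cases "mc \<phi>0 w = ?d") auto
        qed
        show "q \<in> set ws'" using qws set' by simp
        show "mc ?\<psi> q = ?a" using swp_mc[OF cc cd wsE(2)[OF qws], of q] mq by simp
      qed blast
      have hd_eq: "hd (take n ws') = hd ws'" using n(1) by simp
      show ?thesis
      proof (rule that[of ?\<psi> "take n ws'"])
        show "distinct (take n ws')" using dist' by simp
        show "take n ws' \<noteq> []" using n(1,2) by auto
        show "v \<notin> set (take n ws')" using vws set' by (auto dest: in_set_takeD)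
        show "?\<psi> {y, hd (take n ws')} = mc ?\<psi> v" using hd_eq hd' kept(3) by simp
        show "mc ?\<psi> (last (take n ws')) = mc ?\<psi> v" using n(4) kept(3) by simp
        show "mc ?\<psi> (take n ws' ! i) \<noteq> mc ?\<psi> v" if "Suc i < length (take n ws')" for i
          using n(5)[of i] that kept(3) by simp
      qed (rule kept n)+
    qed
  qed
qed

text \<open>By \<open>free_fan_linked\<close> the chain of \<open>v\<close> in
  \<open>\<omega>\<close> and \<open>mc \<phi> v\<close> ends at \<open>y\<close>, so it avoids the
  last leaf \<open>?q\<close> of the second fan. Swapping at \<open>?q\<close> and shifting that fan
  makes \<open>y\<close> miss the same colour as \<open>v\<close>, the situation of
  \<open>swap_back\<close>.\<close>

lemma independent_free_contradiction: False
proof -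
  obtain xs where xs: "fan \<phi>0 v xs" "distinct xs" "xs \<noteq> []" "hd xs = u" "mc \<phi>0 (last xs) = \<omega>"
    using fan_to_free[OF C0] by blast
  define y where "y = last xs"
  have y0: "mc \<phi>0 y = \<omega>" using xs(5) y_def by simp
  obtain \<phi> ws where C: "C \<phi>" and fan: "fan \<phi> v xs" and ws: "fan \<phi> y ws" "distinct ws" "ws \<noteq> []"
    and vws: "v \<notin> set ws" and hd_ws: "\<phi> {y, hd ws} = mc \<phi> v" and last_ws: "mc \<phi> (last ws) = mc \<phi> v"
    and before: "\<And>i. Suc i < length ws \<Longrightarrow> mc \<phi> (ws ! i) \<noteq> mc \<phi> v"
    using second_fan[OF xs(1-4) y_def y0] by blast
  let ?a = "mc \<phi> v" and ?q = "last ws"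
  note cc = C_col[OF C]
  have a\<omega>: "?a \<noteq> \<omega>" using C_mc_uv(2)[OF C] .
  note cd = \<omega>_range C_range[OF C vV] a\<omega>[symmetric]
  have yxs: "y \<in> set xs" using xs(3) y_def by simp
  have xsE: "{v, x} \<in> E" "x \<in> V" if "x \<in> set xs" for x
  proof -
    show "{v, x} \<in> E" using fan that unfolding fan_def by blast
    then show "x \<in> V" using edgeD by blast
  qed
  have vy: "{v, y} \<in> E" by (rule xsE(1)[OF yxs])
  have yV: "y \<in> V" and y_ne_v: "y \<noteq> v" using edgeD[OF vy] by auto
  have my: "mc \<phi> y = \<omega>" using C_free[OF C yV] y0 by simp
  have y_ne_u: "y \<noteq> u" using my C_mc_uv(1)[OF C] by auto
  have wsE: "{y, w} \<in> E" "w \<in> V" "mc \<phi> w \<noteq> \<omega>" "w \<noteq> y" if "w \<in> set ws" for w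
  proof -
    show E: "{y, w} \<in> E" using ws(1) that unfolding fan_def by blast
    show V: "w \<in> V" "w \<noteq> y" using edgeD[OF E] by auto
    show "mc \<phi> w \<noteq> \<omega>" using C_free[OF C V(1)] indep[OF E y0] by simp
  qed
  have qws: "?q \<in> set ws" using ws(3) by simp
  have inner: "mc \<phi> w \<noteq> ?a" if w: "w \<in> set ws" "w \<noteq> ?q" for w
  proof -
    obtain i where i: "i < length ws" "ws ! i = w" using w(1) by (metis in_set_conv_nth)
    have "Suc i < length ws"
    proof (rule ccontr)
      assume "\<not> ?thesis"
      then have "i = length ws - 1" using i(1) by simp
      then show False using i(2) w(2) ws(3) by (simp add: last_conv_nth)
    qed
    then show ?thesis using before i(2) by blast
  qed
  have l: "conn \<phi> \<omega> ?a v y" using free_fan_linked[OF C fan xs(2-4) y_def my] .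
  have q_ne_v: "?q \<noteq> v" using vws qws by auto
  have nv: "\<not> conn \<phi> \<omega> ?a ?q v"
  proof
    assume "conn \<phi> \<omega> ?a ?q v"
    then have "y = ?q"
      using chain_ends[OF cc l conn_sym vV yV wsE(2)[OF qws]] my last_ws y_ne_v q_ne_v by simp
    then show False using wsE(4)[OF qws] by simp
  qed
  have ny: "\<not> conn \<phi> \<omega> ?a ?q y" using nv l conn_trans conn_sym by blast
  let ?\<psi> = "swp \<phi> \<omega> ?a ?q"
  let ?\<chi> = "shift ?\<psi> y ws"
  define K where "K = {e \<in> bicoloured_edges E \<phi> \<omega> ?a. \<exists>z\<in>e. conn \<phi> \<omega> ?a ?q z}"
  have \<psi>K: "?\<psi> = kempe_swap \<omega> ?a K \<phi>" unfolding swp_def K_def ..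
  have KB: "K \<subseteq> bicoloured_edges E \<phi> \<omega> ?a" unfolding K_def by blast
  have K_conn: "conn \<phi> \<omega> ?a ?q z" if "e \<in> K" "z \<in> e" for e z
    using that conn_bicoloured unfolding K_def by blast
  have K_int: "e \<in> K" if "e \<in> bicoloured_edges E \<phi> \<omega> ?a" "z \<in> e" "conn \<phi> \<omega> ?a ?q z" for e z
    using that unfolding K_def by blast
  have bic: "bicoloured_edges E ?\<psi> \<omega> ?a = bicoloured_edges E \<phi> \<omega> ?a"
    unfolding \<psi>K by (rule bicoloured_swap[OF KB])
  have ey: "?\<psi> {y, w} = \<phi> {y, w}" if "{y, w} \<in> E" for w using swp_edge[OF cc cd that] ny by simp
  have ev: "?\<psi> {v, w} = \<phi> {v, w}" if "{v, w} \<in> E" for w using swp_edge[OF cc cd that] nv by simp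
  have mq: "mc ?\<psi> ?q = \<omega>" using swp_mc[OF cc cd wsE(2)[OF qws], of ?q] last_ws by simp
  have mw: "mc ?\<psi> w = mc \<phi> w" if "w \<in> set ws" "w \<noteq> ?q" for w
    using swp_mc[OF cc cd wsE(2)[OF that(1)]] wsE(3)[OF that(1)] inner[OF that] by simp
  have \<psi>y: "mc ?\<psi> y = \<omega>" using swp_mc[OF cc cd yV] ny my by simp
  have fan\<psi>: "fan ?\<psi> y ws"
  proof (rule fan_cong[OF ws(1)])
    show "?\<psi> {y, w} = \<phi> {y, w}" if "w \<in> set ws" for w using ey[OF wsE(1)[OF that]] .
    fix i assume i: "Suc i < length ws"
    then have "ws ! i \<noteq> ?q" using ws(2,3) by (simp add: last_conv_nth nth_eq_iff_index_eq)
    then show "mc ?\<psi> (ws ! i) = mc \<phi> (ws ! i)" using mw i by simp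
  qed
  have sh: "col ?\<chi>" "eqv ?\<psi> ?\<chi>" "mc ?\<chi> y = ?a"
    using fan_shift[OF swp_col[OF cc cd] fan\<psi> ws(2,3)] mq \<psi>y ey[OF wsE(1)[OF hd_in_set[OF ws(3)]]] hd_ws
    by simp_all
  have \<chi>_in: "?\<chi> {y, w} = mc ?\<psi> w" if "w \<in> set ws" for w using shift_in[OF that] .
  have \<chi>_out: "?\<chi> e = ?\<psi> e" if "\<And>w. w \<in> set ws \<Longrightarrow> e \<noteq> {y, w}" for e using shift_out[OF that] .
  have \<chi>v: "?\<chi> {v, w} = \<phi> {v, w}" if vw: "{v, w} \<in> E" for w
  proof -
    have "{v, w} \<noteq> {y, w'}" if "w' \<in> set ws" for w' using that vws y_ne_v by (auto simp: doubleton_eq_iff)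
    then have "?\<chi> {v, w} = ?\<psi> {v, w}" by (rule \<chi>_out)
    then show ?thesis using ev[OF vw] by simp
  qed
  have \<chi>x: "mc ?\<chi> x = mc \<phi> x" "mc \<phi> x \<noteq> \<omega>" "mc \<phi> x \<noteq> ?a" if x: "x \<in> set xs" "x \<noteq> y" for x
  proof -
    show m: "mc \<phi> x \<noteq> \<omega>" "mc \<phi> x \<noteq> ?a"
      using fan_free_last[OF C fan xs(2,4) x(1)] fan_mc_ne[OF C fan xs(2,4) x(1)] x(2) y_def by simp_all
    \<comment> \<open>A common leaf of the two fans would form a triangle with \<open>v\<close> and
      \<open>y\<close>; hence the shift at \<open>y\<close> does not disturb the fan at
      \<open>v\<close>.\<close>
    have xws: "x \<notin> set ws" using no_triangle[OF vy wsE(1)] xsE(1)[OF x(1)] by blast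
    have "mc ?\<chi> x = mc ?\<psi> x"
    proof (rule mc_cong)
      fix w
      have "{x, w} \<noteq> {y, w'}" if "w' \<in> set ws" for w'
        using that xws x(2) by (auto simp: doubleton_eq_iff)
      then show "?\<chi> {x, w} = ?\<psi> {x, w}" by (rule \<chi>_out)
    qed
    also have "\<dots> = mc \<phi> x" using swp_mc[OF cc cd xsE(2)[OF x(1)]] m by simp
    finally show "mc ?\<chi> x = mc \<phi> x" .
  qed
  have \<chi>K: "?\<chi> e = ?\<psi> e" if e: "e \<in> K" for e
  proof (rule \<chi>_out)
    show "e \<noteq> {y, w}" for w using K_conn[OF e, of y] ny by auto
  qed
  have bad: "w = ?q" if w: "w \<in> set ws" "?\<chi> {y, w} = \<omega> \<or> ?\<chi> {y, w} = ?a" for w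
  proof (rule ccontr)
    assume ne: "w \<noteq> ?q"
    show False using w(2) \<chi>_in[OF w(1)] mw[OF w(1) ne] wsE(3)[OF w(1)] inner[OF w(1) ne] by simp
  qed
  have at_y: "{y, w} = {y, ?q}" if w: "{y, w} \<in> E" "?\<chi> {y, w} = \<omega> \<or> ?\<chi> {y, w} = ?a" for w
  proof (cases "w \<in> set ws")
    case True
    then show ?thesis using bad w(2) by blast
  next
    case False
    have "{y, w} \<noteq> {y, w'}" if "w' \<in> set ws" for w' using that False by (auto simp: doubleton_eq_iff)
    then have "?\<chi> {y, w} = ?\<psi> {y, w}" by (rule \<chi>_out)
    then have "\<phi> {y, w} = ?a" using ey[OF w(1)] w(2) mc_edge[OF cc w(1)] my by auto
    then have "w = hd ws" using nbr_unique[OF cc w(1) wsE(1)[OF hd_in_set[OF ws(3)]]] hd_ws by simp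
    then show ?thesis using False ws(3) by simp
  qed
  have \<chi>q: "?\<chi> {y, ?q} = \<omega>" using \<chi>_in[OF qws] mq by simp
  have yq: "{y, ?q} \<in> E" using wsE(1)[OF qws] .
  \<comment> \<open>The shift has put \<open>\<omega>\<close> on the edge from \<open>y\<close> to
    \<open>?q\<close>; swapping back must take it off again to restore the class of
    \<open>\<phi>0\<close>.\<close>
  let ?K = "insert {y, ?q} K"
  show False
  proof (rule swap_back[where \<psi> = ?\<chi> and K = ?K and xs = xs and a = ?a and y = y])
    show "col ?\<chi>" by (rule sh(1))
    show "eqv \<phi>0 ?\<chi>"
      using equiv_trans[OF equiv_trans[OF _ swp_eqv[OF cc cd]] sh(2)] C unfolding C_def by blast
    show "?a = mc ?\<chi> v" using mc_cong[of v ?\<chi> \<phi>] \<chi>v by simp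
    show "fan ?\<chi> v xs"
    proof (rule fan_cong[OF fan])
      show "?\<chi> {v, w} = \<phi> {v, w}" if "w \<in> set xs" for w using \<chi>v[OF xsE(1)[OF that]] .
      fix i assume i: "Suc i < length xs"
      then have "xs ! i \<noteq> y" using xs(2,3) y_def by (simp add: last_conv_nth nth_eq_iff_index_eq)
      then show "mc ?\<chi> (xs ! i) = mc \<phi> (xs ! i)" using \<chi>x(1) i by simp
    qed
    show "mc ?\<chi> x \<noteq> \<omega> \<and> mc ?\<chi> x \<noteq> ?a" if "x \<in> set xs" "x \<noteq> y" for x
      using \<chi>x[OF that] by simp
    show "?\<chi> {v, u} = \<omega>" using \<chi>v[OF vu] C_uv(2)[OF C] by simp
    show "swap_closed E ?\<chi> \<omega> ?a ?K"
    proof (rule swap_closedI)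
      show "?K \<subseteq> bicoloured_edges E ?\<chi> \<omega> ?a"
      proof
        fix e assume "e \<in> ?K"
        then consider "e = {y, ?q}" | "e \<in> K" by blast
        then show "e \<in> bicoloured_edges E ?\<chi> \<omega> ?a"
        proof cases
          case 1
          then show ?thesis using yq \<chi>q unfolding bicoloured_edges_def by simp
        next
          case 2
          then have "e \<in> bicoloured_edges E ?\<psi> \<omega> ?a" using KB bic by blast
          then show ?thesis using \<chi>K[OF 2] unfolding bicoloured_edges_def by simp
        qed
      qed
      fix e z w assume h: "e \<in> ?K" "z \<in> e" "{z, w} \<in> E" "?\<chi> {z, w} = \<omega> \<or> ?\<chi> {z, w} = ?a"
      show "{z, w} \<in> ?K"
      proof (cases "y \<in> {z, w}")
        case True
        then obtain w' where w': "{z, w} = {y, w'}" by blast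
        then have "{z, w} = {y, ?q}" using at_y[of w'] h(3,4) by simp
        then show ?thesis by simp
      next
        case False
        then have "{z, w} \<noteq> {y, w'}" for w' by blast
        then have "?\<chi> {z, w} = ?\<psi> {z, w}" by (intro \<chi>_out) blast
        then have "{z, w} \<in> bicoloured_edges E ?\<psi> \<omega> ?a"
          using h(3,4) unfolding bicoloured_edges_def by simp
        then have B: "{z, w} \<in> bicoloured_edges E \<phi> \<omega> ?a" using bic by simp
        have "conn \<phi> \<omega> ?a ?q z"
        proof (cases "e \<in> K")
          case True
          then show ?thesis using K_conn h(2) by blast
        next
          case e: False
          then have "z = ?q" using h(1,2) False by blast
          then show ?thesis by simp
        qed
        then show ?thesis using K_int[OF B, of z] by simp
      qed
    qed
    show "v \<notin> e" if "e \<in> ?K" for e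
    proof
      assume "v \<in> e"
      then show False using that K_conn[of e v] nv q_ne_v y_ne_v by auto
    qed
    show "{y, w} \<in> ?K" if "{y, w} \<in> E" "?\<chi> {y, w} = \<omega> \<or> ?\<chi> {y, w} = ?a" for w
      using at_y[OF that] by simp
    show "kempe_swap \<omega> ?a ?K ?\<chi> e = \<omega> \<longleftrightarrow> \<phi>0 e = \<omega>" if e: "e \<in> E" for e
    proof (cases "y \<in> e")
      case True
      then obtain w where w: "e = {y, w}" using edge_at[OF e] by blast
      have "\<phi>0 e \<noteq> \<omega>" using mc_edge[OF col0, of y w] e w y0 by simp
      moreover have "kempe_swap \<omega> ?a ?K ?\<chi> e \<noteq> \<omega>"
      proof (cases "e = {y, ?q}")
        case True
        then show ?thesis using \<chi>q a\<omega> unfolding kempe_swap_def by simp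
      next
        case False
        then have "?\<chi> e \<noteq> \<omega>" using at_y[of w] e w by blast
        moreover have "e \<notin> ?K" using False K_conn[of e y] ny True by blast
        ultimately show ?thesis unfolding kempe_swap_def by simp
      qed
      ultimately show ?thesis by simp
    next
      case False
      then have ne: "e \<noteq> {y, w}" for w by blast
      then have eq: "?\<chi> e = ?\<psi> e" by (intro \<chi>_out)
      have "kempe_swap \<omega> ?a ?K ?\<chi> e = kempe_swap \<omega> ?a K ?\<psi> e"
        using eq ne[of ?q] unfolding kempe_swap_def by simp
      also have "\<dots> = \<phi> e" unfolding \<psi>K kempe_swap_involutory ..
      finally show ?thesis using C_class[OF C e] by simp
    qed
  qed (use xs y_def sh y_ne_u a\<omega> in auto)
qed

end

end

section \<open>Perfect matchings as colour classes\<close>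

context regular_triangle_free
begin

text \<open>The condition of \<open>irremovable\<close> follows from \<open>no_win\<close>: deleting
  \<open>uv\<close> from the class would free both \<open>t\<close> and \<open>u\<close>, and
  recolouring \<open>tu\<close> would be the forbidden exchange.\<close>

lemma unexchangeableI:
  assumes c: "col \<phi>" and uv: "{u, v} \<in> E" "\<phi> {u, v} = \<omega>" and tu: "{t, u} \<in> E" and t: "mc \<phi> t = \<omega>"
    and no_win: "\<And>\<psi>. col \<psi> \<Longrightarrow> eqv \<phi> \<psi> \<Longrightarrow>
      (\<And>e. e \<in> E \<Longrightarrow> \<phi> e = \<omega> \<Longrightarrow> e \<noteq> {u, v} \<Longrightarrow> \<psi> e = \<omega>) \<Longrightarrow> \<psi> {t, u} \<noteq> \<omega>"
  shows "unexchangeable V E D \<phi> \<omega> u v t"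
proof (unfold_locales)
  show "t \<noteq> v" using mc_edge'[OF c uv(1)] uv(2) t by auto
  fix \<psi> assume \<psi>: "col \<psi>" "eqv \<phi> \<psi>"
  show "\<exists>e\<in>E. \<not> (\<psi> e = \<omega> \<longleftrightarrow> \<phi> e = \<omega> \<and> e \<noteq> {u, v})"
  proof (rule ccontr)
    assume "\<not> ?thesis"
    then have cl: "\<psi> e = \<omega> \<longleftrightarrow> \<phi> e = \<omega> \<and> e \<noteq> {u, v}" if "e \<in> E" for e using that by blast
    have \<omega>r: "\<omega> \<in> {1..Suc D}" using edge_colouring_range[OF c uv(1)] uv(2) by simp
    have V: "t \<in> V" "u \<in> V" using edgeD[OF tu] by auto
    have mt: "mc \<psi> t = \<omega>"
    proof (rule mcI[OF \<psi>(1) V(1) \<omega>r])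
      fix y assume y: "{t, y} \<in> E"
      show "\<psi> {t, y} \<noteq> \<omega>" using cl[OF y] mc_edge[OF c y] t by simp
    qed
    have mu: "mc \<psi> u = \<omega>"
    proof (rule mcI[OF \<psi>(1) V(2) \<omega>r])
      fix y assume y: "{u, y} \<in> E"
      show "\<psi> {u, y} \<noteq> \<omega>"
      proof
        assume "\<psi> {u, y} = \<omega>"
        then have h: "\<phi> {u, y} = \<omega>" "{u, y} \<noteq> {u, v}" using cl[OF y] by blast+
        then have "y = v" using nbr_unique[OF c y uv(1)] uv(2) by simp
        then show False using h(2) by simp
      qed
    qed
    note r = recolour[OF \<psi>(1) tu mt mu]
    have "(\<psi>({t, u} := \<omega>)) e = \<omega>" if "e \<in> E" "\<phi> e = \<omega>" "e \<noteq> {u, v}" for e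
      using cl[OF that(1)] that(2,3) by simp
    then have "(\<psi>({t, u} := \<omega>)) {t, u} \<noteq> \<omega>"
      by (rule no_win[OF r(1) equiv_trans[OF \<psi>(2) r(2)]])
    then show False by simp
  qed
qed (rule c uv tu t no_win; assumption)+

section \<open>Maximising the overlap with a perfect matching\<close>

context
  fixes M \<omega>
  assumes ME: "M \<subseteq> E" and M_ex: "\<And>x. x \<in> V \<Longrightarrow> \<exists>y. {x, y} \<in> M"
    and M_unique: "\<And>x y z. {x, y} \<in> M \<Longrightarrow> {x, z} \<in> M \<Longrightarrow> y = z"
    and \<omega>r: "\<omega> \<in> {1..Suc D}"
begin

text \<open>A lexicographic order as one number: a class has at most \<open>card E\<close> edges, so
  the factor \<open>Suc (card E)\<close> lets one more edge of \<open>M\<close> outweigh any loss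
  elsewhere.\<close>

definition score :: "('a set \<Rightarrow> nat) \<Rightarrow> nat" where
  "score \<phi> = Suc (card E) * card {e \<in> M. \<phi> e = \<omega>} + card {e \<in> E. \<phi> e = \<omega>}"

lemma score_win:
  assumes "\<And>e. e \<in> M \<Longrightarrow> \<phi> e = \<omega> \<Longrightarrow> \<psi> e = \<omega>" "e \<in> M" "\<psi> e = \<omega>" "\<phi> e \<noteq> \<omega>"
  shows "score \<phi> < score \<psi>"
proof -
  have "{e \<in> M. \<phi> e = \<omega>} \<subset> {e \<in> M. \<psi> e = \<omega>}" using assms by blast
  then have "card {e \<in> M. \<phi> e = \<omega>} < card {e \<in> M. \<psi> e = \<omega>}"
    using finite_subset[OF ME finE] by (intro psubset_card_mono) auto
  then have "Suc (card E) * Suc (card {e \<in> M. \<phi> e = \<omega>}) \<le> Suc (card E) * card {e \<in> M. \<psi> e = \<omega>}"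
    by (intro mult_le_mono2) simp
  moreover have "card {e \<in> E. \<phi> e = \<omega>} \<le> card E" using finE by (intro card_mono) auto
  ultimately show ?thesis unfolding score_def by simp
qed

lemma score_grow:
  assumes "\<And>e. e \<in> E \<Longrightarrow> \<phi> e = \<omega> \<Longrightarrow> \<psi> e = \<omega>" "e \<in> E" "\<psi> e = \<omega>" "\<phi> e \<noteq> \<omega>"
  shows "score \<phi> < score \<psi>"
proof -
  have "{e \<in> E. \<phi> e = \<omega>} \<subset> {e \<in> E. \<psi> e = \<omega>}" using assms by blast
  then have "card {e \<in> E. \<phi> e = \<omega>} < card {e \<in> E. \<psi> e = \<omega>}"
    using finE by (intro psubset_card_mono) auto
  moreover have "card {e \<in> M. \<phi> e = \<omega>} \<le> card {e \<in> M. \<psi> e = \<omega>}"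
    using assms(1) ME finite_subset[OF ME finE] by (intro card_mono) auto
  ultimately show ?thesis unfolding score_def
    using mult_le_mono2[of "card {e \<in> M. \<phi> e = \<omega>}" "card {e \<in> M. \<psi> e = \<omega>}" "Suc (card E)"] by linarith
qed

lemma maximal_contains:
  assumes c: "col \<phi>" and max: "\<And>\<psi>. col \<psi> \<Longrightarrow> eqv \<phi> \<psi> \<Longrightarrow> score \<psi> \<le> score \<phi>" and e: "e \<in> M"
  shows "\<phi> e = \<omega>"
proof -
  have indep: "mc \<phi> y \<noteq> \<omega>" if xy: "{x, y} \<in> E" and x: "mc \<phi> x = \<omega>" for x y
  proof
    assume y: "mc \<phi> y = \<omega>"
    note r = recolour[OF c xy x y]
    have "score \<phi> < score (\<phi>({x, y} := \<omega>))"
      by (rule score_grow[OF _ xy]) (use mc_edge[OF c xy] x in auto)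
    then show False using max[OF r(1,2)] by simp
  qed
  have \<omega>_edge: "\<exists>y. {x, y} \<in> E \<and> \<phi> {x, y} = \<omega>" if "x \<in> V" "mc \<phi> x \<noteq> \<omega>" for x
    using nbr_ex[OF c that(1) \<omega>r that(2)[symmetric]] by blast
  have no_free: "mc \<phi> t \<noteq> \<omega>" if tV: "t \<in> V" for t
  proof
    assume t: "mc \<phi> t = \<omega>"
    obtain u where tu: "{t, u} \<in> M" using M_ex[OF tV] by blast
    then have tuE: "{t, u} \<in> E" using ME by blast
    have uV: "u \<in> V" using edgeD[OF tuE] by simp
    obtain v where v: "{u, v} \<in> E" "\<phi> {u, v} = \<omega>" using \<omega>_edge[OF uV indep[OF tuE t]] by blast
    have tv: "t \<noteq> v" using mc_edge'[OF c v(1)] v(2) t by auto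
    have uvM: "{u, v} \<notin> M"
    proof
      assume "{u, v} \<in> M"
      moreover have "{u, t} \<in> M" using tu by (simp add: insert_commute)
      ultimately show False using M_unique tv by blast
    qed
    have "unexchangeable V E D \<phi> \<omega> u v t"
    proof (rule unexchangeableI[OF c v tuE t])
      fix \<psi> assume \<psi>: "col \<psi>" "eqv \<phi> \<psi>" and N: "\<And>e. e \<in> E \<Longrightarrow> \<phi> e = \<omega> \<Longrightarrow> e \<noteq> {u, v} \<Longrightarrow> \<psi> e = \<omega>"
      show "\<psi> {t, u} \<noteq> \<omega>"
      proof
        assume a: "\<psi> {t, u} = \<omega>"
        have N': "\<psi> e = \<omega>" if "e \<in> M" "\<phi> e = \<omega>" for e using N[of e] that ME uvM by blast
        have "\<phi> {t, u} \<noteq> \<omega>" using mc_edge[OF c tuE] t by simp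
        then have "score \<phi> < score \<psi>" using score_win[of \<phi> \<psi>, OF N' tu a] by blast
        then show False using max[OF \<psi>] by simp
      qed
    qed
    then interpret unexchangeable V E D \<phi> \<omega> u v t .
    show False by (rule independent_free_contradiction) (rule indep)
  qed
  show ?thesis
  proof (rule ccontr)
    assume ne: "\<phi> e \<noteq> \<omega>"
    have "e \<in> E" using e ME by blast
    then obtain t u where etu: "e = {t, u}" and V: "t \<in> V" "u \<in> V" by (rule edgeE)
    have tuE: "{t, u} \<in> E" and tuM: "{t, u} \<in> M" and ne': "\<phi> {t, u} \<noteq> \<omega>"
      using e ME ne unfolding etu by auto
    have utM: "{u, t} \<in> M" using tuM by (simp add: insert_commute)
    obtain y where y: "{t, y} \<in> E" "\<phi> {t, y} = \<omega>" using \<omega>_edge[OF V(1) no_free[OF V(1)]] by blast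
    obtain v where v: "{u, v} \<in> E" "\<phi> {u, v} = \<omega>" using \<omega>_edge[OF V(2) no_free[OF V(2)]] by blast
    have yu: "y \<noteq> u" using y(2) ne' by blast
    have tv: "t \<noteq> v" using v(2) ne' by (auto simp: insert_commute)
    have tyM: "{t, y} \<notin> M" using M_unique[OF tuM, of y] yu by blast
    have uvM: "{u, v} \<notin> M" using M_unique[OF utM, of v] tv by blast
    have uv_ty: "{u, v} \<noteq> {t, y}"
      using yu edgeD[OF tuE] by (auto simp: doubleton_eq_iff)
    \<comment> \<open>If \<open>ty\<close> could not be removed, \<open>fan_to_free\<close> would
      give a free vertex adjacent to \<open>y\<close>, but there is none.\<close>
    have "\<exists>\<psi>. col \<psi> \<and> eqv \<phi> \<psi> \<and> (\<forall>e\<in>E. \<psi> e = \<omega> \<longleftrightarrow> \<phi> e = \<omega> \<and> e \<noteq> {t, y})"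
    proof (rule ccontr)
      assume no: "\<not> ?thesis"
      interpret irremovable V E D \<phi> \<omega> t y
        by unfold_locales (rule c y; assumption | use no in blast)+
      obtain xs where xs: "fan \<phi> y xs" "xs \<noteq> []" "mc \<phi> (last xs) = \<omega>" using fan_to_free[OF C0] by blast
      have "{y, last xs} \<in> E" using xs(1) last_in_set[OF xs(2)] unfolding fan_def by blast
      then show False using no_free[of "last xs"] xs(3) edgeD by blast
    qed
    then obtain \<psi> where \<psi>: "col \<psi>" "eqv \<phi> \<psi>"
      and cl: "\<And>e. e \<in> E \<Longrightarrow> \<psi> e = \<omega> \<longleftrightarrow> \<phi> e = \<omega> \<and> e \<noteq> {t, y}" by blast
    have t: "mc \<psi> t = \<omega>"
    proof (rule mcI[OF \<psi>(1) V(1) \<omega>r])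
      fix z assume z: "{t, z} \<in> E"
      show "\<psi> {t, z} \<noteq> \<omega>"
      proof
        assume "\<psi> {t, z} = \<omega>"
        then have h: "\<phi> {t, z} = \<omega>" "{t, z} \<noteq> {t, y}" using cl[OF z] by blast+
        then have "z = y" using nbr_unique[OF c z y(1)] y(2) by simp
        then show False using h(2) by simp
      qed
    qed
    have only: "z = t \<or> z = y" if zV: "z \<in> V" and z: "mc \<psi> z = \<omega>" for z
    proof -
      obtain w where w: "{z, w} \<in> E" "\<phi> {z, w} = \<omega>" using \<omega>_edge[OF zV no_free[OF zV]] by blast
      have "\<psi> {z, w} \<noteq> \<omega>" using mc_edge[OF \<psi>(1) w(1)] z by simp
      then have "{z, w} = {t, y}" using cl[OF w(1)] w(2) by blast
      then show ?thesis by (auto simp: doubleton_eq_iff)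
    qed
    have uv\<psi>: "\<psi> {u, v} = \<omega>" using cl[OF v(1)] v(2) uv_ty by blast
    have "unexchangeable V E D \<psi> \<omega> u v t"
    proof (rule unexchangeableI[OF \<psi>(1) v(1) uv\<psi> tuE t])
      fix \<chi> assume \<chi>: "col \<chi>" "eqv \<psi> \<chi>" and N: "\<And>e. e \<in> E \<Longrightarrow> \<psi> e = \<omega> \<Longrightarrow> e \<noteq> {u, v} \<Longrightarrow> \<chi> e = \<omega>"
      show "\<chi> {t, u} \<noteq> \<omega>"
      proof
        assume a: "\<chi> {t, u} = \<omega>"
        \<comment> \<open>The score is compared with that of \<open>\<phi>\<close>, not
          \<open>\<psi>\<close>; the lost edge \<open>ty\<close> is outside \<open>M\<close>, so the
          overlap does not suffer.\<close>
        have N': "\<chi> e = \<omega>" if h: "e \<in> M" "\<phi> e = \<omega>" for e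
        proof -
          have "e \<in> E" "e \<noteq> {t, y}" "e \<noteq> {u, v}" using h(1) ME tyM uvM by auto
          then show ?thesis using N[of e] cl[of e] h(2) by blast
        qed
        have "score \<phi> < score \<chi>" using score_win[of \<phi> \<chi>, OF N' tuM a ne'] by blast
        then show False using max[OF \<chi>(1) equiv_trans[OF \<psi>(2) \<chi>(2)]] by simp
      qed
    qed
    then interpret unexchangeable V E D \<psi> \<omega> u v t .
    show False by (rule two_free_contradiction[OF y(1)]) (rule only)
  qed
qed

lemma equiv_class_matching:
  assumes c: "col \<phi>"
  obtains \<psi> where "col \<psi>" "eqv \<phi> \<psi>" "\<And>e. e \<in> E \<Longrightarrow> \<psi> e = \<omega> \<longleftrightarrow> e \<in> M"
proof -
  define P where "P \<psi> \<longleftrightarrow> col \<psi> \<and> eqv \<phi> \<psi>" for \<psi>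
  have "score \<psi> < Suc (Suc (card E) * card E + card E)" for \<psi>
  proof -
    have "card {e \<in> M. \<psi> e = \<omega>} \<le> card E" "card {e \<in> E. \<psi> e = \<omega>} \<le> card E"
      using finE ME by (auto intro!: card_mono)
    then have "Suc (card E) * card {e \<in> M. \<psi> e = \<omega>} + card {e \<in> E. \<psi> e = \<omega>} \<le> Suc (card E) * card E + card E"
      by (intro add_mono mult_le_mono2)
    then show ?thesis unfolding score_def by linarith
  qed
  moreover have "P \<phi>" unfolding P_def using c by simp
  ultimately obtain \<psi> where P: "P \<psi>" and max: "\<And>\<chi>. P \<chi> \<Longrightarrow> score \<chi> \<le> score \<psi>"
    using ex_has_greatest_nat_lemma[of P \<phi> score] ex_has_greatest_nat[of P \<phi> score] by blast
  have \<psi>: "col \<psi>" "eqv \<phi> \<psi>" using P unfolding P_def by blast+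
  have max': "score \<chi> \<le> score \<psi>" if "col \<chi>" "eqv \<psi> \<chi>" for \<chi>
    using max[of \<chi>] that(1) equiv_trans[OF \<psi>(2) that(2)] unfolding P_def by blast
  have sub: "\<psi> e = \<omega>" if "e \<in> M" for e using maximal_contains[OF \<psi>(1) max' that] by blast
  \<comment> \<open>A class containing a perfect matching equals it, as a further edge would touch a
    matching edge of the same colour.\<close>
  have "e \<in> M" if e: "e \<in> E" "\<psi> e = \<omega>" for e
  proof -
    obtain x y where xy: "e = {x, y}" "x \<in> V" using edgeE[OF e(1)] by blast
    obtain z where z: "{x, z} \<in> M" using M_ex[OF xy(2)] by blast
    then have "{x, z} \<in> E" "\<psi> {x, z} = \<psi> e" using ME sub e(2) by auto
    then have "{x, z} = e" using edge_colouring_proper[OF \<psi>(1) _ e(1), of "{x, z}" x] xy(1) by simp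
    then show ?thesis using z by simp
  qed
  then show ?thesis using that[OF \<psi>] sub by blast
qed

end

end

section \<open>Induction on the degree by removing a perfect matching\<close>

lemma lift_kempe_equivalent:
  assumes "kempe_equivalent E k \<phi> \<psi>" and M: "E \<inter> M = {}"
  shows "kempe_equivalent (E \<union> M) (Suc k) (\<lambda>e. if e \<in> M then Suc k else \<phi> e) (\<lambda>e. if e \<in> M then Suc k else \<psi> e)"
  using assms(1) unfolding kempe_equivalent_def
proof (induction rule: rtranclp_induct)
  case base
  show ?case by simp
next
  case (step \<psi> \<chi>)
  let ?lift = "\<lambda>\<phi> e. if e \<in> M then Suc k else \<phi> e"
  obtain c d K where cd: "c \<in> {1..k}" "d \<in> {1..k}" "c \<noteq> d" and K: "kempe_chain E \<psi> c d K"
    and \<chi>: "\<chi> = kempe_swap c d K \<psi>" using step.hyps(2) unfolding kempe_change_def by blast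
  \<comment> \<open>The colour \<open>Suc k\<close> of \<open>M\<close> is neither \<open>c\<close>
    nor \<open>d\<close>, so the bicoloured subgraph is the same as before.\<close>
  have "bicoloured_edges (E \<union> M) (?lift \<psi>) c d = bicoloured_edges E \<psi> c d"
    unfolding bicoloured_edges_def using cd M by auto
  then have "kempe_chain (E \<union> M) (?lift \<psi>) c d K" using K unfolding kempe_chain_def by simp
  moreover have "?lift \<chi> = kempe_swap c d K (?lift \<psi>)"
  proof
    fix e
    have "K \<subseteq> E" using K unfolding kempe_chain_def bicoloured_edges_def by blast
    then show "?lift \<chi> e = kempe_swap c d K (?lift \<psi>) e" unfolding \<chi> kempe_swap_def using M by auto
  qed
  moreover have "c \<in> {1..Suc k}" "d \<in> {1..Suc k}" using cd by auto
  ultimately have "kempe_change (E \<union> M) (Suc k) (?lift \<psi>) (?lift \<chi>)"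
    unfolding kempe_change_def using cd(3) by blast
  then show ?case by (rule rtranclp.rtrancl_into_rtrancl[OF step.IH])
qed

text \<open>With \<open>D\<close> colours and \<open>D\<close> edges at a vertex, every colour
  occurs there, so every class is a perfect matching.\<close>

lemma (in regular_triangle_free) class_perfect:
  assumes h: "edge_colouring E D h" and c: "c \<in> {1..D}" and x: "x \<in> V"
  shows "\<exists>!y. {x, y} \<in> E \<and> h {x, y} = c"
proof -
  have "restrict h E = h"
    using edge_colouring_undefined[OF h] by (intro ext) (simp add: restrict_def)
  moreover have "edge_colouring E (Suc D) (restrict h E)"
  proof (rule edge_colouring_restrict[OF h order_refl])
    fix e assume "e \<in> E"
    then show "h e \<in> {1..Suc D}" using edge_colouring_range[OF h] by fastforce
  qed
  ultimately have h': "edge_colouring E (Suc D) h" by simp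
  let ?S = "{e \<in> E. x \<in> e}"
  have inj: "inj_on h ?S" by (rule inj_on_edges_at[OF h])
  have "h ` ?S \<subseteq> {1..D}" using edge_colouring_range[OF h] by blast
  then have "h ` ?S = {1..D}"
    using card_image[OF inj] reg[OF x] by (intro card_subset_eq) simp_all
  then have "c \<in> h ` ?S" using c by simp
  then obtain e where e: "e \<in> E" "x \<in> e" "h e = c" by blast
  obtain y where y: "e = {x, y}" using edge_at[OF e(1,2)] by blast
  show ?thesis
  proof (rule ex1I[of _ y])
    show "{x, y} \<in> E \<and> h {x, y} = c" using e unfolding y by simp
    fix z assume "{x, z} \<in> E \<and> h {x, z} = c"
    then show "z = y" using nbr_unique[OF h', of x z y] e unfolding y by simp
  qed
qed

lemma regular_equivalent:
  assumes "regular_triangle_free V E D" "edge_colouring E D h" "edge_colouring E (Suc D) f" "edge_colouring E (Suc D) g"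
  shows "kempe_equivalent E (Suc D) f g"
  using assms
proof (induction D arbitrary: E h f g)
  case 0
  then have "E = {}" using edge_colouring_range[of E 0 h] by auto
  then have "f = g" using 0(3,4) unfolding edge_colouring_def by simp
  then show ?case unfolding kempe_equivalent_def by simp
next
  case (Suc D)
  interpret regular_triangle_free V E "Suc D" using Suc.prems(1) .
  let ?\<omega> = "Suc (Suc D)"
  \<comment> \<open>The target is a class of \<open>h\<close>, not of \<open>f\<close> or
    \<open>g\<close>: the remaining graph inherits a \<open>D\<close>-edge-colouring, and both
    colourings are led to the same class.\<close>
  define M where "M = {e \<in> E. h e = Suc D}"
  define F where "F = E - M"
  have ME: "M \<subseteq> E" and EF: "E = F \<union> M" and FM: "F \<inter> M = {}" unfolding M_def F_def by blast+
  have M1: "\<exists>!y. {x, y} \<in> M" if "x \<in> V" for x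
    using class_perfect[OF Suc.prems(2) _ that, of "Suc D"] unfolding M_def by simp
  have M_ex: "\<exists>y. {x, y} \<in> M" if "x \<in> V" for x using M1[OF that] by blast
  have M_unique: "y = z" if h: "{x, y} \<in> M" "{x, z} \<in> M" for x y z
  proof -
    have "x \<in> V" using h(1) ME edgeD by blast
    then show ?thesis using M1 h by blast
  qed
  have F: "regular_triangle_free V F D"
  proof
    show "finite_simple_graph V F"
      using graph unfolding finite_simple_graph_def F_def by blast
    show "triangle_free F" using tf unfolding triangle_free_def F_def by blast
    fix x assume x: "x \<in> V"
    obtain y where y: "{x, y} \<in> M" using M_ex[OF x] by blast
    have "{e \<in> F. x \<in> e} = {e \<in> E. x \<in> e} - {{x, y}}"
    proof (rule set_eqI)
      fix e
      have "e = {x, y}" if e: "e \<in> M" "x \<in> e"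
      proof -
        have "e \<in> E" using e(1) ME by blast
        then obtain z where z: "e = {x, z}" using edge_at e(2) by blast
        then show ?thesis using M_unique[OF y, of z] e(1) by simp
      qed
      then show "e \<in> {e \<in> F. x \<in> e} \<longleftrightarrow> e \<in> {e \<in> E. x \<in> e} - {{x, y}}"
        using y unfolding F_def by auto
    qed
    moreover have "{x, y} \<in> {e \<in> E. x \<in> e}" using y ME by auto
    ultimately show "card {e \<in> F. x \<in> e} = D" using reg[OF x] finE by simp
  qed
  have hF: "edge_colouring F D (restrict h F)"
  proof -
    have "h e \<in> {1..D}" if "e \<in> F" for e
    proof -
      have "e \<in> E" "h e \<noteq> Suc D" using that unfolding F_def M_def by auto
      then show ?thesis using edge_colouring_range[OF Suc.prems(2), of e] by simp
    qed
    then show ?thesis using edge_colouring_restrict[OF Suc.prems(2)] unfolding F_def by blast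
  qed
  have reduce: "\<exists>\<psi>. edge_colouring F (Suc D) \<psi> \<and> kempe_equivalent E ?\<omega> \<phi> (\<lambda>e. if e \<in> M then ?\<omega> else \<psi> e)"
    if c: "col \<phi>" for \<phi>
  proof -
    obtain \<psi> where \<psi>: "col \<psi>" "eqv \<phi> \<psi>" and cl: "\<And>e. e \<in> E \<Longrightarrow> \<psi> e = ?\<omega> \<longleftrightarrow> e \<in> M"
      by (rule equiv_class_matching[OF ME _ _ _ c, of ?\<omega>]) (use M_ex M_unique in auto)
    have "\<psi> e \<in> {1..Suc D}" if "e \<in> F" for e
    proof -
      have e: "e \<in> E" "e \<notin> M" using that unfolding F_def by auto
      have "\<psi> e \<in> {1..?\<omega>}" using edge_colouring_range[OF \<psi>(1) e(1)] .
      moreover have "\<psi> e \<noteq> ?\<omega>" using cl[OF e(1)] e(2) by blast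
      ultimately show ?thesis by auto
    qed
    then have "edge_colouring F (Suc D) (restrict \<psi> F)"
      using edge_colouring_restrict[OF \<psi>(1)] unfolding F_def by blast
    moreover have "(\<lambda>e. if e \<in> M then ?\<omega> else restrict \<psi> F e) = \<psi>"
    proof
      fix e
      show "(if e \<in> M then ?\<omega> else restrict \<psi> F e) = \<psi> e"
      proof (cases "e \<in> E")
        case True
        then show ?thesis using cl[OF True] unfolding F_def by (cases "e \<in> M") simp_all
      next
        case False
        then have "e \<notin> M" "e \<notin> F" using ME unfolding F_def by blast+
        then show ?thesis using edge_colouring_undefined[OF \<psi>(1) False] by simp
      qed
    qed
    ultimately show ?thesis using \<psi>(2) by (intro exI[of _ "restrict \<psi> F"]) simp
  qed
  obtain f' g' where f': "edge_colouring F (Suc D) f'" "kempe_equivalent E ?\<omega> f (\<lambda>e. if e \<in> M then ?\<omega> else f' e)"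
    and g': "edge_colouring F (Suc D) g'" "kempe_equivalent E ?\<omega> g (\<lambda>e. if e \<in> M then ?\<omega> else g' e)"
    using reduce[OF Suc.prems(3)] reduce[OF Suc.prems(4)] by blast
  have "kempe_equivalent F (Suc D) f' g'" using Suc.IH[OF F hF f'(1) g'(1)] .
  then have "kempe_equivalent E ?\<omega> (\<lambda>e. if e \<in> M then ?\<omega> else f' e) (\<lambda>e. if e \<in> M then ?\<omega> else g' e)"
    using lift_kempe_equivalent[OF _ FM] unfolding EF[symmetric] by simp
  then show ?case by (rule equiv_trans[OF equiv_trans[OF f'(2)] equiv_sym[OF g'(2)]])
qed

section \<open>Embedding into a regular graph\<close>

text \<open>Touching edges have touching images, so the preimage of a Kempe chain is
  \<open>swap_closed\<close>: one change in the large graph becomes several, or none, in the small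
  one.\<close>

lemma restrict_kempe_equivalent:
  assumes H: "simple_graph V' E'" and G: "simple_graph V E" and equiv: "kempe_equivalent E' k \<phi> \<psi>"
    and \<iota>: "\<And>e. e \<in> E \<Longrightarrow> \<iota> e \<in> E'" "\<And>e e'. e \<inter> e' \<noteq> {} \<Longrightarrow> \<iota> e \<inter> \<iota> e' \<noteq> {}"
  shows "kempe_equivalent E k (\<lambda>e\<in>E. \<phi> (\<iota> e)) (\<lambda>e\<in>E. \<psi> (\<iota> e))"
  using equiv unfolding kempe_equivalent_def
proof (induction rule: rtranclp_induct)
  case base
  show ?case by simp
next
  case (step \<psi> \<chi>)
  interpret H: simple_graph V' E' by (rule H)
  interpret G: simple_graph V E by (rule G)
  let ?\<psi> = "\<lambda>e\<in>E. \<psi> (\<iota> e)"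
  obtain c d K where cd: "c \<in> {1..k}" "d \<in> {1..k}" "c \<noteq> d" and K: "kempe_chain E' \<psi> c d K"
    and \<chi>: "\<chi> = kempe_swap c d K \<psi>" using step.hyps(2) unfolding kempe_change_def by blast
  have KB: "K \<subseteq> bicoloured_edges E' \<psi> c d"
    and Kcl: "\<And>e e'. e \<in> K \<Longrightarrow> e' \<in> bicoloured_edges E' \<psi> c d \<Longrightarrow> e \<inter> e' \<noteq> {} \<Longrightarrow> e' \<in> K"
    using H.kempe_chain_swap_closed[OF K] unfolding swap_closed_def by blast+
  let ?L = "{e \<in> E. \<iota> e \<in> K}"
  have B: "e \<in> bicoloured_edges E ?\<psi> c d \<longleftrightarrow> e \<in> E \<and> \<iota> e \<in> bicoloured_edges E' \<psi> c d" for e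
    unfolding bicoloured_edges_def using \<iota>(1) by auto
  have "swap_closed E ?\<psi> c d ?L"
    unfolding swap_closed_def
  proof (intro conjI ballI impI subsetI)
    fix e assume "e \<in> ?L"
    then show "e \<in> bicoloured_edges E ?\<psi> c d" unfolding B using KB by blast
  next
    fix e e' assume h: "e \<in> ?L" "e' \<in> bicoloured_edges E ?\<psi> c d" "e \<inter> e' \<noteq> {}"
    have "\<iota> e' \<in> K" using Kcl[of "\<iota> e" "\<iota> e'"] h(1) h(2)[unfolded B] \<iota>(2)[OF h(3)] by blast
    then show "e' \<in> ?L" using h(2)[unfolded B] by blast
  qed
  then have "kempe_equivalent E k ?\<psi> (kempe_swap c d ?L ?\<psi>)" using G.swap_closed_equiv cd by blast
  moreover have "kempe_swap c d ?L ?\<psi> = (\<lambda>e\<in>E. \<chi> (\<iota> e))"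
    unfolding \<chi> kempe_swap_def by (rule ext) auto
  ultimately have "(kempe_change E k)\<^sup>*\<^sup>* ?\<psi> (\<lambda>e\<in>E. \<chi> (\<iota> e))" unfolding kempe_equivalent_def by simp
  then show ?case by (rule rtranclp_trans[OF step.IH])
qed

text \<open>Cube vertices are sets of directions; the symmetric difference with \<open>{j}\<close>
  is the neighbour in direction \<open>j\<close>.\<close>

definition flip :: "nat \<Rightarrow> nat set \<Rightarrow> nat set" where
  "flip j q = (if j \<in> q then q - {j} else insert j q)"

lemma flip_mem: "i \<in> flip j q \<longleftrightarrow> (i \<in> q \<longleftrightarrow> i \<noteq> j)"
  unfolding flip_def by auto

lemma flip_flip: "flip j (flip j q) = q"
  by (rule set_eqI) (auto simp: flip_mem)

lemma flip_eq_iff: "flip i q = flip j q \<longleftrightarrow> i = j"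
  using flip_mem[of i i q] flip_mem[of i j q] by auto

lemma flip_ne: "flip j q \<noteq> q"
  using flip_mem[of j j q] by auto

lemma even_flip: "finite q \<Longrightarrow> even (card (flip j q)) \<longleftrightarrow> odd (card q)"
  unfolding flip_def by (auto simp: card_Diff_singleton card_gt_0_iff)

lemma flip_diff: "(q \<union> flip j q) - (q \<inter> flip j q) = {j}"
  by (rule set_eqI) (auto simp: flip_mem)

locale class_one = simple_graph +
  fixes d :: nat and \<alpha> :: "'a set \<Rightarrow> nat"
  assumes \<alpha>: "edge_colouring E d \<alpha>" and tf: "triangle_free E"
begin

text \<open>The subtraction is exact, since \<open>\<alpha>\<close> forces every degree to be at
  most \<open>d\<close>.\<close>

definition deficit :: "'a \<Rightarrow> nat" where
  "deficit x = d - card {e \<in> E. x \<in> e}"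

definition VH :: "('a \<times> nat set) set" where
  "VH = V \<times> Pow {..<d}"

definition EH :: "('a \<times> nat set) set set" where
  "EH = {e \<times> {q} | e q. e \<in> E \<and> q \<in> Pow {..<d}} \<union>
    {{x} \<times> {q, flip j q} | x q j. x \<in> V \<and> q \<in> Pow {..<d} \<and> j < deficit x}"

text \<open>The increasing enumeration depends only on the colours at \<open>x\<close>, so all
  copies of \<open>x\<close> make the same choice and both ends of a cube edge agree.\<close>

definition missing :: "nat \<Rightarrow> ('a set \<Rightarrow> nat) \<Rightarrow> 'a \<Rightarrow> nat \<Rightarrow> nat" where
  "missing k \<phi> x j = sorted_list_of_set ({1..k} - \<phi> ` {e \<in> E. x \<in> e}) ! j"

text \<open>An edge \<open>{(x, q), (x, flip j q)}\<close> receives the \<open>j\<close>-th colour missing at \<open>x\<close>; the vertex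
  \<open>x\<close> and the direction \<open>j\<close> are read off the edge.\<close>

definition extend :: "nat \<Rightarrow> ('a set \<Rightarrow> nat) \<Rightarrow> ('a \<times> nat set) set \<Rightarrow> nat" where
  "extend k \<phi> = (\<lambda>e\<in>EH. if fst ` e \<in> E then \<phi> (fst ` e)
     else missing k \<phi> (the_elem (fst ` e)) (the_elem (\<Union>(snd ` e) - \<Inter>(snd ` e))))"

lemma card_colours_at:
  assumes \<phi>: "edge_colouring E k \<phi>"
  shows "\<phi> ` {e \<in> E. x \<in> e} \<subseteq> {1..k}" "card (\<phi> ` {e \<in> E. x \<in> e}) = card {e \<in> E. x \<in> e}"
proof -
  show "\<phi> ` {e \<in> E. x \<in> e} \<subseteq> {1..k}" using edge_colouring_range[OF \<phi>] by blast
  show "card (\<phi> ` {e \<in> E. x \<in> e}) = card {e \<in> E. x \<in> e}" by (rule card_image[OF inj_on_edges_at[OF \<phi>]])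
qed

lemma degree_le: "card {e \<in> E. x \<in> e} \<le> d"
  using card_mono[OF _ card_colours_at(1)[OF \<alpha>, of x]] card_colours_at(2)[OF \<alpha>, of x] by simp

lemma deficit_le: "deficit x \<le> d"
  unfolding deficit_def by simp

lemma missing:
  assumes \<phi>: "edge_colouring E k \<phi>" and k: "d \<le> k" and j: "j < deficit x"
  shows "missing k \<phi> x j \<in> {1..k} - \<phi> ` {e \<in> E. x \<in> e}"
    "i < deficit x \<Longrightarrow> missing k \<phi> x i = missing k \<phi> x j \<Longrightarrow> i = j"
proof -
  let ?A = "{1..k} - \<phi> ` {e \<in> E. x \<in> e}"
  have "card ?A = k - card {e \<in> E. x \<in> e}"
    using card_Diff_subset[OF _ card_colours_at(1)[OF \<phi>, of x]] card_colours_at(2)[OF \<phi>, of x] finE by simp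
  then have len: "i < length (sorted_list_of_set ?A)" if "i < deficit x" for i
    using that k unfolding deficit_def by simp
  show "missing k \<phi> x j \<in> ?A"
    using nth_mem[OF len[OF j]] unfolding missing_def by simp
  assume "i < deficit x" "missing k \<phi> x i = missing k \<phi> x j"
  then show "i = j" using nth_eq_iff_index_eq[OF _ len len[OF j]] unfolding missing_def by simp
qed

lemma EH_cases:
  assumes "e \<in> EH"
  obtains e' q where "e = e' \<times> {q}" "e' \<in> E" "q \<subseteq> {..<d}"
    | x q j where "e = {x} \<times> {q, flip j q}" "x \<in> V" "q \<subseteq> {..<d}" "j < deficit x"
  using assms unfolding EH_def by (elim UnE CollectE exE conjE) simp_all

lemma adjacent_H:
  "{(x, q), (y, r)} \<in> EH \<longleftrightarrow>
     {x, y} \<in> E \<and> q = r \<and> q \<subseteq> {..<d} \<or> x = y \<and> x \<in> V \<and> q \<subseteq> {..<d} \<and> (\<exists>j<deficit x. r = flip j q)"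
  (is "?L \<longleftrightarrow> ?R")
proof
  assume ?L
  then show ?R
  proof (cases rule: EH_cases)
    case (1 e s)
    have "e = fst ` {(x, q), (y, r)}" unfolding 1(1) by force
    then have "e = {x, y}" by simp
    moreover have "(x, q) \<in> e \<times> {s}" "(y, r) \<in> e \<times> {s}" unfolding 1(1)[symmetric] by simp_all
    then have "q = s" "r = s" by simp_all
    ultimately show ?thesis using 1(2,3) by simp
  next
    case (2 z s j)
    have "(x, q) \<in> {z} \<times> {s, flip j s}" "(y, r) \<in> {z} \<times> {s, flip j s}" unfolding 2(1)[symmetric] by simp_all
    then have xy: "x = z" "y = z" by auto
    have "snd ` {(x, q), (y, r)} = {s, flip j s}" unfolding 2(1) by force
    then have "{q, r} = {s, flip j s}" by simp
    then have "q = s \<and> r = flip j s \<or> q = flip j s \<and> r = s" by (auto simp: doubleton_eq_iff)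
    moreover have "flip j s \<subseteq> {..<d}" using 2(3,4) deficit_le[of z] unfolding flip_def by auto
    ultimately have "q \<subseteq> {..<d}" "r = flip j q" using 2(3) flip_flip by auto
    then show ?thesis using xy 2(2,4) by blast
  qed
next
  assume ?R
  then show ?L
  proof (elim disjE conjE exE)
    assume h: "{x, y} \<in> E" "q = r" "q \<subseteq> {..<d}"
    then have "{(x, q), (y, r)} = {x, y} \<times> {q}" by auto
    then show ?L unfolding EH_def using h by blast
  next
    fix j assume h: "x = y" "x \<in> V" "q \<subseteq> {..<d}" "j < deficit x" "r = flip j q"
    then have "{(x, q), (y, r)} = {x} \<times> {q, flip j q}" by auto
    then show ?L unfolding EH_def using h by blast
  qed
qed

lemma graph_H: "finite_simple_graph VH EH"
  unfolding finite_simple_graph_def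
proof (intro conjI subsetI)
  show "finite VH" unfolding VH_def using finV by simp
  fix e assume "e \<in> EH"
  then show "e \<in> [VH]\<^bsup>2\<^esup>"
  proof (cases rule: EH_cases)
    case (1 e' q)
    then obtain x y where xy: "e' = {x, y}" "x \<noteq> y" "x \<in> V" "y \<in> V" using edgeE by blast
    then have "e = {(x, q), (y, q)}" using 1(1) by auto
    then show ?thesis using xy 1(3) unfolding nsets_def VH_def by auto
  next
    case (2 x q j)
    then have "e = {(x, q), (x, flip j q)}" by auto
    moreover have "q \<noteq> flip j q" using flip_ne[of j q] by simp
    moreover have "flip j q \<subseteq> {..<d}" using 2(3,4) deficit_le[of x] unfolding flip_def by auto
    ultimately show ?thesis using 2(2,3) unfolding nsets_def VH_def by auto
  qed
qed

interpretation H: simple_graph VH EH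
  by unfold_locales (rule graph_H)

text \<open>Cube edges change the parity of the second component and copied edges keep it, so a
  triangle has zero or two cube edges. Two would put all three vertices over the same vertex of
  \<open>V\<close>, making the third a cube edge too; zero would project to a triangle in
  \<open>E\<close>.\<close>

lemma triangle_free_H: "triangle_free EH"
  unfolding triangle_free_def
proof
  define P where "P a \<longleftrightarrow> even (card (snd a))" for a :: "'a \<times> nat set"
  have dich: "fst a \<noteq> fst b \<and> {fst a, fst b} \<in> E \<and> P a = P b \<or> fst a = fst b \<and> P a \<noteq> P b"
    if ab: "{a, b} \<in> EH" for a b
  proof -
    obtain x q y r where a: "a = (x, q)" and b: "b = (y, r)" by (cases a, cases b)
    consider "{x, y} \<in> E" "q = r" | j where "x = y" "q \<subseteq> {..<d}" "r = flip j q"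
      using ab unfolding a b adjacent_H by blast
    then show ?thesis
    proof cases
      case 1
      then show ?thesis using edgeD[OF 1(1)] unfolding a b P_def by simp
    next
      case 2
      have "finite q" using finite_subset[OF 2(2)] by simp
      then show ?thesis using 2(1,3) even_flip[of q j] unfolding a b P_def by simp
    qed
  qed
  assume "\<exists>a b c. a \<noteq> b \<and> b \<noteq> c \<and> a \<noteq> c \<and> {a, b} \<in> EH \<and> {b, c} \<in> EH \<and> {a, c} \<in> EH"
  then obtain a b c where "{a, b} \<in> EH" "{b, c} \<in> EH" "{a, c} \<in> EH" by blast
  then have "fst a \<noteq> fst b \<and> {fst a, fst b} \<in> E \<and> P a = P b \<or> fst a = fst b \<and> P a \<noteq> P b"
    "fst b \<noteq> fst c \<and> {fst b, fst c} \<in> E \<and> P b = P c \<or> fst b = fst c \<and> P b \<noteq> P c"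
    "fst a \<noteq> fst c \<and> {fst a, fst c} \<in> E \<and> P a = P c \<or> fst a = fst c \<and> P a \<noteq> P c"
    using dich by blast+
  moreover have "\<not> (fst a \<noteq> fst b \<and> fst b \<noteq> fst c \<and> fst a \<noteq> fst c
      \<and> {fst a, fst b} \<in> E \<and> {fst b, fst c} \<in> E \<and> {fst a, fst c} \<in> E)"
    using tf unfolding triangle_free_def by blast
  ultimately show False by metis
qed

lemma edges_at_H:
  assumes "x \<in> V" "q \<subseteq> {..<d}"
  shows "{e \<in> EH. (x, q) \<in> e} =
    (\<lambda>e. e \<times> {q}) ` {e \<in> E. x \<in> e} \<union> (\<lambda>j. {(x, q), (x, flip j q)}) ` {..<deficit x}"
proof (intro equalityI subsetI)
  fix e assume e: "e \<in> {e \<in> EH. (x, q) \<in> e}"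
  then obtain w where w: "e = {(x, q), w}" using H.edge_at[of e "(x, q)"] by blast
  obtain y r where "w = (y, r)" by (cases w)
  then have eq: "e = {(x, q), (y, r)}" and "{(x, q), (y, r)} \<in> EH" using e w by simp_all
  from this(2) consider "{x, y} \<in> E" "q = r" | j where "x = y" "j < deficit x" "r = flip j q"
    unfolding adjacent_H by blast
  then show "e \<in> (\<lambda>e. e \<times> {q}) ` {e \<in> E. x \<in> e} \<union> (\<lambda>j. {(x, q), (x, flip j q)}) ` {..<deficit x}"
  proof cases
    case 1
    then have "e = {x, y} \<times> {q}" unfolding eq by auto
    then show ?thesis using 1 by blast
  next
    case 2
    then show ?thesis unfolding eq by blast
  qed
next
  fix e assume "e \<in> (\<lambda>e. e \<times> {q}) ` {e \<in> E. x \<in> e} \<union> (\<lambda>j. {(x, q), (x, flip j q)}) ` {..<deficit x}"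
  then consider e' where "e = e' \<times> {q}" "e' \<in> E" "x \<in> e'" | j where "e = {(x, q), (x, flip j q)}" "j < deficit x"
    by blast
  then show "e \<in> {e \<in> EH. (x, q) \<in> e}"
  proof cases
    case 1
    then show ?thesis unfolding EH_def using assms(2) by blast
  next
    case 2
    then show ?thesis using adjacent_H[of x q x "flip j q"] assms by blast
  qed
qed

lemma regular_H: "regular_triangle_free VH EH d"
proof
  show "triangle_free EH" by (rule triangle_free_H)
  fix w assume "w \<in> VH"
  then obtain x q where w: "w = (x, q)" "x \<in> V" "q \<subseteq> {..<d}" unfolding VH_def by auto
  let ?A = "(\<lambda>e. e \<times> {q}) ` {e \<in> E. x \<in> e}" and ?B = "(\<lambda>j. {(x, q), (x, flip j q)}) ` {..<deficit x}"
  have "inj_on (\<lambda>e. e \<times> {q}) {e \<in> E. x \<in> e}" by (rule inj_onI) auto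
  then have A: "card ?A = card {e \<in> E. x \<in> e}" by (rule card_image)
  have "inj_on (\<lambda>j. {(x, q), (x, flip j q)}) {..<deficit x}"
    by (rule inj_onI) (auto simp: doubleton_eq_iff flip_eq_iff flip_ne)
  then have B: "card ?B = deficit x" using card_image by fastforce
  have "?A \<inter> ?B = {}"
  proof (intro equalityI subsetI)
    fix e assume "e \<in> ?A \<inter> ?B"
    then obtain e' j where "e = e' \<times> {q}" "e = {(x, q), (x, flip j q)}" by blast
    then have "flip j q = q" by blast
    then show "e \<in> {}" using flip_mem[of j j q] by simp
  qed simp
  then have "card (?A \<union> ?B) = card ?A + card ?B" using finE by (intro card_Un_disjoint) auto
  then show "card {e \<in> EH. w \<in> e} = d"
    using edges_at_H[OF w(2,3)] A B degree_le[of x] unfolding w(1) deficit_def by simp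
qed

lemma extend_1: "e \<in> E \<Longrightarrow> q \<subseteq> {..<d} \<Longrightarrow> extend k \<phi> (e \<times> {q}) = \<phi> e"
proof -
  assume e: "e \<in> E" "q \<subseteq> {..<d}"
  then have "e \<times> {q} \<in> EH" unfolding EH_def by blast
  moreover have "fst ` (e \<times> {q}) = e" by force
  ultimately show ?thesis unfolding extend_def using e by simp
qed

lemma extend_2:
  assumes "x \<in> V" "q \<subseteq> {..<d}" "j < deficit x"
  shows "extend k \<phi> {(x, q), (x, flip j q)} = missing k \<phi> x j"
proof -
  have "{(x, q), (x, flip j q)} \<in> EH" using adjacent_H[of x q x "flip j q"] assms by blast
  moreover have "{x} \<notin> E" using edgeD[of x x] by auto
  ultimately show ?thesis unfolding extend_def using flip_diff[of q j] by simp
qed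

lemma extend_colouring:
  assumes \<phi>: "edge_colouring E k \<phi>" and k: "d \<le> k"
  shows "edge_colouring EH k (extend k \<phi>)"
proof -
  let ?\<Phi> = "extend k \<phi>"
  have cases: "(\<exists>e'\<in>E. x \<in> e' \<and> e = e' \<times> {q} \<and> ?\<Phi> e = \<phi> e')
      \<or> (\<exists>j<deficit x. e = {(x, q), (x, flip j q)} \<and> ?\<Phi> e = missing k \<phi> x j)"
    if e: "e \<in> EH" "(x, q) \<in> e" for e x q
  proof -
    obtain w where "e = {(x, q), w}" using H.edge_at[OF e] by blast
    then have "(x, q) \<in> VH" using H.edgeD e(1) by blast
    then have xq: "x \<in> V" "q \<subseteq> {..<d}" unfolding VH_def by auto
    have "e \<in> (\<lambda>e. e \<times> {q}) ` {e \<in> E. x \<in> e} \<union> (\<lambda>j. {(x, q), (x, flip j q)}) ` {..<deficit x}"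
      using edges_at_H[OF xq] e by blast
    then consider e' where "e = e' \<times> {q}" "e' \<in> E" "x \<in> e'" | j where "e = {(x, q), (x, flip j q)}" "j < deficit x"
      by blast
    then show ?thesis
    proof cases
      case 1
      then show ?thesis using extend_1[OF 1(2) xq(2)] by blast
    next
      case 2
      then show ?thesis using extend_2[OF xq 2(2)] by blast
    qed
  qed
  have "?\<Phi> e \<in> {1..k}" if e: "e \<in> EH" for e
  proof -
    obtain a b where ab: "e = {a, b}" using H.edgeE[OF e] by blast
    obtain x q where "a = (x, q)" by (cases a)
    then have "(x, q) \<in> e" using ab by simp
    from cases[OF e this] show ?thesis
    proof (elim disjE bexE exE conjE)
      fix e' assume "e' \<in> E" "?\<Phi> e = \<phi> e'"
      then show ?thesis using edge_colouring_range[OF \<phi>, of e'] by simp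
    next
      fix j assume "j < deficit x" "?\<Phi> e = missing k \<phi> x j"
      then show ?thesis using missing(1)[OF \<phi> k, of j x] by simp
    qed
  qed
  moreover have "?\<Phi> e = undefined" if "e \<notin> EH" for e using that unfolding extend_def by simp
  ultimately have "?\<Phi> \<in> EH \<rightarrow>\<^sub>E {1..k}" by (rule PiE_I)
  moreover have "?\<Phi> e \<noteq> ?\<Phi> e'" if h: "e \<in> EH" "e' \<in> EH" "e \<noteq> e'" "e \<inter> e' \<noteq> {}" for e e'
  proof
    assume eq: "?\<Phi> e = ?\<Phi> e'"
    obtain x q where xq: "(x, q) \<in> e" "(x, q) \<in> e'" using h(4) by auto
    have no: "missing k \<phi> x j \<noteq> \<phi> e1" if "j < deficit x" "e1 \<in> E" "x \<in> e1" for j e1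
      using missing(1)[OF \<phi> k that(1)] that(2,3) by blast
    from cases[OF h(1) xq(1)] show False
    proof (elim disjE bexE exE conjE)
      fix e1 assume e1: "e1 \<in> E" "x \<in> e1" "e = e1 \<times> {q}" "?\<Phi> e = \<phi> e1"
      from cases[OF h(2) xq(2)] show False
      proof (elim disjE bexE exE conjE)
        fix e2 assume e2: "e2 \<in> E" "x \<in> e2" "e' = e2 \<times> {q}" "?\<Phi> e' = \<phi> e2"
        have "e1 = e2" using edge_colouring_proper[OF \<phi> e1(1) e2(1) e1(2) e2(2)] e1(4) e2(4) eq by simp
        then show False using h(3) e1(3) e2(3) by simp
      next
        fix j assume "j < deficit x" "?\<Phi> e' = missing k \<phi> x j"
        then show False using no[of j e1] e1 eq by simp
      qed
    next
      fix j assume j: "j < deficit x" "e = {(x, q), (x, flip j q)}" "?\<Phi> e = missing k \<phi> x j"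
      from cases[OF h(2) xq(2)] show False
      proof (elim disjE bexE exE conjE)
        fix e2 assume "e2 \<in> E" "x \<in> e2" "?\<Phi> e' = \<phi> e2"
        then show False using no[of j e2] j eq by simp
      next
        fix i assume i: "i < deficit x" "e' = {(x, q), (x, flip i q)}" "?\<Phi> e' = missing k \<phi> x i"
        have "i = j" using missing(2)[OF \<phi> k j(1) i(1)] i(3) j(3) eq by simp
        then show False using h(3) i(2) j(2) by simp
      qed
    qed
  qed
  ultimately show ?thesis unfolding edge_colouring_def by simp
qed

lemma restrict_extend:
  assumes "edge_colouring E k \<phi>"
  shows "(\<lambda>e\<in>E. extend k \<phi> (e \<times> {{}})) = \<phi>"
proof
  fix e
  show "(\<lambda>e\<in>E. extend k \<phi> (e \<times> {{}})) e = \<phi> e"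
    using extend_1[of e "{}"] edge_colouring_undefined[OF assms] by simp
qed

lemma kempe_equivalent_class_one:
  assumes f: "edge_colouring E (Suc d) f" and g: "edge_colouring E (Suc d) g"
  shows "kempe_equivalent E (Suc d) f g"
proof -
  \<comment> \<open>Extending \<open>\<alpha>\<close> as well shows that the regular graph is of
    class one, as \<open>regular_equivalent\<close> requires.\<close>
  have "kempe_equivalent EH (Suc d) (extend (Suc d) f) (extend (Suc d) g)"
    using regular_equivalent[OF regular_H extend_colouring[OF \<alpha>]] extend_colouring f g by simp
  then have "kempe_equivalent E (Suc d) (\<lambda>e\<in>E. extend (Suc d) f (e \<times> {{}})) (\<lambda>e\<in>E. extend (Suc d) g (e \<times> {{}}))"
    by (rule restrict_kempe_equivalent[OF H.simple_graph_axioms simple_graph_axioms]) (auto simp: EH_def)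
  then show ?thesis unfolding restrict_extend[OF f] restrict_extend[OF g] .
qed

end

theorem corollary1p7:
  fixes V :: "'a set" and E :: "'a set set" and f g :: "'a set \<Rightarrow> nat"
  assumes "finite_simple_graph V E"
    and "triangle_free E"
    and "edge_colouring E (chromatic_index E + 1) f"
    and "edge_colouring E (chromatic_index E + 1) g"
  shows "kempe_equivalent E (chromatic_index E + 1) f g"
proof -
  \<comment> \<open>\<open>f\<close> witnesses that some number of colours suffices, so the least
    one is attained.\<close>
  have "\<exists>k \<alpha>. edge_colouring E k \<alpha>" using assms(3) by blast
  then have "\<exists>\<alpha>. edge_colouring E (chromatic_index E) \<alpha>"
    unfolding chromatic_index_def by (rule LeastI_ex)
  then obtain \<alpha> where "edge_colouring E (chromatic_index E) \<alpha>" by blast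
  then interpret class_one V E "chromatic_index E" \<alpha>
    using assms(1,2) by unfold_locales
  show ?thesis using kempe_equivalent_class_one assms(3,4) by simp
qed

end
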